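(* Let $0<T<\infty$, $0<\gamma<1$, $m\in C^1([0,T])$, and $$Au=\frac{t^{-\gamma}}{\Gamma(1-\gamma)}\ast u,\qquad Bu=m\ast u,$$ where $(f\ast u)(t)=\int_0^t f(t-s)u(s)\,ds$. Let $R_1(\delta)$ be defined by $$(R_1(\delta)g_\delta)(t):=\frac1{\Gamma(\gamma)}\int_0^t\frac{(R(\delta)g_\delta)(s)}{(t-s)^{1-\gamma}}\,ds,\qquad (R(\delta)g_\delta)(t):=\frac{g_\delta(t+h(\delta))-g_\delta(t)}{h(\delta)},\qquad h(\delta)=2\left(\frac{\delta}{m_2}\right)^{1/2},$$ where $m_2>0$ is a constant with $\|u\|_{W^{2,\infty}}\le m_2$ for the exact solution $u$. Then: (1) $R_1(\delta)$ is a regularizer for the equation $Au=g$; (2) the operator $S:=A^{-1}B$ is compact in $L^2(0,T)$; (3) $N(I+S)=\{0\}$, where $N(\cdot)$ denotes the null space and $I$ the identity on $L^2(0,T)$.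
   Context: $A^{-1}$ is given by $(A^{-1}g)(t)=\frac1{\Gamma(\gamma)}\int_0^t\frac{g'(s)}{(t-s)^{1-\gamma}}\,ds$ (for $g$ in the range of $A$). Regularizer: let $u$ be the exact solution on $(0,T)$, $\|u\|_{W^{2,\infty}(0,T)}\le m_2$, and $g=Au$. Noisy data $g_\delta$ satisfy $\sup_t|g_\delta(t)-g(t)|\le\delta$. The family $R_1(\delta)$ is called a regularizer for $Au=g$ if $\|R_1(\delta)g_\delta-u\|\to0$ as $\delta\to0$, the norm being that of $L^2(0,T)$. By convention, $u$ is extended by $0$ for $t>T$, $g$ is defined for $t>T$ by $g(t)=(Au)(t)$, and the data $g_\delta$ are given for $t>T$ as well (so that $g_\delta(t+h)$ makes sense for $t\in[0,T]$). *)

theory Defs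
  imports "HOL-Analysis.Analysis" "HOL-Probability.Essential_Supremum"
begin

section \<open>The space \<open>L\<^sup>2(0,T)\<close> and operators in it\<close>

text \<open>
  Elements of \<open>L\<^sup>2(0,T)\<close> are represented by functions \<open>real \<Rightarrow> real\<close>, of which only the
  restriction to \<open>(0,T)\<close> matters and which are identified if they agree almost everywhere there.
\<close>

abbreviation I_meas :: "real \<Rightarrow> real measure" where
  "I_meas T \<equiv> lebesgue_on {0<..<T}"

definition L2 :: "real \<Rightarrow> (real \<Rightarrow> real) set" where
  "L2 T = {f \<in> borel_measurable (I_meas T). integrable (I_meas T) (\<lambda>t. (f t)\<^sup>2)}"

text \<open>Meaningful for members of \<^term>\<open>L2 T\<close> only: other functions get the value \<open>0\<close>, the default
  value of the integral.\<close>

definition L2_norm :: "real \<Rightarrow> (real \<Rightarrow> real) \<Rightarrow> real" where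
  "L2_norm T f = sqrt (\<integral>t. (f t)\<^sup>2 \<partial>I_meas T)"

definition L2_eq :: "real \<Rightarrow> (real \<Rightarrow> real) \<Rightarrow> (real \<Rightarrow> real) \<Rightarrow> bool" where
  "L2_eq T f g \<longleftrightarrow> (AE t in I_meas T. f t = g t)"

definition L2_linear_operator :: "real \<Rightarrow> ((real \<Rightarrow> real) \<Rightarrow> real \<Rightarrow> real) \<Rightarrow> bool" where
  "L2_linear_operator T F \<longleftrightarrow>
     (\<forall>f\<in>L2 T. F f \<in> L2 T) \<and>
     (\<forall>f\<in>L2 T. \<forall>g\<in>L2 T. L2_eq T f g \<longrightarrow> L2_eq T (F f) (F g)) \<and>
     (\<forall>f\<in>L2 T. \<forall>g\<in>L2 T. \<forall>a b.
        L2_eq T (F (\<lambda>t. a * f t + b * g t)) (\<lambda>t. a * F f t + b * F g t))"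

text \<open>Linear, and the image of every bounded sequence has a convergent subsequence.\<close>

definition L2_compact_operator :: "real \<Rightarrow> ((real \<Rightarrow> real) \<Rightarrow> real \<Rightarrow> real) \<Rightarrow> bool" where
  "L2_compact_operator T F \<longleftrightarrow>
     L2_linear_operator T F \<and>
     (\<forall>f :: nat \<Rightarrow> real \<Rightarrow> real.
        (\<forall>n. f n \<in> L2 T) \<and> (\<exists>C. \<forall>n. L2_norm T (f n) \<le> C) \<longrightarrow>
        (\<exists>(r :: nat \<Rightarrow> nat) v. strict_mono r \<and> v \<in> L2 T \<and>
           (\<lambda>n. L2_norm T (\<lambda>t. F (f (r n)) t - v t)) \<longlonglongrightarrow> 0))"

definition L2_null_space :: "real \<Rightarrow> ((real \<Rightarrow> real) \<Rightarrow> real \<Rightarrow> real) \<Rightarrow> (real \<Rightarrow> real) set" where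
  "L2_null_space T F = {u \<in> L2 T. L2_eq T (F u) (\<lambda>t. 0)}"

text \<open>The zero element of \<open>L\<^sup>2(0,T)\<close>, as the set of its representatives.\<close>

definition L2_zero :: "real \<Rightarrow> (real \<Rightarrow> real) set" where
  "L2_zero T = {u \<in> L2 T. L2_eq T u (\<lambda>t. 0)}"


section \<open>The spaces \<open>W\<^sup>2\<^sup>,\<^sup>\<infinity>(0,T)\<close> and \<open>C\<^sup>1([0,T])\<close>\<close>

definition Linf_norm :: "real \<Rightarrow> (real \<Rightarrow> real) \<Rightarrow> ereal" where
  "Linf_norm T f = esssup (I_meas T) (\<lambda>t. ereal \<bar>f t\<bar>)"

definition Linf :: "real \<Rightarrow> (real \<Rightarrow> real) set" where
  "Linf T = {f \<in> borel_measurable (I_meas T). Linf_norm T f < \<infinity>}"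

text \<open>Test functions: \<open>C\<^sub>c\<^sup>\<infinity>(0,T)\<close>.\<close>

definition test_fun :: "real \<Rightarrow> (real \<Rightarrow> real) \<Rightarrow> bool" where
  "test_fun T \<phi> \<longleftrightarrow>
     (\<forall>k x. ((deriv ^^ k) \<phi>) differentiable (at x)) \<and>
     compact (closure {x. \<phi> x \<noteq> 0}) \<and> closure {x. \<phi> x \<noteq> 0} \<subseteq> {0<..<T}"

text \<open>\<open>v\<close> is the \<open>k\<close>-th weak derivative of \<open>u\<close>; only used for \<open>u\<close> and \<open>v\<close> in \<^term>\<open>Linf T\<close>.\<close>

definition has_weak_deriv :: "real \<Rightarrow> nat \<Rightarrow> (real \<Rightarrow> real) \<Rightarrow> (real \<Rightarrow> real) \<Rightarrow> bool" where
  "has_weak_deriv T k u v \<longleftrightarrow>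
     (\<forall>\<phi>. test_fun T \<phi> \<longrightarrow>
        (\<integral>t. u t * (deriv ^^ k) \<phi> t \<partial>I_meas T) = (-1) ^ k * (\<integral>t. v t * \<phi> t \<partial>I_meas T))"

definition W2inf :: "real \<Rightarrow> (real \<Rightarrow> real) set" where
  "W2inf T = {u \<in> Linf T. \<forall>k\<in>{1, 2}. \<exists>v\<in>Linf T. has_weak_deriv T k u v}"

definition weak_deriv :: "real \<Rightarrow> nat \<Rightarrow> (real \<Rightarrow> real) \<Rightarrow> real \<Rightarrow> real" where
  "weak_deriv T k u = (SOME v. v \<in> Linf T \<and> has_weak_deriv T k u v)"

text \<open>
  The maximum convention. It is dominated by the sum of the three \<open>L\<^sup>\<infinity>\<close> norms, so that a bound
  on it is the weaker hypothesis.
\<close>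

definition W2inf_norm :: "real \<Rightarrow> (real \<Rightarrow> real) \<Rightarrow> ereal" where
  "W2inf_norm T u =
     Max {Linf_norm T u, Linf_norm T (weak_deriv T 1 u), Linf_norm T (weak_deriv T 2 u)}"

text \<open>Derivatives at the end points are one-sided.\<close>

definition C1_on_interval :: "real \<Rightarrow> (real \<Rightarrow> real) \<Rightarrow> bool" where
  "C1_on_interval T m \<longleftrightarrow>
     (\<exists>m'. (\<forall>t\<in>{0..T}. (m has_real_derivative m' t) (at t within {0..T})) \<and>
           continuous_on {0..T} m')"


section \<open>The operators \<open>A\<close>, \<open>B\<close> and \<open>A\<inverse>B\<close>\<close>

definition conv :: "(real \<Rightarrow> real) \<Rightarrow> (real \<Rightarrow> real) \<Rightarrow> real \<Rightarrow> real" where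
  "conv f u t = (LINT s:{0..t}|lebesgue. f (t - s) * u s)"

definition op_A :: "real \<Rightarrow> (real \<Rightarrow> real) \<Rightarrow> real \<Rightarrow> real" where
  "op_A \<gamma> u = conv (\<lambda>t. t powr (- \<gamma>) / Gamma (1 - \<gamma>)) u"

definition op_B :: "(real \<Rightarrow> real) \<Rightarrow> (real \<Rightarrow> real) \<Rightarrow> real \<Rightarrow> real" where
  "op_B m u = conv m u"

definition range_A :: "real \<Rightarrow> real \<Rightarrow> (real \<Rightarrow> real) set" where
  "range_A T \<gamma> = {g. \<exists>v\<in>L2 T. L2_eq T (op_A \<gamma> v) g}"

text \<open>
  The operator is partial: outside the range of \<open>A\<close> its value is left unspecified, so that any
  statement about \<open>A\<inverse>B\<close> on \<open>L\<^sup>2(0,T)\<close> includes that \<open>B\<close> maps into the range of \<open>A\<close>.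
\<close>

definition A_inv :: "real \<Rightarrow> real \<Rightarrow> (real \<Rightarrow> real) \<Rightarrow> real \<Rightarrow> real" where
  "A_inv T \<gamma> g =
     (if g \<in> range_A T \<gamma>
      then (\<lambda>t. 1 / Gamma \<gamma> * (LINT s:{0..t}|lebesgue. deriv g s / (t - s) powr (1 - \<gamma>)))
      else undefined)"

definition op_S :: "real \<Rightarrow> real \<Rightarrow> (real \<Rightarrow> real) \<Rightarrow> (real \<Rightarrow> real) \<Rightarrow> real \<Rightarrow> real" where
  "op_S T \<gamma> m u = A_inv T \<gamma> (op_B m u)"


section \<open>Regularization\<close>

definition step_size :: "real \<Rightarrow> real \<Rightarrow> real" where
  "step_size m\<^sub>2 \<delta> = 2 * sqrt (\<delta> / m\<^sub>2)"

definition R_op :: "real \<Rightarrow> real \<Rightarrow> (real \<Rightarrow> real) \<Rightarrow> real \<Rightarrow> real" where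
  "R_op m\<^sub>2 \<delta> g t = (g (t + step_size m\<^sub>2 \<delta>) - g t) / step_size m\<^sub>2 \<delta>"

definition R1_op :: "real \<Rightarrow> real \<Rightarrow> real \<Rightarrow> (real \<Rightarrow> real) \<Rightarrow> real \<Rightarrow> real" where
  "R1_op \<gamma> m\<^sub>2 \<delta> g t =
     1 / Gamma \<gamma> * (LINT s:{0..t}|lebesgue. R_op m\<^sub>2 \<delta> g s / (t - s) powr (1 - \<gamma>))"

definition zero_extension :: "real \<Rightarrow> (real \<Rightarrow> real) \<Rightarrow> real \<Rightarrow> real" where
  "zero_extension T u t = (if t \<in> {0..T} then u t else 0)"

text \<open>
  Exact solutions \<open>u\<close> range over the ball of radius \<open>m\<^sub>2\<close> in \<open>W\<^sup>2\<^sup>,\<^sup>\<infinity>(0,T)\<close>. The exact data are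
  \<open>A\<close> applied to the extension of \<open>u\<close> by zero, and the noisy data, given on \<open>[0,\<infinity>)\<close>, form an
  arbitrary family of measurable functions within distance \<open>\<delta>\<close> of them.
\<close>

definition regularizer ::
  "real \<Rightarrow> ((real \<Rightarrow> real) \<Rightarrow> real \<Rightarrow> real) \<Rightarrow> real \<Rightarrow>
     (real \<Rightarrow> (real \<Rightarrow> real) \<Rightarrow> real \<Rightarrow> real) \<Rightarrow> bool" where
  "regularizer T A m\<^sub>2 R \<longleftrightarrow>
     (\<forall>u g g\<^sub>\<delta>.
        u \<in> W2inf T \<and> W2inf_norm T u \<le> ereal m\<^sub>2 \<and>
        g = A (zero_extension T u) \<and>
        (\<forall>\<delta>>0. g\<^sub>\<delta> \<delta> \<in> borel_measurable (lebesgue_on {0..}) \<and> (\<forall>t\<ge>0. \<bar>g\<^sub>\<delta> \<delta> t - g t\<bar> \<le> \<delta>)) \<longrightarrow>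
        (\<forall>\<delta>>0. R \<delta> (g\<^sub>\<delta> \<delta>) \<in> L2 T) \<and>
        ((\<lambda>\<delta>. L2_norm T (\<lambda>t. R \<delta> (g\<^sub>\<delta> \<delta>) t - u t)) \<longlongrightarrow> 0) (at_right 0))"

end

theory Submission
  imports Defs "HOL-Complex_Analysis.Great_Picard"
begin

text \<open>
  Write \<open>k\<^sub>a(t) = t\<^bsup>a-1\<^esup>/\<Gamma>(a)\<close> for the Riemann--Liouville kernels, so that \<open>k\<^sub>a \<ast> k\<^sub>b = k\<^bsub>a+b\<^esub>\<close>.

  (1) With \<open>U = 1 \<ast> u\<close> one has \<open>k\<^sub>\<gamma> \<ast> g = U\<close>, hence the regularized exact data equal the
  difference quotient of \<open>U\<close> minus \<open>(1/h) \<integral>\<^sub>0\<^sup>h k\<^sub>\<gamma>(t+h-s) g(s) ds\<close>. The difference quotient tends to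
  \<open>u\<close> almost everywhere by Lebesgue's differentiation theorem, the remainder tends to \<open>0\<close> for
  every \<open>t > 0\<close>, both stay bounded, and the noise contributes \<open>O(\<delta>/h) = O(h)\<close>. Dominated
  convergence gives the limit in \<open>L\<^sup>2\<close>.

  (2) Almost everywhere \<open>(m \<ast> u)' = w\<close> with \<open>w = m(0) u + m' \<ast> u\<close>, hence \<open>S u = k\<^sub>\<gamma> \<ast> w\<close>. If \<open>w\<^sub>n\<close>
  is bounded in \<open>L\<^sup>2\<close>, then the primitives of \<open>w\<^sub>n\<close> are equicontinuous and a subsequence of them
  converges uniformly. Approximating \<open>k\<^sub>\<gamma>\<close> in \<open>L\<^sup>1\<close> by smooth kernels, Young's inequality shows that
  \<open>k\<^sub>\<gamma> \<ast> w\<^sub>n\<close> is a Cauchy sequence along this subsequence.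

  (3) If \<open>u + k\<^sub>\<gamma> \<ast> w = 0\<close>, multiply by \<open>e\<^bsup>ct\<^esup>\<close> with \<open>c \<rightarrow> -\<infinity>\<close>: the weight passes to both factors of
  the convolution, and the \<open>L\<^sup>1\<close> norm of \<open>e\<^bsup>ct\<^esup> k\<^sub>\<gamma>\<close> tends to \<open>0\<close>, so that \<open>u\<close> is dominated by half of
  its own weighted norm.
\<close>

section \<open>Lebesgue differentiation on the line\<close>

text \<open>For \<gamma> \<le> 1/2 the kernel k_\<gamma> is integrable but not square integrable
  near 0, and this shapes all three parts. S cannot be treated as a Hilbert-Schmidt operator with an
  L^2 convolution kernel; every L^2 bound comes from Young's inequality with the kernel in L^1; the
  convolution of k_\<gamma> with an L^2 function is controlled only almost everywhere; and in (1)
  the bound that makes the remainder vanish at each t > 0, of order h^(1-\<gamma>) t^(\<gamma>-1),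
  is no L^2 majorant, so a second bound uniform in t stands beside it.

  Passing to U avoids differentiating g: u may be nonzero at 0 and may jump at T, where g' can be
  singular, whereas U is Lipschitz.

  The step h = 2 (\<delta>/m_2)^(1/2) minimises 2\<delta>/h + m_2 h/2, the noise plus the error of a
  forward quotient under a second derivative bound m_2. At the minimum both terms agree, so the
  noise costs m_2 h/2.

  Convolutions are taken over the whole line, for Borel functions and \<open>lborel\<close>, where
  translations and Fubini are at hand. Elements of L^2(0,T) enter through Borel representatives that
  vanish off (0,T).\<close>

lemma henstock_bad_intervals_negligible:
  fixes f :: "real \<Rightarrow> real"
  assumes f: "f integrable_on {a..b}" and e: "0 < e"
  shows "negligible {x. \<forall>d>0. \<exists>y z. y \<le> x \<and> x \<le> z \<and> y < z \<and> z - y < d \<and> a \<le> y \<and> z \<le> b \<and>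
            e * (z - y) < \<bar>(z - y) * f x - integral {y..z} f\<bar>}" (is "negligible ?E")
  unfolding negligible_outer_le
proof (intro allI impI)
  fix \<epsilon> :: real assume \<epsilon>: "0 < \<epsilon>"
  have f': "f integrable_on cbox a b" using f by simp
  obtain \<gamma> where \<gamma>: "gauge \<gamma>"
    and hen: "\<And>p. \<lbrakk>p tagged_partial_division_of (cbox a b); \<gamma> fine p\<rbrakk> \<Longrightarrow>
             (\<Sum>(x,k)\<in>p. norm (measure lborel k *\<^sub>R f x - integral k f)) < \<epsilon> * e"
    using Henstock_lemma[OF f', of "\<epsilon> * e"] \<epsilon> e by auto
  \<comment> \<open>A triple (x, y, z) is a bad interval [y, z] tagged by x and small enough for the
    gauge. Such intervals shrink to every point of the bad set, which is what the Vitali covering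
    theorem asks for.\<close>
  define K where "K = {(x, y, z). y \<le> x \<and> x \<le> z \<and> y < z \<and> a \<le> y \<and> z \<le> b \<and> {y..z} \<subseteq> \<gamma> x \<and>
            e * (z - y) < \<bar>(z - y) * f x - integral {y..z} f\<bar>}"
  define c where "c = (\<lambda>i::real\<times>real\<times>real. (fst (snd i) + snd (snd i)) / 2)"
  define r where "r = (\<lambda>i::real\<times>real\<times>real. (snd (snd i) - fst (snd i)) / 2)"
  have cb: "cball (c i) (r i) = {fst (snd i)..snd (snd i)}" for i
    by (simp add: cball_eq_atLeastAtMost c_def r_def field_simps)
  have cov: "\<exists>i. i \<in> K \<and> x \<in> cball (c i) (r i) \<and> r i < d" if x: "x \<in> ?E" and d: "0 < d" for x d
  proof -
    have "open (\<gamma> x)" "x \<in> \<gamma> x" using \<gamma> by (auto simp: gauge_def)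
    then obtain \<rho> where \<rho>: "\<rho> > 0" "ball x \<rho> \<subseteq> \<gamma> x" using open_contains_ball by blast
    with x d obtain y z where yz: "y \<le> x" "x \<le> z" "y < z" "z - y < min d \<rho>" "a \<le> y" "z \<le> b"
      "e * (z - y) < \<bar>(z - y) * f x - integral {y..z} f\<bar>"
      unfolding mem_Collect_eq by (meson min_less_iff_conj)
    have "{y..z} \<subseteq> ball x \<rho>" using yz by (auto simp: dist_real_def)
    then have "(x, y, z) \<in> K" using yz \<rho> by (auto simp: K_def)
    moreover have "r (x,y,z) < d" using yz by (auto simp: r_def)
    moreover have "x \<in> cball (c (x,y,z)) (r (x,y,z))" using yz by (simp add: cb)
    ultimately show ?thesis by blast
  qed
  have rpos: "0 < r i" if "i \<in> K" for i using that by (auto simp: K_def r_def)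
  obtain C where C: "countable C" "C \<subseteq> K"
     "pairwise (\<lambda>i j. disjnt (cball (c i) (r i)) (cball (c j) (r j))) C"
     "negligible (?E - (\<Union>i \<in> C. cball (c i) (r i)))"
    by (rule Vitali_covering_theorem_cballs[of K r ?E c, OF rpos cov]) blast
  let ?B = "\<lambda>i. cball (c i) (r i)"
  \<comment> \<open>Disjoint bad intervals form a fine tagged partial division. Each has an error
    above e times its length, while Henstock's lemma keeps the total error below \<epsilon> e; hence
    their total length is at most \<epsilon>.\<close>
  have fin: "(\<Sum>i\<in>D. measure lebesgue (?B i)) \<le> \<epsilon>" if D: "finite D" "D \<subseteq> C" for D
  proof -
    let ?h = "\<lambda>i. (fst i, ?B i)"
    have DK: "D \<subseteq> K" using D C by auto
    \<comment> \<open>Henstock's sum runs over the pairs (tag, interval). Two triples with the same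
      pair would put one tag into two disjoint balls.\<close>
    have inj: "inj_on ?h D"
    proof (rule inj_onI)
      fix i j assume ij: "i \<in> D" "j \<in> D" "?h i = ?h j"
      show "i = j"
      proof (rule ccontr)
        assume "i \<noteq> j"
        then have "disjnt (?B i) (?B j)" using C(3) ij(1,2) D by (blast dest: pairwiseD)
        moreover have "fst i \<in> ?B i" using ij DK by (auto simp: K_def cb)
        moreover have "?B i = ?B j" using ij(3) by blast
        ultimately show False unfolding disjnt_def by blast
      qed
    qed
    have tag: "?h ` D tagged_partial_division_of cbox a b"
      unfolding tagged_partial_division_of_def
    proof (intro conjI allI impI, goal_cases)
      case 1
      show ?case using D by simp
    next
      case (2 x k)
      then obtain i where i: "i \<in> D" "x = fst i" "k = ?B i" by auto
      then have "i \<in> K" using DK by auto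
      then show ?case using i by (auto simp: cb K_def)
    next
      case (3 x k)
      then obtain i where i: "i \<in> D" "x = fst i" "k = ?B i" by auto
      then have "i \<in> K" using DK by auto
      then show ?case using i by (auto simp: cb K_def)
    next
      case (4 x k)
      then obtain i where "k = ?B i" by auto
      then show ?case by (metis cb cbox_interval)
    next
      case (5 x k x' k')
      obtain i where i: "i \<in> D" "x = fst i" "k = ?B i" using 5 by auto
      obtain j where j: "j \<in> D" "x' = fst j" "k' = ?B j" using 5 by auto
      have "i \<noteq> j" using 5 i j by auto
      then have "disjnt (?B i) (?B j)" using C(3) i(1) j(1) D by (blast dest: pairwiseD)
      then show ?case
        using i j interior_subset[of k] interior_subset[of k'] unfolding disjnt_def by blast
    qed
    have "?B i \<subseteq> \<gamma> (fst i)" if "i \<in> D" for i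
      using that DK unfolding cb by (cases i) (auto simp: K_def)
    then have fine: "\<gamma> fine ?h ` D" by (auto simp: fine_def)
    have "(\<Sum>i\<in>D. e * measure lebesgue (?B i)) \<le> (\<Sum>i\<in>D. norm (measure lborel (?B i) *\<^sub>R f (fst i) - integral (?B i) f))"
    proof (rule sum_mono)
      fix i assume "i \<in> D"
      then have "i \<in> K" using DK by auto
      then show "e * measure lebesgue (?B i) \<le> norm (measure lborel (?B i) *\<^sub>R f (fst i) - integral (?B i) f)"
        unfolding cb by (auto simp: K_def)
    qed
    also have "\<dots> = (\<Sum>(x,k)\<in>?h ` D. norm (measure lborel k *\<^sub>R f x - integral k f))"
      by (subst sum.reindex[OF inj]) simp
    also have "\<dots> < \<epsilon> * e" by (rule hen[OF tag fine])
    finally show ?thesis using e by (simp add: sum_distrib_left[symmetric] mult.commute)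
  qed
  have meas: "(\<Union>i\<in>C. ?B i) \<in> lmeasurable" "measure lebesgue (\<Union>i\<in>C. ?B i) \<le> \<epsilon>"
  proof -
    have *: "measure lebesgue (\<Union> (?B ` D)) \<le> \<epsilon>" if "D \<subseteq> C" "finite D" for D
      using measure_UNION_le[of D ?B lebesgue] fin[OF that(2,1)] that by auto
    show "(\<Union>i\<in>C. ?B i) \<in> lmeasurable" "measure lebesgue (\<Union>i\<in>C. ?B i) \<le> \<epsilon>"
      using fmeasurable_UN_bound[OF C(1), of ?B lebesgue \<epsilon>] measure_UN_bound[OF C(1), of ?B lebesgue \<epsilon>] * by auto
  qed
  let ?N = "?E - (\<Union>i \<in> C. ?B i)"
  have N: "?N \<in> lmeasurable" "measure lebesgue ?N = 0"
    using C(4) by (auto simp: negligible_iff_measure)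
  show "\<exists>U. ?E \<subseteq> U \<and> U \<in> lmeasurable \<and> measure lebesgue U \<le> \<epsilon>"
  proof (intro exI conjI)
    show "?E \<subseteq> (\<Union>i\<in>C. ?B i) \<union> ?N" by auto
    show "(\<Union>i\<in>C. ?B i) \<union> ?N \<in> lmeasurable" by (rule fmeasurable.Un[OF meas(1) N(1)])
    have "measure lebesgue ((\<Union>i\<in>C. ?B i) \<union> ?N) \<le> measure lebesgue (\<Union>i\<in>C. ?B i) + measure lebesgue ?N"
      using meas N by (intro measure_Un_le) (auto dest: fmeasurableD)
    then show "measure lebesgue ((\<Union>i\<in>C. ?B i) \<union> ?N) \<le> \<epsilon>" using meas N by simp
  qed
qed

text \<open>A point that is bad for none of the tolerances 1/(n+1) is a point of differentiability,
  and the exceptional set is then inside a countable union of null sets.\<close>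

theorem negligible_not_has_real_derivative_integral:
  fixes f :: "real \<Rightarrow> real"
  assumes f: "f integrable_on {a..b}"
  shows "negligible {x\<in>{a<..<b}. \<not> ((\<lambda>t. integral {a..t} f) has_real_derivative f x) (at x)}"
proof -
  define E where "E = (\<lambda>e::real. {x. \<forall>d>0. \<exists>y z. y \<le> x \<and> x \<le> z \<and> y < z \<and> z - y < d \<and> a \<le> y \<and> z \<le> b \<and>
            e * (z - y) < \<bar>(z - y) * f x - integral {y..z} f\<bar>})"
  have neg: "negligible (\<Union>n. E (1 / Suc n))"
    unfolding E_def by (intro negligible_Union_nat henstock_bad_intervals_negligible f) simp
  let ?F = "\<lambda>t. integral {a..t} f"
  have "(?F has_real_derivative f x) (at x)" if x: "a < x" "x < b" "x \<notin> (\<Union>n. E (1 / Suc n))" for x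
    unfolding has_field_derivative_iff LIM_eq
  proof (intro allI impI)
    fix r :: real assume "0 < r"
    then obtain n where n: "1 / Suc n < r" using nat_approx_posE by metis
    have "x \<notin> E (1 / Suc n)" using x by blast
    then obtain d where d: "d > 0" and
      D: "\<And>y z. y \<le> x \<Longrightarrow> x \<le> z \<Longrightarrow> y < z \<Longrightarrow> z - y < d \<Longrightarrow> a \<le> y \<Longrightarrow> z \<le> b \<Longrightarrow>
            \<bar>(z - y) * f x - integral {y..z} f\<bar> \<le> 1 / Suc n * (z - y)"
      unfolding E_def mem_Collect_eq by (meson not_less)
    have F: "?F z - ?F y = integral {y..z} f" if "a \<le> y" "y \<le> z" "z \<le> b" for y z
      using Henstock_Kurzweil_Integration.integral_combine[of a y z f] that
        integrable_on_subinterval[OF f, of a z] by auto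
    show "\<exists>s>0. \<forall>y. y \<noteq> x \<and> norm (y - x) < s \<longrightarrow> norm ((?F y - ?F x) / (y - x) - f x) < r"
    proof (intro exI[of _ "min d (min (x - a) (b - x))"] conjI allI impI)
      show "0 < min d (min (x - a) (b - x))" using d x by auto
      fix y assume y: "y \<noteq> x \<and> norm (y - x) < min d (min (x - a) (b - x))"
      \<comment> \<open>The intervals in \<open>E\<close> may have x as an end point, so
        \<open>D\<close> applies to [x, y] and to [y, x] alike, which yields the two-sided
        derivative.\<close>
      have *: "\<bar>?F y - ?F x - (y - x) * f x\<bar> \<le> 1 / Suc n * \<bar>y - x\<bar>"
      proof (cases "x < y")
        case True
        then show ?thesis using D[of x y] F[of x y] y x by (auto simp: abs_minus_commute)
      next
        case False
        then have "y < x" using y by auto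
        moreover have "?F x - ?F y = integral {y..x} f" using F[of y x] y x \<open>y < x\<close> by auto
        moreover have "\<bar>(x - y) * f x - integral {y..x} f\<bar> \<le> 1 / Suc n * (x - y)"
          using D[of y x] y x \<open>y < x\<close> by auto
        ultimately show ?thesis by (simp add: left_diff_distrib)
      qed
      have "norm ((?F y - ?F x) / (y - x) - f x) = \<bar>?F y - ?F x - (y - x) * f x\<bar> / \<bar>y - x\<bar>"
        using y by (simp add: field_simps abs_divide[symmetric] del: abs_divide)
      also have "\<dots> \<le> 1 / Suc n" using * y by (simp add: pos_divide_le_eq)
      finally show "norm ((?F y - ?F x) / (y - x) - f x) < r" using n by simp
    qed
  qed
  then show ?thesis by (intro negligible_subset[OF neg]) (auto simp del: UN_iff)
qed

section \<open>Convolution and Young's inequality\<close>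

text \<open>Companion of \<open>convol\<close> with values in \<open>ennreal\<close>, where Tonelli
  gives associativity unconditionally. Finiteness of \<open>nnconvol (nnabs f) (nnabs g) t\<close>
  is exactly absolute convergence of \<open>convol f g t\<close>, so it carries all integrability
  conditions.\<close>

definition nnconvol :: "(real \<Rightarrow> ennreal) \<Rightarrow> (real \<Rightarrow> ennreal) \<Rightarrow> real \<Rightarrow> ennreal" where
  "nnconvol f g t = (\<integral>\<^sup>+s. f (t - s) * g s \<partial>lborel)"

definition convol :: "(real \<Rightarrow> real) \<Rightarrow> (real \<Rightarrow> real) \<Rightarrow> real \<Rightarrow> real" where
  "convol f g t = (\<integral>s. f (t - s) * g s \<partial>lborel)"

definition nnabs :: "(real \<Rightarrow> real) \<Rightarrow> real \<Rightarrow> ennreal" where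
  "nnabs f x = ennreal \<bar>f x\<bar>"

lemma nnabs_measurable [measurable]: "f \<in> borel_measurable borel \<Longrightarrow> nnabs f \<in> borel_measurable borel"
  unfolding nnabs_def by measurable

lemma nnconvol_measurable [measurable]:
  assumes [measurable]: "f \<in> borel_measurable borel" "g \<in> borel_measurable borel"
  shows "nnconvol f g \<in> borel_measurable borel"
  unfolding nnconvol_def by measurable

lemma convol_measurable [measurable]:
  assumes [measurable]: "f \<in> borel_measurable borel" "g \<in> borel_measurable borel"
  shows "convol f g \<in> borel_measurable borel"
  unfolding convol_def by measurable

lemma nnconvol_commute:
  assumes [measurable]: "f \<in> borel_measurable borel" "g \<in> borel_measurable borel"
  shows "nnconvol f g t = nnconvol g f t"
  unfolding nnconvol_def
  by (subst nn_integral_real_affine[where c="-1" and t=t]) (auto simp: mult.commute)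

lemma convol_commute: "convol f g t = convol g f t"
  unfolding convol_def
  by (subst lborel_integral_real_affine[where c="-1" and t=t]) (auto simp: mult.commute)

lemma nn_integral_lborel_translate:
  fixes f :: "real \<Rightarrow> ennreal"
  assumes [measurable]: "f \<in> borel_measurable borel"
  shows "(\<integral>\<^sup>+x. f (x - r) \<partial>lborel) = (\<integral>\<^sup>+x. f x \<partial>lborel)"
  using nn_integral_real_affine[of f 1 "-r"] by (simp add: algebra_simps)

lemma nnconvol_assoc:
  assumes [measurable]: "f \<in> borel_measurable borel" "g \<in> borel_measurable borel" "h \<in> borel_measurable borel"
  shows "nnconvol f (nnconvol g h) t = nnconvol (nnconvol f g) h t"
proof -
  have "nnconvol f (nnconvol g h) t = (\<integral>\<^sup>+s. \<integral>\<^sup>+r. f (t - s) * (g (s - r) * h r) \<partial>lborel \<partial>lborel)"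
    unfolding nnconvol_def by (subst nn_integral_cmult) auto
  also have "\<dots> = (\<integral>\<^sup>+r. \<integral>\<^sup>+s. f (t - s) * (g (s - r) * h r) \<partial>lborel \<partial>lborel)"
    by (rule lborel_pair.Fubini') measurable
  also have "\<dots> = (\<integral>\<^sup>+r. (\<integral>\<^sup>+s. f (t - s) * g (s - r) \<partial>lborel) * h r \<partial>lborel)"
    by (subst nn_integral_multc[symmetric]) (auto simp: mult.assoc)
  also have "(\<lambda>r. \<integral>\<^sup>+s. f (t - s) * g (s - r) \<partial>lborel) = (\<lambda>r. \<integral>\<^sup>+s. f (t - r - s) * g s \<partial>lborel)"
  proof
    fix r
    show "(\<integral>\<^sup>+s. f (t - s) * g (s - r) \<partial>lborel) = (\<integral>\<^sup>+s. f (t - r - s) * g s \<partial>lborel)"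
      using nn_integral_lborel_translate[of "\<lambda>s. f (t - r - s) * g s" r] by simp
  qed
  finally show ?thesis unfolding nnconvol_def .
qed

lemma nnconvol_mono:
  assumes "\<And>x. f x \<le> f' x" "\<And>x. g x \<le> g' x"
  shows "nnconvol f g t \<le> nnconvol f' g' t"
  unfolding nnconvol_def by (intro nn_integral_mono mult_mono) (auto simp: assms)

lemma nnconvol_nnabs:
  "nnconvol (nnabs f) (nnabs g) t = (\<integral>\<^sup>+s. ennreal (norm (f (t - s) * g s)) \<partial>lborel)"
  unfolding nnconvol_def nnabs_def by (simp add: abs_mult ennreal_mult)

lemma convol_integrable_iff:
  assumes [measurable]: "f \<in> borel_measurable borel" "g \<in> borel_measurable borel"
  shows "integrable lborel (\<lambda>s. f (t - s) * g s) \<longleftrightarrow> nnconvol (nnabs f) (nnabs g) t < \<infinity>"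
  unfolding integrable_iff_bounded nnconvol_nnabs by simp

lemma nnabs_convol_le: "nnabs (convol f g) t \<le> nnconvol (nnabs f) (nnabs g) t"
proof (cases "integrable lborel (\<lambda>s. f (t - s) * g s)")
  case True
  show ?thesis
    using integral_norm_bound_ennreal[OF True] by (simp add: nnabs_def convol_def nnconvol_nnabs)
next
  case False
  then show ?thesis by (simp add: nnabs_def convol_def not_integrable_integral_eq)
qed

text \<open>Fubini at the single point t; the finiteness hypothesis is absolute convergence of the
  double integral there.\<close>

lemma convol_assoc:
  assumes [measurable]: "f \<in> borel_measurable borel" "g \<in> borel_measurable borel" "h \<in> borel_measurable borel"
    and fin: "nnconvol (nnabs f) (nnconvol (nnabs g) (nnabs h)) t < \<infinity>"
  shows "convol f (convol g h) t = convol (convol f g) h t"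
proof -
  let ?F = "\<lambda>s r. f (t - s) * (g (s - r) * h r)"
  have "(\<integral>\<^sup>+s. \<integral>\<^sup>+r. norm (?F s r) \<partial>lborel \<partial>lborel) = nnconvol (nnabs f) (nnconvol (nnabs g) (nnabs h)) t"
    unfolding nnconvol_def nnabs_def by (subst nn_integral_cmult[symmetric]) (auto simp: abs_mult ennreal_mult)
  then have int: "integrable (lborel \<Otimes>\<^sub>M lborel) (\<lambda>(s, r). ?F s r)"
    using fin by (subst integrable_iff_bounded)
      (auto simp: split_beta' lborel.nn_integral_fst[symmetric])
  have "convol f (convol g h) t = (\<integral>s. \<integral>r. ?F s r \<partial>lborel \<partial>lborel)"
    unfolding convol_def by simp
  also have "\<dots> = (\<integral>r. \<integral>s. ?F s r \<partial>lborel \<partial>lborel)"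
    by (rule lborel_pair.Fubini_integral[OF int, symmetric])
  also have "\<dots> = (\<integral>r. (\<integral>s. f (t - s) * g (s - r) \<partial>lborel) * h r \<partial>lborel)"
    by (subst integral_mult_left_zero[symmetric]) (auto simp: mult.assoc)
  also have "(\<lambda>r. \<integral>s. f (t - s) * g (s - r) \<partial>lborel) = (\<lambda>r. \<integral>s. f (t - r - s) * g s \<partial>lborel)"
  proof
    fix r
    show "(\<integral>s. f (t - s) * g (s - r) \<partial>lborel) = (\<integral>s. f (t - r - s) * g s \<partial>lborel)"
      using lborel_integral_real_affine[of 1 "\<lambda>s. f (t - r - s) * g s" "-r"] by simp
  qed
  finally show ?thesis unfolding convol_def .
qed

lemma convol_lin:
  assumes "integrable lborel (\<lambda>s. f (t - s) * g s)" "integrable lborel (\<lambda>s. f (t - s) * h s)"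
  shows "convol f (\<lambda>s. a * g s + b * h s) t = a * convol f g t + b * convol f h t"
proof -
  have "convol f (\<lambda>s. a * g s + b * h s) t = (\<integral>s. a * (f (t - s) * g s) + b * (f (t - s) * h s) \<partial>lborel)"
    unfolding convol_def by (rule Bochner_Integration.integral_cong) (auto simp: algebra_simps)
  then show ?thesis using assms by (simp add: convol_def)
qed

section \<open>Young's inequality with an L^1 kernel, on the line and on (0,T)\<close>

lemma nn_integral_nnconvol:
  fixes f g :: "real \<Rightarrow> ennreal"
  assumes [measurable]: "f \<in> borel_measurable borel" "g \<in> borel_measurable borel"
  shows "(\<integral>\<^sup>+t. nnconvol f g t \<partial>lborel) = (\<integral>\<^sup>+t. f t \<partial>lborel) * (\<integral>\<^sup>+t. g t \<partial>lborel)"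
proof -
  have "(\<integral>\<^sup>+t. nnconvol f g t \<partial>lborel) = (\<integral>\<^sup>+s. \<integral>\<^sup>+t. f (t - s) * g s \<partial>lborel \<partial>lborel)"
    unfolding nnconvol_def by (rule lborel_pair.Fubini') measurable
  also have "\<dots> = (\<integral>\<^sup>+s. (\<integral>\<^sup>+t. f t \<partial>lborel) * g s \<partial>lborel)"
    by (subst nn_integral_multc) (auto simp: nn_integral_lborel_translate)
  finally show ?thesis by (simp add: nn_integral_cmult)
qed

text \<open>Cauchy-Schwarz with respect to the weight f(t - s) ds, obtained by writing f as the
  square of \<open>q\<close>, bounds the squared convolution by the mass of f times the convolution
  of f with g^2. Tonelli integrates the latter.\<close>

lemma Young_nnconvol:
  fixes f g :: "real \<Rightarrow> ennreal"
  assumes [measurable]: "f \<in> borel_measurable borel" "g \<in> borel_measurable borel"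
    and f: "\<And>x. f x < \<infinity>"
  shows "(\<integral>\<^sup>+t. (nnconvol f g t)\<^sup>2 \<partial>lborel) \<le> (\<integral>\<^sup>+t. f t \<partial>lborel)\<^sup>2 * (\<integral>\<^sup>+t. (g t)\<^sup>2 \<partial>lborel)"
proof -
  define q where "q = (\<lambda>x. ennreal (sqrt (enn2real (f x))))"
  have q: "f x = q x * q x" for x
    using f[of x] by (simp add: q_def ennreal_mult[symmetric] ennreal_enn2real_if)
  have [measurable]: "q \<in> borel_measurable borel" unfolding q_def by measurable
  have "(nnconvol f g t)\<^sup>2 \<le> (\<integral>\<^sup>+t. f t \<partial>lborel) * nnconvol f (\<lambda>x. (g x)\<^sup>2) t" for t
  proof -
    have "(nnconvol f g t)\<^sup>2 = (\<integral>\<^sup>+s. q (t - s) * (q (t - s) * g s) \<partial>lborel)\<^sup>2"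
      unfolding nnconvol_def by (simp add: q mult.assoc)
    also have "\<dots> \<le> (\<integral>\<^sup>+s. (q (t - s))\<^sup>2 \<partial>lborel) * (\<integral>\<^sup>+s. (q (t - s) * g s)\<^sup>2 \<partial>lborel)"
      by (rule Cauchy_Schwarz_nn_integral) measurable
    also have "(\<integral>\<^sup>+s. (q (t - s))\<^sup>2 \<partial>lborel) = (\<integral>\<^sup>+s. f s \<partial>lborel)"
      using nn_integral_real_affine[of f "-1" t] by (simp add: q power2_eq_square)
    also have "(\<integral>\<^sup>+s. (q (t - s) * g s)\<^sup>2 \<partial>lborel) = nnconvol f (\<lambda>x. (g x)\<^sup>2) t"
      unfolding nnconvol_def by (simp add: q power2_eq_square mult_ac)
    finally show ?thesis .
  qed
  then have "(\<integral>\<^sup>+t. (nnconvol f g t)\<^sup>2 \<partial>lborel) \<le> (\<integral>\<^sup>+t. (\<integral>\<^sup>+t. f t \<partial>lborel) * nnconvol f (\<lambda>x. (g x)\<^sup>2) t \<partial>lborel)"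
    by (intro nn_integral_mono)
  also have "\<dots> = (\<integral>\<^sup>+t. f t \<partial>lborel)\<^sup>2 * (\<integral>\<^sup>+t. (g t)\<^sup>2 \<partial>lborel)"
    by (simp add: nn_integral_cmult nn_integral_nnconvol power2_eq_square mult_ac)
  finally show ?thesis .
qed

text \<open>Vanishing at 0 itself is included: it changes nothing almost everywhere and makes the
  integrand of a convolution of causal functions live exactly on the open interval (0,t).\<close>

definition causal :: "(real \<Rightarrow> 'a::zero) \<Rightarrow> bool" where
  "causal f \<longleftrightarrow> (\<forall>x\<le>0. f x = 0)"

text \<open>For t < T, causality lets only the restrictions of f and g to (0,T) enter. The
  localisation is essential because the Riemann-Liouville kernels have infinite mass on the half
  line.\<close>

lemma Young_nnconvol_interval:
  fixes f g :: "real \<Rightarrow> ennreal"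
  assumes [measurable]: "f \<in> borel_measurable borel" "g \<in> borel_measurable borel"
    and f: "\<And>x. f x < \<infinity>" and c: "causal f" "causal g"
  shows "(\<integral>\<^sup>+t\<in>{0<..<T}. (nnconvol f g t)\<^sup>2 \<partial>lborel)
    \<le> (\<integral>\<^sup>+t\<in>{0<..<T}. f t \<partial>lborel)\<^sup>2 * (\<integral>\<^sup>+t\<in>{0<..<T}. (g t)\<^sup>2 \<partial>lborel)"
proof -
  let ?i = "\<lambda>t::real. indicator {0<..<T} t :: ennreal"
  let ?f = "\<lambda>t. f t * ?i t" and ?g = "\<lambda>t. g t * ?i t"
  have eq: "nnconvol f g t = nnconvol ?f ?g t" if t: "t < T" for t
    unfolding nnconvol_def
  proof (rule nn_integral_cong)
    fix s
    show "f (t - s) * g s = ?f (t - s) * ?g s"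
      using c t unfolding causal_def by (cases "0 < s"; cases "0 < t - s") (auto simp: indicator_def)
  qed
  have "(\<integral>\<^sup>+t\<in>{0<..<T}. (nnconvol f g t)\<^sup>2 \<partial>lborel) = (\<integral>\<^sup>+t\<in>{0<..<T}. (nnconvol ?f ?g t)\<^sup>2 \<partial>lborel)"
    by (rule nn_integral_cong) (auto simp: eq indicator_def)
  also have "\<dots> \<le> (\<integral>\<^sup>+t. (nnconvol ?f ?g t)\<^sup>2 \<partial>lborel)"
    by (rule nn_integral_mono) (auto simp: indicator_def)
  also have "\<dots> \<le> (\<integral>\<^sup>+t. ?f t \<partial>lborel)\<^sup>2 * (\<integral>\<^sup>+t. (?g t)\<^sup>2 \<partial>lborel)"
    by (rule Young_nnconvol) (use f in \<open>auto simp: indicator_def top.not_eq_extremum\<close>)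
  also have "(\<integral>\<^sup>+t. (?g t)\<^sup>2 \<partial>lborel) = (\<integral>\<^sup>+t\<in>{0<..<T}. (g t)\<^sup>2 \<partial>lborel)"
    by (rule nn_integral_cong) (auto simp: indicator_def)
  finally show ?thesis .
qed

lemma Young_convol_interval:
  fixes f g :: "real \<Rightarrow> real"
  assumes [measurable]: "f \<in> borel_measurable borel" "g \<in> borel_measurable borel"
    and c: "causal f" "causal g"
  shows "(\<integral>\<^sup>+t\<in>{0<..<T}. ennreal ((convol f g t)\<^sup>2) \<partial>lborel)
    \<le> (\<integral>\<^sup>+t\<in>{0<..<T}. nnabs f t \<partial>lborel)\<^sup>2 * (\<integral>\<^sup>+t\<in>{0<..<T}. ennreal ((g t)\<^sup>2) \<partial>lborel)"
proof -
  have sq: "ennreal (x\<^sup>2) = (ennreal \<bar>x\<bar>)\<^sup>2" for x :: real by (simp add: ennreal_power)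
  have "(\<integral>\<^sup>+t\<in>{0<..<T}. ennreal ((convol f g t)\<^sup>2) \<partial>lborel)
      \<le> (\<integral>\<^sup>+t\<in>{0<..<T}. (nnconvol (nnabs f) (nnabs g) t)\<^sup>2 \<partial>lborel)"
    using nnabs_convol_le[of f g, unfolded nnabs_def[of "convol f g"]]
    by (intro nn_integral_mono) (auto simp: sq indicator_def intro!: power_mono)
  also have "\<dots> \<le> (\<integral>\<^sup>+t\<in>{0<..<T}. nnabs f t \<partial>lborel)\<^sup>2 * (\<integral>\<^sup>+t\<in>{0<..<T}. (nnabs g t)\<^sup>2 \<partial>lborel)"
    using c by (intro Young_nnconvol_interval) (auto simp: causal_def nnabs_def)
  also have "(\<integral>\<^sup>+t\<in>{0<..<T}. (nnabs g t)\<^sup>2 \<partial>lborel) = (\<integral>\<^sup>+t\<in>{0<..<T}. ennreal ((g t)\<^sup>2) \<partial>lborel)"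
    by (simp add: nnabs_def sq)
  finally show ?thesis .
qed

section \<open>Riemann--Liouville kernels\<close>

text \<open>The cutoff turns convolution on the line into the fractional integral based at 0.
  \<open>RL_kernel 1\<close> is the Heaviside function, so that convolving a causal function with it
  gives the primitive.\<close>

definition RL_kernel :: "real \<Rightarrow> real \<Rightarrow> real" where
  "RL_kernel a t = (if 0 < t then t powr (a - 1) / Gamma a else 0)"

lemma RL_kernel_measurable [measurable]: "RL_kernel a \<in> borel_measurable borel"
  unfolding RL_kernel_def by measurable

lemma RL_kernel_nonneg: "0 < a \<Longrightarrow> 0 \<le> RL_kernel a t"
  by (simp add: RL_kernel_def Gamma_real_nonneg)

lemma causal_RL_kernel [simp]: "causal (RL_kernel a)"
  by (simp add: causal_def RL_kernel_def)

lemma RL_kernel_1: "RL_kernel 1 t = (if 0 < t then 1 else 0)"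
  by (simp add: RL_kernel_def)

text \<open>The substitution s = t r reduces the convolution to Euler's Beta integral, and Beta(b,
  a) = Gamma(a) Gamma(b) / Gamma(a+b) supplies the normalisation.\<close>

lemma nnconvol_RL_kernel:
  assumes a: "0 < a" and b: "0 < b"
  shows "nnconvol (nnabs (RL_kernel a)) (nnabs (RL_kernel b)) t = nnabs (RL_kernel (a + b)) t"
proof (cases "0 < t")
  case False
  then have "nnabs (RL_kernel a) (t - s) * nnabs (RL_kernel b) s = 0" for s
    by (cases "0 < s") (auto simp: nnabs_def RL_kernel_def)
  then have "(\<lambda>s. nnabs (RL_kernel a) (t - s) * nnabs (RL_kernel b) s) = (\<lambda>s. 0)" by (rule ext)
  then have "nnconvol (nnabs (RL_kernel a)) (nnabs (RL_kernel b)) t = 0" by (simp add: nnconvol_def)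
  then show ?thesis using False by (simp add: nnabs_def RL_kernel_def)
next
  case t: True
  let ?\<beta> = "\<lambda>r::real. if r \<in> {0..1} then r powr (b - 1) * (1 - r) powr (a - 1) else 0"
  have [measurable]: "?\<beta> \<in> borel_measurable borel" by measurable
  have "(?\<beta> has_integral Beta b a) UNIV"
    using has_integral_Beta_real[OF b a] by (simp only: has_integral_restrict_UNIV)
  then have B: "(\<integral>\<^sup>+r. ?\<beta> r \<partial>lborel) = ennreal (Beta b a)"
    by (intro nn_integral_has_integral_lborel) auto
  let ?C = "t powr (a + b - 1) / (Gamma a * Gamma b)"
  have G: "0 < Gamma a" "0 < Gamma b" "0 < Gamma (a + b)" using a b by (auto intro: Gamma_real_pos)
  have pt: "t * (RL_kernel a (t - t * r) * RL_kernel b (t * r)) = ?C * ?\<beta> r" for r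
  proof (cases "0 < r \<and> r < 1")
    case True
    have "t - t * r = t * (1 - r)" by (simp add: algebra_simps)
    moreover have "0 < t * (1 - r)" "0 < t * r" using True t by auto
    moreover have "t powr (a + b - 1) = t * (t powr (a - 1) * t powr (b - 1))"
    proof -
      have "t * (t powr (a - 1) * t powr (b - 1)) = t powr (1 + ((a - 1) + (b - 1)))"
        unfolding powr_add using t by simp
      then show ?thesis by (simp add: algebra_simps)
    qed
    moreover have "RL_kernel a (t * (1 - r)) = t powr (a - 1) * (1 - r) powr (a - 1) / Gamma a"
      "RL_kernel b (t * r) = t powr (b - 1) * r powr (b - 1) / Gamma b"
      using True t by (auto simp: RL_kernel_def powr_mult)
    ultimately show ?thesis using True by simp
  next
    case False
    then have "RL_kernel a (t - t * r) * RL_kernel b (t * r) = 0"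
      using t by (auto simp: RL_kernel_def zero_less_mult_iff not_less mult_le_cancel_left1)
    \<comment> \<open>The end points r = 0 and r = 1 agree too, since \<open>0 powr x = 0\<close>
      for every exponent.\<close>
    moreover have "?\<beta> r = 0" using False by auto
    ultimately show ?thesis by simp
  qed
  have "nnconvol (nnabs (RL_kernel a)) (nnabs (RL_kernel b)) t
      = (\<integral>\<^sup>+s. ennreal (RL_kernel a (t - s) * RL_kernel b s) \<partial>lborel)"
    using a b by (simp add: nnconvol_nnabs RL_kernel_nonneg)
  also have "\<dots> = ennreal t * (\<integral>\<^sup>+r. ennreal (RL_kernel a (t - t * r) * RL_kernel b (t * r)) \<partial>lborel)"
    using t by (subst nn_integral_real_affine[where c=t and t=0]) auto
  also have "\<dots> = (\<integral>\<^sup>+r. ennreal (?C * ?\<beta> r) \<partial>lborel)"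
    unfolding pt[symmetric] using t a b
    by (subst nn_integral_cmult[symmetric]) (auto simp: ennreal_mult RL_kernel_nonneg)
  also have "\<dots> = ennreal ?C * ennreal (Beta b a)"
  proof -
    have "ennreal (?C * ?\<beta> r) = ennreal ?C * ennreal (?\<beta> r)" for r
      using G by (intro ennreal_mult) auto
    then show ?thesis unfolding B[symmetric] by (simp only:) (rule nn_integral_cmult, measurable)
  qed
  also have "\<dots> = nnabs (RL_kernel (a + b)) t"
    using G t by (simp add: nnabs_def RL_kernel_def Beta_def ennreal_mult[symmetric] field_simps)
  finally show ?thesis .
qed

lemma convol_RL_kernel:
  assumes a: "0 < a" and b: "0 < b"
  shows "convol (RL_kernel a) (RL_kernel b) t = RL_kernel (a + b) t"
proof -
  have "convol (RL_kernel a) (RL_kernel b) t = enn2real (\<integral>\<^sup>+s. ennreal (RL_kernel a (t - s) * RL_kernel b s) \<partial>lborel)"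
    unfolding convol_def using a b by (intro integral_eq_nn_integral) (auto simp: RL_kernel_nonneg)
  also have "(\<integral>\<^sup>+s. ennreal (RL_kernel a (t - s) * RL_kernel b s) \<partial>lborel)
      = nnconvol (nnabs (RL_kernel a)) (nnabs (RL_kernel b)) t"
    using a b by (simp add: nnconvol_nnabs RL_kernel_nonneg)
  finally show ?thesis using a b by (simp add: nnconvol_RL_kernel nnabs_def RL_kernel_nonneg)
qed

section \<open>Semigroup law, Abel inversion and primitives\<close>

lemma convol_RL_kernel_semigroup_fin:
  assumes [measurable]: "w \<in> borel_measurable borel" and "0 < a" "0 < b"
    and fin: "nnconvol (nnabs (RL_kernel (a + b))) (nnabs w) t < \<infinity>"
  shows "convol (RL_kernel a) (convol (RL_kernel b) w) t = convol (RL_kernel (a + b)) w t"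
proof -
  have N: "nnconvol (nnabs (RL_kernel a)) (nnabs (RL_kernel b)) = nnabs (RL_kernel (a + b))"
    and R: "convol (RL_kernel a) (RL_kernel b) = RL_kernel (a + b)"
    using assms by (auto simp: nnconvol_RL_kernel convol_RL_kernel)
  have "nnconvol (nnabs (RL_kernel a)) (nnconvol (nnabs (RL_kernel b)) (nnabs w)) t < \<infinity>"
    using fin by (simp add: nnconvol_assoc N)
  then show ?thesis by (subst convol_assoc) (auto simp: R)
qed

lemma nnconvol_RL_kernel_1_le: "nnconvol (nnabs (RL_kernel 1)) g t \<le> (\<integral>\<^sup>+s. g s \<partial>lborel)"
  unfolding nnconvol_def nnabs_def
  by (rule nn_integral_mono) (auto simp: RL_kernel_1)

lemma nnabs_integral_finite: "integrable lborel w \<Longrightarrow> (\<integral>\<^sup>+s. nnabs w s \<partial>lborel) < \<infinity>"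
  by (simp add: integrable_iff_bounded nnabs_def)

text \<open>Since \<open>RL_kernel 1\<close> is bounded by 1, the finiteness condition of the
  semigroup law holds at every t for integrable w. Abel's inversion is therefore a pointwise
  identity, not merely one up to null sets.\<close>

lemma convol_RL_kernel_inverse:
  assumes w: "integrable lborel w" and "0 < a" "0 < b" "a + b = 1"
  shows "convol (RL_kernel a) (convol (RL_kernel b) w) t = convol (RL_kernel 1) w t"
proof -
  have "nnconvol (nnabs (RL_kernel (a + b))) (nnabs w) t < \<infinity>"
    using nnconvol_RL_kernel_1_le[of "nnabs w" t] nnabs_integral_finite[OF w] assms(4)
    by (auto intro: le_less_trans)
  moreover have "w \<in> borel_measurable borel" using w by auto
  ultimately show ?thesis using convol_RL_kernel_semigroup_fin[of w a b t] assms by simp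
qed

lemma set_integrable_of_integrable:
  fixes w :: "real \<Rightarrow> real"
  assumes "integrable lborel w" "A \<in> sets borel"
  shows "set_integrable lborel A w"
  unfolding set_integrable_def using assms by (intro integrable_mult_indicator) auto

lemma convol_RL_kernel_1:
  assumes w: "integrable lborel w" and c: "causal w"
  shows "convol (RL_kernel 1) w t = integral {0..t} w"
proof -
  have "convol (RL_kernel 1) w t = (LINT s:{0..t}|lborel. w s)"
    unfolding convol_def set_lebesgue_integral_def
  proof (rule integral_cong_AE)
    have "AE s in lborel. s \<noteq> t" by (rule AE_lborel_singleton)
    then show "AE s in lborel. RL_kernel 1 (t - s) * w s = indicat_real {0..t} s *\<^sub>R w s"
      by eventually_elim (use c in \<open>auto simp: RL_kernel_1 indicator_def causal_def\<close>)
  qed (use w in auto)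
  also have "\<dots> = integral {0..t} w"
    by (rule set_borel_integral_eq_integral) (use w in \<open>auto intro: set_integrable_of_integrable\<close>)
  finally show ?thesis .
qed

lemma AE_has_real_derivative_convol_RL_kernel_1:
  assumes w: "integrable lborel w" and c: "causal w"
  shows "AE x in lborel. 0 < x \<longrightarrow> (convol (RL_kernel 1) w has_real_derivative w x) (at x)"
proof -
  let ?F = "\<lambda>t. integral {0..t} w"
  let ?N = "\<Union>n. {x\<in>{0<..<real n}. \<not> (?F has_real_derivative w x) (at x)}"
  have "w integrable_on {0..real n}" for n
    by (intro set_borel_integral_eq_integral(1) set_integrable_of_integrable w) simp
  then have "negligible ?N"
    by (intro negligible_Union_nat negligible_not_has_real_derivative_integral)
  then have "AE x in lborel. x \<notin> ?N"
    unfolding negligible_iff_null_sets by (subst AE_completion_iff[symmetric]) (rule AE_not_in)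
  then show ?thesis
  proof eventually_elim
    case (elim x)
    obtain n where "x < real n" using reals_Archimedean2 by blast
    with elim show ?case unfolding ext[OF convol_RL_kernel_1[OF w c]] by auto
  qed
qed

lemma nnconvol_finite_integrable:
  assumes "integrable lborel f" "integrable lborel g"
  shows "nnconvol (nnabs (RL_kernel 1)) (nnconvol (nnabs f) (nnabs g)) t < \<infinity>"
proof -
  have [measurable]: "f \<in> borel_measurable borel" "g \<in> borel_measurable borel" using assms by auto
  have "nnconvol (nnabs (RL_kernel 1)) (nnconvol (nnabs f) (nnabs g)) t \<le> (\<integral>\<^sup>+s. nnconvol (nnabs f) (nnabs g) s \<partial>lborel)"
    by (rule nnconvol_RL_kernel_1_le)
  also have "\<dots> = (\<integral>\<^sup>+s. nnabs f s \<partial>lborel) * (\<integral>\<^sup>+s. nnabs g s \<partial>lborel)"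
    by (rule nn_integral_nnconvol) auto
  also have "\<dots> < \<infinity>" using assms[THEN nnabs_integral_finite] by (auto simp: ennreal_mult_less_top)
  finally show ?thesis .
qed

lemma integrable_convol:
  assumes "integrable lborel f" "integrable lborel g"
  shows "integrable lborel (convol f g)"
proof -
  have [measurable]: "f \<in> borel_measurable borel" "g \<in> borel_measurable borel" using assms by auto
  have "(\<integral>\<^sup>+s. nnabs (convol f g) s \<partial>lborel) \<le> (\<integral>\<^sup>+s. nnconvol (nnabs f) (nnabs g) s \<partial>lborel)"
    by (intro nn_integral_mono nnabs_convol_le)
  also have "\<dots> = (\<integral>\<^sup>+s. nnabs f s \<partial>lborel) * (\<integral>\<^sup>+s. nnabs g s \<partial>lborel)"
    by (rule nn_integral_nnconvol) auto
  also have "\<dots> < \<infinity>" using assms[THEN nnabs_integral_finite] by (auto simp: ennreal_mult_less_top)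
  finally show ?thesis by (simp add: integrable_iff_bounded nnabs_def)
qed

lemma causal_convol: "causal f \<Longrightarrow> causal g \<Longrightarrow> causal (convol f g)"
  unfolding causal_def convol_def
proof (intro allI impI)
  fix t :: real assume "\<forall>x\<le>0. f x = 0" "\<forall>x\<le>0. g x = 0" "t \<le> 0"
  then have "f (t - s) * g s = 0" for s by (cases "s \<le> 0") auto
  then have "(\<lambda>s. f (t - s) * g s) = (\<lambda>s. 0)" by (rule ext)
  then show "(\<integral>s. f (t - s) * g s \<partial>lborel) = 0" by simp
qed

text \<open>The fundamental theorem writes the cut-off kernel as m(0) times the Heaviside function
  plus the primitive of \<open>m1\<close>. Regrouping the convolution with u gives two forms: one
  exhibits the result as the primitive of m(0) u + m' * u, the other is integration by parts and
  involves u only through its own primitive.\<close>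

lemma convol_C1_kernel:
  fixes m m' u :: "real \<Rightarrow> real" and L :: real
  defines "k \<equiv> \<lambda>t. if t \<in> {0<..<L} then m t else 0" and "m1 \<equiv> \<lambda>t. if t \<in> {0<..<L} then m' t else 0"
  assumes m: "\<And>t. t \<in> {0..L} \<Longrightarrow> (m has_real_derivative m' t) (at t within {0..L})"
    and m': "continuous_on {0..L} m'" and u: "integrable lborel u" and c: "causal u"
  shows "integrable lborel m1" "causal m1"
    and "t \<le> L \<Longrightarrow> convol k u t = m 0 * convol (RL_kernel 1) u t + convol (RL_kernel 1) (convol m1 u) t"
    and "t \<le> L \<Longrightarrow> convol k u t = m 0 * convol (RL_kernel 1) u t + convol m1 (convol (RL_kernel 1) u) t"
proof -
  have [measurable]: "u \<in> borel_measurable borel" using u by auto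
  have "set_integrable lborel {0..L} m'"
    using m' by (rule borel_integrable_atLeastAtMost')
  then have "set_integrable lborel {0<..<L} m'"
    by (rule set_integrable_subset) auto
  moreover have "m1 = (\<lambda>t. indicator {0<..<L} t *\<^sub>R m' t)" by (auto simp: m1_def)
  ultimately show m1: "integrable lborel m1" by (simp add: set_integrable_def)
  then have [measurable]: "m1 \<in> borel_measurable borel" by auto
  show m1c: "causal m1" by (simp add: causal_def m1_def)
  \<comment> \<open>The identity stops at L, where \<open>k\<close> is cut off. This suffices up to
    t = L: only s > 0 contributes, so that the kernel is evaluated at t - s < L.\<close>
  have k: "k x = m 0 * RL_kernel 1 x + convol (RL_kernel 1) m1 x" if x: "x < L" for x
  proof (cases "0 < x")
    case False
    then show ?thesis using causal_convol[OF causal_RL_kernel m1c, of 1]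
      by (simp add: k_def RL_kernel_1 causal_def)
  next
    case True
    have "(m' has_integral (m x - m 0)) {0..x}"
    proof (rule fundamental_theorem_of_calculus)
      fix s assume "s \<in> {0..x}"
      then have "(m has_real_derivative m' s) (at s within {0..x})"
        using m[of s] x by (auto intro: has_field_derivative_subset)
      then show "(m has_vector_derivative m' s) (at s within {0..x})"
        by (simp add: has_real_derivative_iff_has_vector_derivative)
    qed (use True in simp)
    moreover have "integral {0..x} m1 = integral {0..x} m'"
      by (rule integral_spike[of "{0, L}"]) (use x in \<open>auto simp: m1_def\<close>)
    ultimately have "integral {0..x} m1 = m x - m 0" by (auto dest: integral_unique)
    then show ?thesis using True x by (simp add: k_def RL_kernel_1 convol_RL_kernel_1[OF m1 m1c])
  qed
  have fin: "nnconvol (nnabs (RL_kernel 1)) (nnconvol (nnabs m1) (nnabs u)) t < \<infinity>" for t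
    by (rule nnconvol_finite_integrable[OF m1 u])
  have fin1: "nnconvol (nnabs (RL_kernel 1)) (nnabs u) t < \<infinity>"
    using nnconvol_RL_kernel_1_le nnabs_integral_finite[OF u] by (rule le_less_trans)
  have "nnconvol (nnabs (convol (RL_kernel 1) m1)) (nnabs u) t
      \<le> nnconvol (nnconvol (nnabs (RL_kernel 1)) (nnabs m1)) (nnabs u) t"
    by (intro nnconvol_mono nnabs_convol_le order_refl)
  then have fin2: "nnconvol (nnabs (convol (RL_kernel 1) m1)) (nnabs u) t < \<infinity>"
    using fin[of t] by (simp add: nnconvol_assoc)
  {
    assume t: "t \<le> L"
    have "k (t - s) * u s = m 0 * (RL_kernel 1 (t - s) * u s) + convol (RL_kernel 1) m1 (t - s) * u s" for s
    proof (cases "0 < s")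
      case True
      then show ?thesis using k[of "t - s"] t by (simp add: algebra_simps)
    qed (use c in \<open>simp add: causal_def\<close>)
    then have "convol k u t = (\<integral>s. m 0 * (RL_kernel 1 (t - s) * u s) + convol (RL_kernel 1) m1 (t - s) * u s \<partial>lborel)"
      unfolding convol_def[of k] by simp
    also have "\<dots> = m 0 * convol (RL_kernel 1) u t + convol (convol (RL_kernel 1) m1) u t"
      using fin1 fin2 unfolding convol_def[of _ u]
      by (subst Bochner_Integration.integral_add) (auto simp: convol_integrable_iff)
    finally have *: "convol k u t = m 0 * convol (RL_kernel 1) u t + convol (convol (RL_kernel 1) m1) u t" .
    then show "convol k u t = m 0 * convol (RL_kernel 1) u t + convol (RL_kernel 1) (convol m1 u) t"
      using fin[of t] by (simp add: convol_assoc)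
    have "convol (convol (RL_kernel 1) m1) u t = convol (convol m1 (RL_kernel 1)) u t"
      using ext[of "convol m1 (RL_kernel 1)", OF convol_commute] by simp
    also have "\<dots> = convol m1 (convol (RL_kernel 1) u) t"
    proof (rule convol_assoc[symmetric])
      have "nnconvol (nnabs m1) (nnconvol (nnabs (RL_kernel 1)) (nnabs u)) t
          = nnconvol (nnconvol (nnabs (RL_kernel 1)) (nnabs m1)) (nnabs u) t"
        using ext[of "nnconvol (nnabs m1) (nnabs (RL_kernel 1))", OF nnconvol_commute]
        by (simp add: nnconvol_assoc)
      then show "nnconvol (nnabs m1) (nnconvol (nnabs (RL_kernel 1)) (nnabs u)) t < \<infinity>"
        using fin[of t] by (simp add: nnconvol_assoc)
    qed auto
    finally show "convol k u t = m 0 * convol (RL_kernel 1) u t + convol m1 (convol (RL_kernel 1) u) t"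
      using * by simp
  }
qed

section \<open>Square norms on an interval\<close>

text \<open>Riesz-Fischer, expressed through nonnegative integrals of differences: a fast
  subsequence converges almost everywhere, and Fatou's lemma carries the Cauchy estimate over to the
  limit.\<close>

lemma L2_Cauchy_converges:
  fixes f :: "nat \<Rightarrow> 'a \<Rightarrow> real"
  assumes [measurable]: "\<And>n. f n \<in> borel_measurable M"
    and Cauchy: "\<And>e. 0 < e \<Longrightarrow> \<exists>N. \<forall>m\<ge>N. \<forall>n\<ge>N. (\<integral>\<^sup>+x. ennreal ((f m x - f n x)\<^sup>2) \<partial>M) \<le> ennreal e"
  obtains v where "v \<in> borel_measurable M"
    "\<And>e. 0 < e \<Longrightarrow> \<exists>N. \<forall>n\<ge>N. (\<integral>\<^sup>+x. ennreal ((f n x - v x)\<^sup>2) \<partial>M) \<le> ennreal e"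
proof -
  have "\<exists>N. \<forall>m\<ge>N. \<forall>n\<ge>N. (\<integral>\<^sup>+x. ennreal ((f m x - f n x)\<^sup>2) \<partial>M) \<le> ennreal ((1/4)^i)" for i :: nat
    by (rule Cauchy) simp
  then obtain K where K: "\<And>i m n. K i \<le> m \<Longrightarrow> K i \<le> n \<Longrightarrow>
      (\<integral>\<^sup>+x. ennreal ((f m x - f n x)\<^sup>2) \<partial>M) \<le> ennreal ((1/4)^i)"
    by metis
  \<comment> \<open>The sum makes both \<open>k i\<close> and \<open>k (Suc i)\<close> at least
    \<open>K i\<close>, so consecutive terms fall under the i-th bound; the summand i sends the
    indices to infinity.\<close>
  define k where "k i = i + (\<Sum>j\<le>i. K j)" for i
  have kK: "K i \<le> k i" "K i \<le> k (Suc i)" "i \<le> k i" for i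
  proof -
    have "K i \<le> (\<Sum>j\<le>i. K j)" by (rule member_le_sum) auto
    then show "K i \<le> k i" "K i \<le> k (Suc i)" "i \<le> k i" unfolding k_def by auto
  qed
  define d where "d i x = f (k (Suc i)) x - f (k i) x" for i x
  have [measurable]: "d i \<in> borel_measurable M" for i unfolding d_def by measurable
  \<comment> \<open>The bound 4^(-i) leaves room for the weight 2^i. The weighted sum then controls
    the absolute increments, since |d| \<le> 2^(-i) + 2^i d^2 for every real d.\<close>
  have "(\<integral>\<^sup>+x. (\<Sum>i. ennreal (2^i * (d i x)\<^sup>2)) \<partial>M) = (\<Sum>i. \<integral>\<^sup>+x. ennreal (2^i * (d i x)\<^sup>2) \<partial>M)"
    by (rule nn_integral_suminf) measurable
  also have "\<dots> \<le> (\<Sum>i. ennreal ((1/2)^i))"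
  proof (intro suminf_le summableI)
    fix i
    have "(\<integral>\<^sup>+x. ennreal (2^i * (d i x)\<^sup>2) \<partial>M) = ennreal (2^i) * (\<integral>\<^sup>+x. ennreal ((d i x)\<^sup>2) \<partial>M)"
      by (subst nn_integral_cmult[symmetric]) (auto simp: ennreal_mult)
    also have "\<dots> \<le> ennreal (2^i) * ennreal ((1/4)^i)"
      unfolding d_def by (intro mult_left_mono K kK) auto
    also have "\<dots> = ennreal ((1/2)^i)"
      by (simp add: ennreal_mult[symmetric] power_mult_distrib[symmetric])
    finally show "(\<integral>\<^sup>+x. ennreal (2^i * (d i x)\<^sup>2) \<partial>M) \<le> ennreal ((1/2)^i)" .
  qed
  also have "\<dots> = ennreal (\<Sum>i. (1/2)^i)"
    by (rule suminf_ennreal2) auto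
  finally have "(\<integral>\<^sup>+x. (\<Sum>i. ennreal (2^i * (d i x)\<^sup>2)) \<partial>M) \<noteq> \<infinity>"
    by (auto simp: top_unique)
  then have "AE x in M. (\<Sum>i. ennreal (2^i * (d i x)\<^sup>2)) \<noteq> \<infinity>"
    by (intro nn_integral_noteq_infinite) auto
  then have conv: "AE x in M. convergent (\<lambda>i. f (k i) x)"
  proof eventually_elim
    case (elim x)
    then have "summable (\<lambda>i. 2^i * (d i x)\<^sup>2)"
      by (intro summable_suminf_not_top) auto
    then have "summable (\<lambda>i. (1/2)^i + 2^i * (d i x)\<^sup>2)"
      by (intro summable_add summable_geometric) auto
    moreover have "norm (d i x) \<le> (1/2)^i + 2^i * (d i x)\<^sup>2" for i
    proof (cases "\<bar>d i x\<bar> \<le> (1/2)^i")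
      case False
      then have "1 * \<bar>d i x\<bar> \<le> (2^i * \<bar>d i x\<bar>) * \<bar>d i x\<bar>"
        by (intro mult_right_mono) (auto simp: power_one_over field_simps)
      also have "\<dots> = 2^i * (d i x)\<^sup>2" by (simp add: power2_eq_square)
      finally show ?thesis by (simp add: add_increasing)
    qed (simp add: add_increasing2)
    ultimately have "summable (\<lambda>i. d i x)"
      by (rule summable_comparison_test'[of _ 0])
    then have "convergent (\<lambda>n. f (k 0) x + (\<Sum>i<n. d i x))"
      by (intro convergent_add convergent_const) (simp add: summable_iff_convergent)
    then show ?case 
      using sum_lessThan_telescope[of "\<lambda>i. f (k i) x"] by (simp add: d_def)
  qed
  define v where "v x = lim (\<lambda>i. f (k i) x)" for x
  have [measurable]: "v \<in> borel_measurable M" unfolding v_def by measurable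
  show thesis
  proof
    fix e :: real assume "0 < e"
    then obtain N where N: "\<And>m n. N \<le> m \<Longrightarrow> N \<le> n \<Longrightarrow> (\<integral>\<^sup>+x. ennreal ((f m x - f n x)\<^sup>2) \<partial>M) \<le> ennreal e"
      using Cauchy by blast
    have "(\<integral>\<^sup>+x. ennreal ((f n x - v x)\<^sup>2) \<partial>M) \<le> ennreal e" if n: "N \<le> n" for n
    proof -
      have "(\<integral>\<^sup>+x. ennreal ((f n x - v x)\<^sup>2) \<partial>M)
          = (\<integral>\<^sup>+x. liminf (\<lambda>i. ennreal ((f n x - f (k i) x)\<^sup>2)) \<partial>M)"
      proof (rule nn_integral_cong_AE)
        show "AE x in M. ennreal ((f n x - v x)\<^sup>2) = liminf (\<lambda>i. ennreal ((f n x - f (k i) x)\<^sup>2))"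
          using conv
        proof eventually_elim
          case (elim x)
          then have "(\<lambda>i. f (k i) x) \<longlonglongrightarrow> v x" unfolding v_def by (rule convergent_LIMSEQ_iff[THEN iffD1])
          then have "(\<lambda>i. ennreal ((f n x - f (k i) x)\<^sup>2)) \<longlonglongrightarrow> ennreal ((f n x - v x)\<^sup>2)"
            by (intro tendsto_intros)
          then show ?case by (rule lim_imp_Liminf[OF trivial_limit_sequentially, symmetric])
        qed
      qed
      also have "\<dots> \<le> liminf (\<lambda>i. \<integral>\<^sup>+x. ennreal ((f n x - f (k i) x)\<^sup>2) \<partial>M)"
        by (rule nn_integral_liminf) measurable
      also have "\<dots> \<le> ennreal e"
        by (rule Liminf_le)
          (use n kK(3) in \<open>auto intro!: N eventually_sequentiallyI[of N] intro: order_trans\<close>)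
      finally show ?thesis .
    qed
    then show "\<exists>N. \<forall>n\<ge>N. (\<integral>\<^sup>+x. ennreal ((f n x - v x)\<^sup>2) \<partial>M) \<le> ennreal e" by blast
  qed measurable
qed

text \<open>Bridge from functions measurable with respect to \<open>lebesgue_on\<close> to Borel
  functions on the line. The zero values off (0,T) make the representative causal and fix its
  extension.\<close>

definition borel_rep :: "real \<Rightarrow> (real \<Rightarrow> real) \<Rightarrow> (real \<Rightarrow> real) \<Rightarrow> bool" where
  "borel_rep T f f' \<longleftrightarrow> f' \<in> borel_measurable borel \<and> (\<forall>x. x \<notin> {0<..<T} \<longrightarrow> f' x = 0) \<and>
     (AE x in lborel. x \<in> {0<..<T} \<longrightarrow> f x = f' x)"

lemma AE_I_meas_iff: "(AE x in I_meas T. P x) \<longleftrightarrow> (AE x in lborel. x \<in> {0<..<T} \<longrightarrow> P x)"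
  by (simp add: AE_restrict_space_iff AE_completion_iff)

lemma borel_rep_exists:
  assumes "f \<in> borel_measurable (I_meas T)"
  obtains f' where "borel_rep T f f'"
proof -
  have "(\<lambda>x. indicator {0<..<T} x *\<^sub>R f x) \<in> borel_measurable lebesgue"
    using assms by (subst (asm) borel_measurable_restrict_space_iff) auto
  then obtain g where g: "g \<in> borel_measurable lborel"
      and eq: "AE x in lborel. indicator {0<..<T} x *\<^sub>R f x = g x"
    using completion_ex_borel_measurable_real by blast
  have [measurable]: "g \<in> borel_measurable borel" using g by simp
  have "borel_rep T f (\<lambda>x. indicator {0<..<T} x * g x)"
    unfolding borel_rep_def using eq by (auto elim!: eventually_mono)
  then show thesis by (rule that)
qed

lemma nn_integral_I_meas:
  assumes "AE x in lborel. x \<in> {0<..<T} \<longrightarrow> f x = g x"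
  shows "(\<integral>\<^sup>+x. f x \<partial>I_meas T) = (\<integral>\<^sup>+x\<in>{0<..<T}. g x \<partial>lborel)"
proof -
  have "(\<integral>\<^sup>+x. f x \<partial>I_meas T) = (\<integral>\<^sup>+x\<in>{0<..<T}. f x \<partial>lborel)"
    by (simp add: nn_integral_restrict_space nn_integral_completion)
  also have "\<dots> = (\<integral>\<^sup>+x\<in>{0<..<T}. g x \<partial>lborel)"
    by (rule nn_integral_cong_AE) (use assms in \<open>auto elim!: eventually_mono simp: indicator_def\<close>)
  finally show ?thesis .
qed

text \<open>The squared L^2(0,T) norm in \<open>ennreal\<close>. Unlike \<open>L2_norm\<close> it is
  infinite where the integral diverges, so that for measurable functions its finiteness is
  membership in \<open>L2\<close>.\<close>

definition sq_norm :: "real \<Rightarrow> (real \<Rightarrow> real) \<Rightarrow> ennreal" where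
  "sq_norm T f = (\<integral>\<^sup>+x\<in>{0<..<T}. ennreal ((f x)\<^sup>2) \<partial>lborel)"

lemma sq_norm_cong_AE:
  "(AE x in lborel. x \<in> {0<..<T} \<longrightarrow> f x = g x) \<Longrightarrow> sq_norm T f = sq_norm T g"
  unfolding sq_norm_def by (rule nn_integral_cong_AE) (auto elim!: eventually_mono simp: indicator_def)

lemma sq_norm_I_meas: "(\<integral>\<^sup>+x. ennreal ((f x)\<^sup>2) \<partial>I_meas T) = sq_norm T f"
  unfolding sq_norm_def by (rule nn_integral_I_meas) simp

lemma L2_iff: "f \<in> L2 T \<longleftrightarrow> f \<in> borel_measurable (I_meas T) \<and> sq_norm T f < \<infinity>"
  unfolding L2_def sq_norm_I_meas[symmetric] by (auto simp: integrable_iff_bounded)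

lemma L2_norm_eq: "f \<in> borel_measurable (I_meas T) \<Longrightarrow> L2_norm T f = sqrt (enn2real (sq_norm T f))"
  unfolding L2_norm_def sq_norm_I_meas[symmetric] by (subst integral_eq_nn_integral) auto

lemma measurable_I_meas_cong:
  assumes "g \<in> borel_measurable borel" "\<And>t. t \<in> {0<..<T} \<Longrightarrow> f t = g t"
  shows "f \<in> borel_measurable (I_meas T)"
proof -
  have "g \<in> borel_measurable (I_meas T)"
    using assms(1) by (intro measurable_restrict_space1 measurable_completion) simp
  then show ?thesis using assms(2) by (subst measurable_cong[where g=g]) auto
qed

text \<open>Completeness of \<open>lebesgue\<close> makes G measurable because it agrees almost
  everywhere with the Borel function F. This admits integrands such as \<open>deriv g\<close>, which
  are known only up to null sets.\<close>

lemma integral_lebesgue_AE: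
  fixes F G :: "real \<Rightarrow> real"
  assumes F: "F \<in> borel_measurable borel" and eq: "AE s in lborel. G s = F s"
  shows "integral\<^sup>L lebesgue G = integral\<^sup>L lborel F"
proof -
  have FL: "F \<in> borel_measurable lebesgue" using F by (simp add: measurable_completion)
  have AE: "AE s in lebesgue. F s = G s" using eq by (simp add: AE_completion_iff eq_commute)
  have "G \<in> borel_measurable lebesgue"
    using FL AE by (rule borel_measurable_AE)
  then have "integral\<^sup>L lebesgue G = integral\<^sup>L lebesgue F"
    using FL AE by (intro integral_cong_AE) (auto simp: eq_commute)
  then show ?thesis using F by (simp add: integral_completion)
qed

lemma sq_norm_add_le:
  assumes [measurable]: "f \<in> borel_measurable borel" "g \<in> borel_measurable borel"
  shows "sq_norm T (\<lambda>x. f x + g x) \<le> 2 * sq_norm T f + 2 * sq_norm T g"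
proof -
  have *: "ennreal ((x + y)\<^sup>2) \<le> 2 * ennreal (x\<^sup>2) + 2 * ennreal (y\<^sup>2)" for x y :: real
  proof -
    have "(x + y)\<^sup>2 \<le> 2 * x\<^sup>2 + 2 * y\<^sup>2"
      using sum_squares_bound[of x y] by (simp add: power2_sum)
    then have "ennreal ((x + y)\<^sup>2) \<le> ennreal (2 * x\<^sup>2 + 2 * y\<^sup>2)" by (rule ennreal_leI)
    then show ?thesis by (simp add: ennreal_plus ennreal_mult)
  qed
  have "sq_norm T (\<lambda>x. f x + g x) \<le>
     (\<integral>\<^sup>+x. 2 * (ennreal ((f x)\<^sup>2) * indicator {0<..<T} x) + 2 * (ennreal ((g x)\<^sup>2) * indicator {0<..<T} x) \<partial>lborel)"
    unfolding sq_norm_def by (rule nn_integral_mono) (use * in \<open>auto simp: indicator_def\<close>)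
  also have "\<dots> = 2 * sq_norm T f + 2 * sq_norm T g"
    unfolding sq_norm_def by (simp add: nn_integral_add nn_integral_cmult)
  finally show ?thesis .
qed

lemma sq_norm_cmult:
  assumes [measurable]: "f \<in> borel_measurable borel"
  shows "sq_norm T (\<lambda>x. c * f x) = ennreal (c\<^sup>2) * sq_norm T f"
  unfolding sq_norm_def
  by (subst nn_integral_cmult[symmetric]) (auto simp: power_mult_distrib ennreal_mult mult.assoc)

lemma sq_norm_convol_le:
  assumes "f \<in> borel_measurable borel" "g \<in> borel_measurable borel" "causal f" "causal g"
  shows "sq_norm T (convol f g) \<le> (\<integral>\<^sup>+t\<in>{0<..<T}. nnabs f t \<partial>lborel)\<^sup>2 * sq_norm T g"
  using Young_convol_interval[OF assms] unfolding sq_norm_def .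

lemma sq_norm_le_const:
  assumes "\<And>t. t \<in> {0<..<T} \<Longrightarrow> \<bar>f t\<bar> \<le> c" "0 < T"
  shows "sq_norm T f \<le> ennreal (c\<^sup>2 * T)"
proof -
  have "sq_norm T f \<le> (\<integral>\<^sup>+x\<in>{0<..<T}. ennreal (c\<^sup>2) \<partial>lborel)"
    unfolding sq_norm_def using assms
    by (intro nn_integral_mono) (auto simp: indicator_def intro!: ennreal_leI abs_le_square_iff[THEN iffD1] order_trans[OF _ abs_ge_self])
  also have "\<dots> = ennreal (c\<^sup>2 * T)"
    using assms(2) by (simp add: nn_integral_cmult_indicator ennreal_mult)
  finally show ?thesis .
qed

text \<open>|f| \<le> 1 + f^2, and (0,T) has finite length.\<close>

lemma integrable_of_sq_norm:
  assumes [measurable]: "f \<in> borel_measurable borel" and 0: "\<And>x. x \<notin> {0<..<T} \<Longrightarrow> f x = 0"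
    and fin: "sq_norm T f < \<infinity>"
  shows "integrable lborel f"
proof (rule integrableI_bounded)
  have *: "ennreal (norm (f x)) \<le> indicator {0<..<T} x + ennreal ((f x)\<^sup>2) * indicator {0<..<T} x" for x
  proof (cases "x \<in> {0<..<T}")
    case True
    have "\<bar>f x\<bar> \<le> 1 + (f x)\<^sup>2"
      using sum_squares_bound[of 1 "\<bar>f x\<bar>"] by simp
    then have "ennreal \<bar>f x\<bar> \<le> ennreal (1 + (f x)\<^sup>2)" by (rule ennreal_leI)
    then show ?thesis using True by (simp add: ennreal_plus)
  qed (simp add: 0)
  have "(\<integral>\<^sup>+x. ennreal (norm (f x)) \<partial>lborel) \<le> emeasure lborel {0<..<T} + sq_norm T f"
    unfolding sq_norm_def by (subst nn_integral_indicator[symmetric], simp, subst nn_integral_add[symmetric]) (auto intro!: nn_integral_mono *[simplified])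
  also have "\<dots> < \<infinity>" using fin emeasure_lborel_box_finite[of 0 T] by auto
  finally show "(\<integral>\<^sup>+x. ennreal (norm (f x)) \<partial>lborel) < \<infinity>" .
qed simp

section \<open>The operator \<open>A\<inverse>B\<close> as a convolution\<close>

text \<open>Translates integrals over the closed interval [0,t] into convolutions on the line. The
  end points are discarded as null sets, so the values of F at the singularity s = t do not
  matter.\<close>

lemma set_integral_lebesgue_eq_convol:
  assumes [measurable]: "k \<in> borel_measurable borel" "g \<in> borel_measurable borel" and c: "causal k" "causal g"
    and eq: "AE s in lborel. s \<in> {0<..<t} \<longrightarrow> F s = k (t - s) * g s"
  shows "(LINT s:{0..t}|lebesgue. F s) = convol k g t"
  unfolding set_lebesgue_integral_def convol_def
proof (rule integral_lebesgue_AE)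
  have "AE s in lborel. s \<noteq> 0" "AE s in lborel. s \<noteq> t" by (auto intro: AE_lborel_singleton)
  with eq show "AE s in lborel. indicat_real {0..t} s *\<^sub>R F s = k (t - s) * g s"
    by eventually_elim (use c in \<open>auto simp: indicator_def causal_def not_le\<close>)
qed measurable

lemma conv_eq_convol:
  assumes "k \<in> borel_measurable borel" "g \<in> borel_measurable borel" "causal k" "causal g"
    and "\<And>x. x \<in> {0<..<t} \<Longrightarrow> f x = k x" and "AE s in lborel. s \<in> {0<..<t} \<longrightarrow> G s = g s"
  shows "conv f G t = convol k g t"
  unfolding conv_def using assms
  by (intro set_integral_lebesgue_eq_convol) (auto elim!: eventually_mono)

lemma op_A_eq_convol:
  assumes "g \<in> borel_measurable borel" "causal g" "AE s in lborel. s \<in> {0<..<t} \<longrightarrow> G s = g s"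
  shows "op_A \<gamma> G t = convol (RL_kernel (1 - \<gamma>)) g t"
  unfolding op_A_def using assms by (intro conv_eq_convol) (auto simp: RL_kernel_def)

lemma fractional_integral_eq_convol:
  assumes "g \<in> borel_measurable borel" "causal g" "AE s in lborel. s \<in> {0<..<t} \<longrightarrow> G s = g s" "0 < \<gamma>"
  shows "1 / Gamma \<gamma> * (LINT s:{0..t}|lebesgue. G s / (t - s) powr (1 - \<gamma>)) = convol (RL_kernel \<gamma>) g t"
proof -
  have nz: "Gamma \<gamma> \<noteq> 0" using Gamma_real_pos[OF assms(4)] by simp
  have "x powr (\<gamma> - 1) = 1 / x powr (1 - \<gamma>)" for x :: real
    using powr_minus_divide[of x "1 - \<gamma>"] by simp
  then have "(LINT s:{0..t}|lebesgue. G s / (t - s) powr (1 - \<gamma>)) = convol (\<lambda>x. Gamma \<gamma> * RL_kernel \<gamma> x) g t"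
    using assms
    by (intro set_integral_lebesgue_eq_convol) (auto simp: causal_def RL_kernel_def nz elim!: eventually_mono)
  also have "\<dots> = Gamma \<gamma> * convol (RL_kernel \<gamma>) g t"
    unfolding convol_def by (simp add: mult.assoc)
  finally show ?thesis using nz by simp
qed

text \<open>The mass on (0,T) is bounded by the convolution with the Heaviside function at T, which
  is the finite number k_(a+1)(T).\<close>

lemma RL_kernel_integral_finite:
  assumes "0 < a"
  shows "(\<integral>\<^sup>+t\<in>{0<..<T}. nnabs (RL_kernel a) t \<partial>lborel) < \<infinity>"
proof -
  have "(\<integral>\<^sup>+t\<in>{0<..<T}. nnabs (RL_kernel a) t \<partial>lborel) \<le> nnconvol (nnabs (RL_kernel 1)) (nnabs (RL_kernel a)) T"
    unfolding nnconvol_def by (rule nn_integral_mono) (auto simp: indicator_def nnabs_def RL_kernel_1)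
  also have "\<dots> < \<infinity>" using assms by (simp add: nnconvol_RL_kernel nnabs_def)
  finally show ?thesis .
qed

definition L2_borel :: "real \<Rightarrow> (real \<Rightarrow> real) \<Rightarrow> bool" where
  "L2_borel T u \<longleftrightarrow> u \<in> borel_measurable borel \<and> (\<forall>x. x \<notin> {0<..<T} \<longrightarrow> u x = 0) \<and> sq_norm T u < \<infinity>"

lemma L2_borelD:
  assumes "L2_borel T u"
  shows "u \<in> borel_measurable borel" "causal u" "integrable lborel u" "sq_norm T u < \<infinity>"
proof -
  have u: "u \<in> borel_measurable borel" "\<And>x. x \<notin> {0<..<T} \<Longrightarrow> u x = 0" "sq_norm T u < \<infinity>"
    using assms unfolding L2_borel_def by blast+
  show "integrable lborel u" by (rule integrable_of_sq_norm[OF u])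
  show "causal u" using u(2) by (simp add: causal_def)
qed (use assms in \<open>simp_all add: L2_borel_def\<close>)

lemma L2_obtain_borel:
  assumes "u \<in> L2 T"
  obtains u' where "borel_rep T u u'" "L2_borel T u'"
proof -
  obtain u' where u': "borel_rep T u u'" using assms borel_rep_exists unfolding L2_iff by blast
  then have "sq_norm T u = sq_norm T u'"
    by (intro sq_norm_cong_AE) (auto simp: borel_rep_def)
  then have "L2_borel T u'" using u' assms by (auto simp: L2_iff L2_borel_def borel_rep_def)
  then show thesis using u' that by blast
qed

lemma L2_borel_lin:
  assumes "L2_borel T u" "L2_borel T v"
  shows "L2_borel T (\<lambda>t. a * u t + b * v t)"
proof -
  have [measurable]: "u \<in> borel_measurable borel" "v \<in> borel_measurable borel"
    using assms by (auto simp: L2_borel_def)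
  have "sq_norm T (\<lambda>t. a * u t + b * v t) \<le> 2 * sq_norm T (\<lambda>t. a * u t) + 2 * sq_norm T (\<lambda>t. b * v t)"
    by (rule sq_norm_add_le) measurable
  also have "\<dots> < \<infinity>" using assms
    by (auto simp: sq_norm_cmult L2_borel_def ennreal_mult_less_top)
  finally show ?thesis using assms by (auto simp: L2_borel_def)
qed

text \<open>Young's inequality makes the squared convolution integrable, hence finite almost
  everywhere. For a \<le> 1/2 it may be infinite at single points, which is why convolutions with
  this kernel are split linearly only almost everywhere.\<close>

lemma AE_nnconvol_RL_kernel_finite:
  assumes w: "L2_borel T w" and a: "0 < a"
  shows "AE t in lborel. t \<in> {0<..<T} \<longrightarrow> nnconvol (nnabs (RL_kernel a)) (nnabs w) t < \<infinity>"
proof -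
  have [measurable]: "w \<in> borel_measurable borel" using w by (rule L2_borelD)
  have "(\<integral>\<^sup>+t\<in>{0<..<T}. (nnconvol (nnabs (RL_kernel a)) (nnabs w) t)\<^sup>2 \<partial>lborel)
      \<le> (\<integral>\<^sup>+t\<in>{0<..<T}. nnabs (RL_kernel a) t \<partial>lborel)\<^sup>2 * (\<integral>\<^sup>+t\<in>{0<..<T}. (nnabs w t)\<^sup>2 \<partial>lborel)"
    using L2_borelD(2)[OF w] causal_RL_kernel[of a]
    by (intro Young_nnconvol_interval) (auto simp: nnabs_def causal_def)
  also have "(\<integral>\<^sup>+t\<in>{0<..<T}. (nnabs w t)\<^sup>2 \<partial>lborel) = sq_norm T w"
    unfolding sq_norm_def nnabs_def by (simp add: ennreal_power)
  also have "(\<integral>\<^sup>+t\<in>{0<..<T}. nnabs (RL_kernel a) t \<partial>lborel)\<^sup>2 * sq_norm T w < \<infinity>"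
    using RL_kernel_integral_finite[OF a, of T] L2_borelD(4)[OF w]
    by (auto simp: ennreal_mult_less_top power2_eq_square)
  finally have "(\<integral>\<^sup>+t\<in>{0<..<T}. (nnconvol (nnabs (RL_kernel a)) (nnabs w) t)\<^sup>2 \<partial>lborel) \<noteq> \<infinity>" by simp
  then have "AE t in lborel. (nnconvol (nnabs (RL_kernel a)) (nnabs w) t)\<^sup>2 * indicator {0<..<T} t \<noteq> \<infinity>"
    by (intro nn_integral_noteq_infinite) auto
  then show ?thesis
    by eventually_elim (auto simp: indicator_def power2_eq_square ennreal_mult_eq_top_iff less_top)
qed

lemma exp_mult_convol:
  "exp (c * t) * convol f g t = convol (\<lambda>t. exp (c * t) * f t) (\<lambda>t. exp (c * t) * g t) t"
proof -
  have "exp (c * t) * (f (t - s) * g s) = (exp (c * (t - s)) * f (t - s)) * (exp (c * s) * g s)" for s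
    by (simp add: exp_diff right_diff_distrib)
  then show ?thesis
    unfolding convol_def integral_mult_right_zero[symmetric]
    by (rule Bochner_Integration.integral_cong[OF refl])
qed

section \<open>S on Borel representatives: derivative of Bu, range of A, linearity\<close>

locale C1_kernel =
  fixes T \<gamma> :: real and m m' :: "real \<Rightarrow> real"
  assumes T: "0 < T" and \<gamma>: "0 < \<gamma>" "\<gamma> < 1"
    and m: "\<And>t. t \<in> {0..T} \<Longrightarrow> (m has_real_derivative m' t) (at t within {0..T})"
    and m': "continuous_on {0..T} m'"
begin

definition kern :: "real \<Rightarrow> real" where "kern t = (if t \<in> {0<..<T} then m t else 0)"
definition dkern :: "real \<Rightarrow> real" where "dkern t = (if t \<in> {0<..<T} then m' t else 0)"

text \<open>The almost everywhere derivative of \<open>m \<ast> u\<close>.\<close>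

definition dB :: "(real \<Rightarrow> real) \<Rightarrow> real \<Rightarrow> real" where
  "dB u t = (if t \<in> {0<..<T} then m 0 * u t + convol dkern u t else 0)"

lemma integrable_dkern: "integrable lborel dkern" and causal_dkern: "causal dkern"
  using convol_C1_kernel(1,2)[OF m m', of "\<lambda>x. 0"]
  by (auto simp: dkern_def[abs_def] causal_def)

lemma dkern_measurable [measurable]: "dkern \<in> borel_measurable borel"
  using integrable_dkern by auto

lemma kern_measurable [measurable]: "kern \<in> borel_measurable borel"
proof -
  have "continuous_on {0..T} m"
    using m DERIV_continuous unfolding continuous_on_eq_continuous_within by blast
  then have "continuous_on {0<..<T} m" by (rule continuous_on_subset) auto
  then have "(\<lambda>t. indicator {0<..<T} t *\<^sub>R m t) \<in> borel_measurable borel"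
    by (intro borel_measurable_continuous_on_indicator) auto
  moreover have "(\<lambda>t. indicator {0<..<T} t *\<^sub>R m t) = kern" by (auto simp: kern_def)
  ultimately show ?thesis by simp
qed

lemma causal_kern: "causal kern"
  by (simp add: causal_def kern_def)

lemma dB_measurable [measurable]:
  assumes [measurable]: "u \<in> borel_measurable borel"
  shows "dB u \<in> borel_measurable borel"
  unfolding dB_def by measurable

lemma dkern_norm_finite: "(\<integral>\<^sup>+t\<in>{0<..<T}. nnabs dkern t \<partial>lborel) < \<infinity>"
proof -
  have "(\<integral>\<^sup>+t\<in>{0<..<T}. nnabs dkern t \<partial>lborel) \<le> (\<integral>\<^sup>+t. nnabs dkern t \<partial>lborel)"
    by (rule nn_integral_mono) (auto simp: indicator_def)
  then show ?thesis using nnabs_integral_finite[OF integrable_dkern] by (rule le_less_trans)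
qed

text \<open>On (0,T) a weight with c \<le> 0 only decreases the L^1 norm of m', so one constant C =
  2 m(0)^2 + 2 (L^1 norm of m')^2 serves all c. The case c = 0 feeds compactness; large negative c
  feeds uniqueness.\<close>

lemma dB_exp_bounded:
  obtains C where "0 \<le> C"
    "\<And>u c. L2_borel T u \<Longrightarrow> c \<le> 0 \<Longrightarrow>
      sq_norm T (\<lambda>t. exp (c * t) * dB u t) \<le> ennreal C * sq_norm T (\<lambda>t. exp (c * t) * u t)"
proof -
  let ?I = "\<integral>\<^sup>+t\<in>{0<..<T}. nnabs dkern t \<partial>lborel"
  have "2 * ennreal ((m 0)\<^sup>2) + 2 * ?I\<^sup>2 < \<infinity>"
    using dkern_norm_finite by (auto simp: power2_eq_square ennreal_mult_less_top)
  then obtain C where C: "0 \<le> C" "2 * ennreal ((m 0)\<^sup>2) + 2 * ?I\<^sup>2 = ennreal C"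
    by (cases "2 * ennreal ((m 0)\<^sup>2) + 2 * ?I\<^sup>2" rule: ennreal_cases) simp_all
  show thesis
  proof (rule that[OF C(1)])
    fix u c assume u: "L2_borel T u" and c: "c \<le> (0::real)"
    note [measurable] = L2_borelD(1)[OF u]
    let ?E = "\<lambda>f t. exp (c * t) * (f t :: real)"
    have eq: "?E (dB u) t = m 0 * ?E u t + convol (?E dkern) (?E u) t" if "t \<in> {0<..<T}" for t
      using that unfolding exp_mult_convol[symmetric] by (simp add: dB_def algebra_simps)
    have "sq_norm T (?E (dB u)) = sq_norm T (\<lambda>t. m 0 * ?E u t + convol (?E dkern) (?E u) t)"
      by (rule sq_norm_cong_AE, rule AE_I2, rule impI, rule eq)
    also have "\<dots> \<le> 2 * sq_norm T (\<lambda>t. m 0 * ?E u t) + 2 * sq_norm T (convol (?E dkern) (?E u))"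
      by (rule sq_norm_add_le) measurable
    also have "\<dots> \<le> 2 * (ennreal ((m 0)\<^sup>2) * sq_norm T (?E u)) + 2 * (?I\<^sup>2 * sq_norm T (?E u))"
    proof (intro add_mono mult_left_mono)
      show "sq_norm T (\<lambda>t. m 0 * ?E u t) \<le> ennreal ((m 0)\<^sup>2) * sq_norm T (?E u)"
        by (subst sq_norm_cmult) auto
      have "sq_norm T (convol (?E dkern) (?E u))
          \<le> (\<integral>\<^sup>+t\<in>{0<..<T}. nnabs (?E dkern) t \<partial>lborel)\<^sup>2 * sq_norm T (?E u)"
        using L2_borelD(2)[OF u] causal_dkern by (intro sq_norm_convol_le) (auto simp: causal_def)
      also have "\<dots> \<le> ?I\<^sup>2 * sq_norm T (?E u)"
      proof (rule mult_right_mono[OF power_mono[OF nn_integral_mono]])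
        fix t
        have "\<bar>exp (c * t) * dkern t\<bar> \<le> \<bar>dkern t\<bar>" if "0 < t"
          unfolding abs_mult using that c by (intro mult_left_le_one_le) (auto simp: mult_nonpos_nonneg)
        then show "nnabs (?E dkern) t * indicator {0<..<T} t \<le> nnabs dkern t * indicator {0<..<T} t"
          by (auto simp: indicator_def nnabs_def intro!: ennreal_leI)
      qed auto
      finally show "sq_norm T (convol (?E dkern) (?E u)) \<le> ?I\<^sup>2 * sq_norm T (?E u)" .
    qed auto
    finally show "sq_norm T (?E (dB u)) \<le> ennreal C * sq_norm T (?E u)"
      by (simp add: C(2)[symmetric] distrib_right mult.assoc)
  qed
qed

lemma dB_bounded:
  obtains C where "0 \<le> C" "\<And>u. L2_borel T u \<Longrightarrow> sq_norm T (dB u) \<le> ennreal C * sq_norm T u"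
proof -
  obtain C where "0 \<le> C" and C: "\<And>u c. L2_borel T u \<Longrightarrow> c \<le> 0 \<Longrightarrow>
      sq_norm T (\<lambda>t. exp (c * t) * dB u t) \<le> ennreal C * sq_norm T (\<lambda>t. exp (c * t) * u t)"
    using dB_exp_bounded by blast
  with C[of _ 0] show thesis by (intro that[of C]) simp_all
qed

lemma L2_borel_dB:
  assumes u: "L2_borel T u"
  shows "L2_borel T (dB u)"
proof -
  obtain C where "0 \<le> C" "sq_norm T (dB u) \<le> ennreal C * sq_norm T u"
    using dB_bounded u by metis
  note this(2)
  also have "ennreal C * sq_norm T u < \<infinity>"
    using L2_borelD(4)[OF u] by (simp add: ennreal_mult_less_top)
  finally have "sq_norm T (dB u) < \<infinity>" .
  then show ?thesis using L2_borelD(1)[OF u] by (auto simp: L2_borel_def dB_def)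
qed

text \<open>The identity holds at every point: m' is continuous on a compact interval, hence
  bounded, so the convolution with \<open>dkern\<close> converges absolutely everywhere.\<close>

lemma dB_lin:
  assumes u: "L2_borel T u" and v: "L2_borel T v"
  shows "dB (\<lambda>t. a * u t + b * v t) = (\<lambda>t. a * dB u t + b * dB v t)"
proof
  fix t
  have bdd: "bounded (m' ` {0..T})"
    using m' by (intro compact_imp_bounded compact_continuous_image) auto
  then obtain M where M: "\<And>x. x \<in> {0..T} \<Longrightarrow> \<bar>m' x\<bar> \<le> M"
    unfolding bounded_iff by (metis imageI real_norm_def)
  then have M': "\<bar>dkern x\<bar> \<le> \<bar>M\<bar>" for x
  proof (cases "x \<in> {0<..<T}")
    case True
    then have "\<bar>m' x\<bar> \<le> M" by (intro M) auto
    then show ?thesis using True by (simp add: dkern_def)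
  next
    case False
    then have "dkern x = 0" unfolding dkern_def by (rule if_not_P)
    then show ?thesis by simp
  qed
  have int: "integrable lborel (\<lambda>s. dkern (t - s) * w s)" if w: "L2_borel T w" for w
  proof (rule Bochner_Integration.integrable_bound)
    show "integrable lborel (\<lambda>s. \<bar>M\<bar> * w s)" using L2_borelD(3)[OF w] by simp
    show "AE s in lborel. norm (dkern (t - s) * w s) \<le> norm (\<bar>M\<bar> * w s)"
      by (auto simp: abs_mult intro!: mult_right_mono M')
  qed (use L2_borelD(1)[OF w] in measurable)
  show "dB (\<lambda>t. a * u t + b * v t) t = a * dB u t + b * dB v t"
    unfolding dB_def using convol_lin[OF int[OF u] int[OF v], of a b] by (simp add: algebra_simps)
qed

lemma convol_kern_eq:
  assumes u: "L2_borel T u" and t: "t \<le> T"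
  shows "convol kern u t = convol (RL_kernel 1) (dB u) t"
proof -
  note [measurable] = L2_borelD(1)[OF u]
  have i: "integrable lborel (convol dkern u)"
    by (rule integrable_convol[OF integrable_dkern L2_borelD(3)[OF u]])
  have c: "causal (convol dkern u)" by (rule causal_convol[OF causal_dkern L2_borelD(2)[OF u]])
  have fin: "integrable lborel (\<lambda>s. RL_kernel 1 (t - s) * w s)" if "integrable lborel w" for w
    using that nnconvol_RL_kernel_1_le[of "nnabs w" t] nnabs_integral_finite[OF that]
    by (subst convol_integrable_iff) (auto intro: le_less_trans)
  \<comment> \<open>The truncation of \<open>dB\<close> at T is invisible here, because the
    Heaviside factor already vanishes for s \<ge> t and t \<le> T.\<close>
  have "RL_kernel 1 (t - s) * dB u s = RL_kernel 1 (t - s) * (m 0 * u s + 1 * convol dkern u s)" for s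
    using t c L2_borelD(2)[OF u] by (cases "0 < s") (auto simp: dB_def RL_kernel_1 causal_def)
  then have "convol (RL_kernel 1) (dB u) t = convol (RL_kernel 1) (\<lambda>s. m 0 * u s + 1 * convol dkern u s) t"
    unfolding convol_def[of "RL_kernel 1"] by (rule Bochner_Integration.integral_cong[OF refl])
  also have "\<dots> = m 0 * convol (RL_kernel 1) u t + 1 * convol (RL_kernel 1) (convol dkern u) t"
    by (rule convol_lin[OF fin[OF L2_borelD(3)[OF u]] fin[OF i]])
  also have "\<dots> = convol kern u t"
    using convol_C1_kernel(3)[OF m m' L2_borelD(3,2)[OF u] t]
    by (simp add: kern_def[abs_def] dkern_def[abs_def])
  finally show ?thesis by simp
qed

lemma op_B_eq:
  assumes "borel_rep T u u'" "L2_borel T u'" "t \<le> T"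
  shows "op_B m u t = convol (RL_kernel 1) (dB u') t"
proof -
  have "op_B m u t = convol kern u' t"
    unfolding op_B_def using assms L2_borelD[OF assms(2)]
    by (intro conv_eq_convol) (auto simp: kern_def causal_kern borel_rep_def elim!: eventually_mono)
  then show ?thesis using convol_kern_eq assms by simp
qed

text \<open>The preimage is k_\<gamma> convolved with w = \<open>dB u'\<close>: applying A composes
  k_(1-\<gamma>) with k_\<gamma> to the Heaviside function, which turns w into its primitive, that
  is Bu. Without this fact \<open>A_inv\<close> would be unspecified at Bu.\<close>

lemma op_B_in_range_A:
  assumes u: "borel_rep T u u'" "L2_borel T u'"
  shows "op_B m u \<in> range_A T \<gamma>"
proof -
  let ?w = "dB u'"
  have w: "L2_borel T ?w" by (rule L2_borel_dB[OF u(2)])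
  note w' = L2_borelD[OF w]
  note [measurable] = w'(1)
  define v where "v = convol (RL_kernel \<gamma>) ?w"
  have [measurable]: "v \<in> borel_measurable borel" unfolding v_def by measurable
  have "sq_norm T v \<le> (\<integral>\<^sup>+t\<in>{0<..<T}. nnabs (RL_kernel \<gamma>) t \<partial>lborel)\<^sup>2 * sq_norm T ?w"
    unfolding v_def using w' by (intro sq_norm_convol_le) auto
  also have "\<dots> < \<infinity>" using RL_kernel_integral_finite[OF \<gamma>(1), of T] w'(4)
    by (auto simp: power2_eq_square ennreal_mult_less_top)
  finally have "v \<in> L2 T" unfolding L2_iff by (auto intro: measurable_I_meas_cong[of v])
  moreover have "op_A \<gamma> v t = op_B m u t" if "t \<in> {0<..<T}" for t
  proof -
    have "op_A \<gamma> v t = convol (RL_kernel (1 - \<gamma>)) v t"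
      by (rule op_A_eq_convol) (auto simp: v_def intro: causal_convol w')
    also have "\<dots> = convol (RL_kernel 1) ?w t"
      unfolding v_def using \<gamma> w'(3) by (intro convol_RL_kernel_inverse) auto
    also have "\<dots> = op_B m u t" using op_B_eq[OF u] that by simp
    finally show ?thesis .
  qed
  ultimately show ?thesis unfolding range_A_def L2_eq_def AE_I_meas_iff by auto
qed

lemma AE_deriv_op_B:
  assumes u: "borel_rep T u u'" "L2_borel T u'"
  shows "AE s in lborel. s \<in> {0<..<T} \<longrightarrow> deriv (op_B m u) s = dB u' s"
proof -
  note w = L2_borelD[OF L2_borel_dB[OF u(2)]]
  show ?thesis
    using AE_has_real_derivative_convol_RL_kernel_1[OF w(3,2)]
  proof eventually_elim
    case (elim s)
    show ?case
    proof
      assume s: "s \<in> {0<..<T}"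
      have "(op_B m u has_real_derivative dB u' s) (at s)"
        by (rule has_field_derivative_transform_within_open[of "convol (RL_kernel 1) (dB u')" _ _ "{0<..<T}"])
          (use elim s op_B_eq[OF u] in auto)
      then show "deriv (op_B m u) s = dB u' s" by (rule DERIV_imp_deriv)
    qed
  qed
qed

text \<open>The derivative of Bu is known only almost everywhere, yet the formula holds at every t
  in (0,T), because \<open>A_inv\<close> sees the derivative only under an integral.\<close>

lemma op_S_eq:
  assumes u: "borel_rep T u u'" "L2_borel T u'" and t: "t \<in> {0<..<T}"
  shows "op_S T \<gamma> m u t = convol (RL_kernel \<gamma>) (dB u') t"
proof -
  note w = L2_borelD[OF L2_borel_dB[OF u(2)]]
  have "AE s in lborel. s \<in> {0<..<t} \<longrightarrow> deriv (op_B m u) s = dB u' s"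
    using AE_deriv_op_B[OF u] t by (auto elim!: eventually_mono)
  then show ?thesis
    unfolding op_S_def A_inv_def if_P[OF op_B_in_range_A[OF u]]
    by (intro fractional_integral_eq_convol w \<gamma>)
qed

lemma op_S_L2:
  assumes u: "borel_rep T u u'" "L2_borel T u'"
  shows "op_S T \<gamma> m u \<in> L2 T"
    and "sq_norm T (op_S T \<gamma> m u) = sq_norm T (convol (RL_kernel \<gamma>) (dB u'))"
proof -
  note w = L2_borelD[OF L2_borel_dB[OF u(2)]]
  note [measurable] = w(1)
  show eq: "sq_norm T (op_S T \<gamma> m u) = sq_norm T (convol (RL_kernel \<gamma>) (dB u'))"
    by (rule sq_norm_cong_AE) (auto simp: op_S_eq[OF u])
  have "sq_norm T (convol (RL_kernel \<gamma>) (dB u')) \<le> (\<integral>\<^sup>+t\<in>{0<..<T}. nnabs (RL_kernel \<gamma>) t \<partial>lborel)\<^sup>2 * sq_norm T (dB u')"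
    using w by (intro sq_norm_convol_le) auto
  also have "\<dots> < \<infinity>" using RL_kernel_integral_finite[OF \<gamma>(1), of T] w(4)
    by (auto simp: power2_eq_square ennreal_mult_less_top)
  finally show "op_S T \<gamma> m u \<in> L2 T"
    unfolding L2_iff eq by (auto intro!: measurable_I_meas_cong[of "convol (RL_kernel \<gamma>) (dB u')"] op_S_eq[OF u])
qed

lemma op_S_linear: "L2_linear_operator T (op_S T \<gamma> m)"
  unfolding L2_linear_operator_def
proof (intro conjI ballI allI impI)
  fix f assume "f \<in> L2 T"
  then obtain f' where "borel_rep T f f'" "L2_borel T f'" by (rule L2_obtain_borel)
  then show "op_S T \<gamma> m f \<in> L2 T" by (rule op_S_L2)
next
  fix f g assume "f \<in> L2 T" and eq: "L2_eq T f g"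
  then obtain f' where f: "borel_rep T f f'" "L2_borel T f'" by (blast elim: L2_obtain_borel)
  \<comment> \<open>Equality as L^2 elements means that one Borel function represents both f and g;
    \<open>op_S_eq\<close> then gives both images the same values on (0,T).\<close>
  then have "borel_rep T g f'"
    using eq unfolding borel_rep_def L2_eq_def AE_I_meas_iff by (auto elim: eventually_elim2)
  then show "L2_eq T (op_S T \<gamma> m f) (op_S T \<gamma> m g)"
    unfolding L2_eq_def AE_I_meas_iff using f by (auto simp: op_S_eq)
next
  fix f g :: "real \<Rightarrow> real" and a b :: real assume "f \<in> L2 T" "g \<in> L2 T"
  then obtain f' g' where f: "borel_rep T f f'" "L2_borel T f'" and g: "borel_rep T g g'" "L2_borel T g'"
    by (metis L2_obtain_borel)
  let ?h = "\<lambda>t. a * f t + b * g t" and ?h' = "\<lambda>t. a * f' t + b * g' t"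
  have h: "L2_borel T ?h'" by (rule L2_borel_lin[OF f(2) g(2)])
  then have h': "borel_rep T ?h ?h'"
    using f(1) g(1) unfolding borel_rep_def L2_borel_def by (auto elim: eventually_elim2)
  have wf: "L2_borel T (dB f')" and wg: "L2_borel T (dB g')" using f g by (auto intro: L2_borel_dB)
  note [measurable] = L2_borelD(1)[OF wf] L2_borelD(1)[OF wg]
  show "L2_eq T (op_S T \<gamma> m ?h) (\<lambda>t. a * op_S T \<gamma> m f t + b * op_S T \<gamma> m g t)"
    unfolding L2_eq_def AE_I_meas_iff
    using AE_nnconvol_RL_kernel_finite[OF wf \<gamma>(1)] AE_nnconvol_RL_kernel_finite[OF wg \<gamma>(1)]
  proof eventually_elim
    case (elim t)
    show ?case
    proof
      assume t: "t \<in> {0<..<T}"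
      then have "integrable lborel (\<lambda>s. RL_kernel \<gamma> (t - s) * dB f' s)"
        "integrable lborel (\<lambda>s. RL_kernel \<gamma> (t - s) * dB g' s)"
        using elim by (auto simp: convol_integrable_iff)
      from convol_lin[OF this, of a b]
      show "op_S T \<gamma> m ?h t = a * op_S T \<gamma> m f t + b * op_S T \<gamma> m g t"
        using t f g h h' by (simp add: op_S_eq dB_lin)
    qed
  qed
qed

end

section \<open>Compactness\<close>

lemma convol_RL_kernel_1_integrable:
  assumes w: "integrable lborel w"
  shows "integrable lborel (\<lambda>s. RL_kernel 1 (t - s) * w s)"
  using assms nnconvol_RL_kernel_1_le[of "nnabs w" t] nnabs_integral_finite[OF w]
  by (subst convol_integrable_iff) (auto intro: le_less_trans)

text \<open>Cauchy-Schwarz on the interval between s and t: primitives of L^2 functions are Hoelder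
  continuous of exponent 1/2, with a constant governed by the norm alone.\<close>

lemma primitive_Hoelder:
  assumes w: "L2_borel T w" and st: "s \<le> t"
  shows "ennreal ((convol (RL_kernel 1) w t - convol (RL_kernel 1) w s)\<^sup>2) \<le> ennreal (t - s) * sq_norm T w"
proof -
  note [measurable] = L2_borelD(1)[OF w]
  note int = convol_RL_kernel_1_integrable[OF L2_borelD(3)[OF w]]
  let ?P = "convol (RL_kernel 1) w"
  let ?D = "\<lambda>r. RL_kernel 1 (t - r) * w r - RL_kernel 1 (s - r) * w r"
  have D: "ennreal (norm (?D r)) = indicator {s..<t} r * nnabs w r" for r
    using st by (auto simp: RL_kernel_1 nnabs_def indicator_def)
  have "?P t - ?P s = (\<integral>r. ?D r \<partial>lborel)"
    unfolding convol_def using int by simp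
  then have "ennreal \<bar>?P t - ?P s\<bar> \<le> (\<integral>\<^sup>+r. ennreal (norm (?D r)) \<partial>lborel)"
    using integral_norm_bound_ennreal[OF Bochner_Integration.integrable_diff[OF int[of t] int[of s]]] by simp
  also have "\<dots> = (\<integral>\<^sup>+r. indicator {s..<t} r * nnabs w r \<partial>lborel)" by (simp only: D)
  finally have "(ennreal \<bar>?P t - ?P s\<bar>)\<^sup>2 \<le> (\<integral>\<^sup>+r. indicator {s..<t} r * nnabs w r \<partial>lborel)\<^sup>2"
    by (rule power_mono) simp
  also have "\<dots> \<le> (\<integral>\<^sup>+r. (indicator {s..<t} r)\<^sup>2 \<partial>lborel) * (\<integral>\<^sup>+r. (nnabs w r)\<^sup>2 \<partial>lborel)"
    by (rule Cauchy_Schwarz_nn_integral) measurable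
  also have "(\<lambda>r. (indicator {s..<t} r :: ennreal)\<^sup>2) = indicator {s..<t}"
    by (auto simp: indicator_def)
  also have "(\<integral>\<^sup>+r. indicator {s..<t} r \<partial>lborel) = ennreal (t - s)" using st by simp
  also have "(\<integral>\<^sup>+r. (nnabs w r)\<^sup>2 \<partial>lborel) = sq_norm T w"
    unfolding sq_norm_def nnabs_def using w
    by (intro nn_integral_cong) (auto simp: ennreal_power indicator_def L2_borel_def)
  finally show ?thesis by (simp add: ennreal_power)
qed

text \<open>For a < 1 the kernel decreases on (0,\<infinity>), so its difference with a forward
  shift lies between 0 and the kernel itself. This is the integrable majorant for dominated
  convergence along shifts 1/(n+1).\<close>

lemma RL_kernel_shift_approx:
  assumes a: "0 < a" "a < 1" and e: "0 < e"
  obtains \<epsilon> where "0 < \<epsilon>"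
    "(\<integral>\<^sup>+t\<in>{0<..<T}. nnabs (\<lambda>t. RL_kernel a t - RL_kernel a (t + \<epsilon>)) t \<partial>lborel) \<le> ennreal e"
proof -
  let ?q = "\<lambda>n t. nnabs (\<lambda>t. RL_kernel a t - RL_kernel a (t + 1 / Suc n)) t * indicator {0<..<T} t"
  have G: "0 < Gamma a" using a by (simp add: Gamma_real_pos)
  have mono: "0 \<le> RL_kernel a (t + \<epsilon>) \<and> RL_kernel a (t + \<epsilon>) \<le> RL_kernel a t" if "0 < t" "0 < \<epsilon>" for t \<epsilon>
    using that a G by (auto simp: RL_kernel_def intro!: divide_right_mono powr_mono2')
  have "(\<lambda>n. \<integral>\<^sup>+t. ?q n t \<partial>lborel) \<longlonglongrightarrow> (\<integral>\<^sup>+t. 0 \<partial>(lborel :: real measure))"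
  proof (rule nn_integral_dominated_convergence[where w="\<lambda>t. nnabs (RL_kernel a) t * indicator {0<..<T} t"])
    show "AE t in lborel. ?q n t \<le> nnabs (RL_kernel a) t * indicator {0<..<T} t" for n
    proof (rule AE_I2)
      fix t show "?q n t \<le> nnabs (RL_kernel a) t * indicator {0<..<T} t"
        using mono[of t "1 / Suc n"] by (auto simp: indicator_def nnabs_def intro!: ennreal_leI)
    qed
    show "(\<integral>\<^sup>+t. nnabs (RL_kernel a) t * indicator {0<..<T} t \<partial>lborel) < \<infinity>"
      by (rule RL_kernel_integral_finite[OF a(1)])
    show "AE t in lborel. (\<lambda>n. ?q n t) \<longlonglongrightarrow> 0"
    proof (rule AE_I2)
      fix t :: real
      show "(\<lambda>n. ?q n t) \<longlonglongrightarrow> 0"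
      proof (cases "0 < t")
        case True
        have lim: "(\<lambda>n. t + 1 / real (Suc n)) \<longlonglongrightarrow> t"
          using tendsto_add[OF tendsto_const[of t] LIMSEQ_inverse_real_of_nat] by (simp add: field_simps)
        have "(\<lambda>n. (t + 1 / real (Suc n)) powr (a - 1) / Gamma a) \<longlonglongrightarrow> t powr (a - 1) / Gamma a"
          using True G by (intro tendsto_intros lim) auto
        then have "(\<lambda>n. RL_kernel a (t + 1 / real (Suc n))) \<longlonglongrightarrow> RL_kernel a t"
          using True by (simp add: RL_kernel_def add_pos_pos)
        then have "(\<lambda>n. \<bar>RL_kernel a t - RL_kernel a (t + 1 / real (Suc n))\<bar>) \<longlonglongrightarrow> \<bar>RL_kernel a t - RL_kernel a t\<bar>"
          by (intro tendsto_intros)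
        then have "(\<lambda>n. nnabs (\<lambda>t. RL_kernel a t - RL_kernel a (t + 1 / real (Suc n))) t) \<longlonglongrightarrow> 0"
          unfolding nnabs_def by (auto dest: tendsto_ennrealI)
        then show ?thesis by (cases "t < T") (auto simp: indicator_def)
      qed (simp add: indicator_def)
    qed
  qed measurable
  then have "(\<lambda>n. \<integral>\<^sup>+t. ?q n t \<partial>lborel) \<longlonglongrightarrow> 0" by simp
  then have "eventually (\<lambda>n. (\<integral>\<^sup>+t. ?q n t \<partial>lborel) < ennreal e) sequentially"
    using e by (intro order_tendstoD) auto
  then obtain n where "(\<integral>\<^sup>+t. ?q n t \<partial>lborel) < ennreal e"
    by (auto simp: eventually_sequentially)
  then show thesis by (intro that[of "1 / Suc n"]) auto
qed

text \<open>The constant is |k(0)| plus the L^1 norm of k', for the shifted kernel k. For a < 1 it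
  blows up as \<epsilon> tends to 0, which is harmless: \<epsilon> is fixed before the bound b on
  the primitive is chosen.\<close>

lemma RL_kernel_shift_convol_bound:
  assumes a: "0 < a" and \<epsilon>: "0 < \<epsilon>"
  obtains A where "0 \<le> A"
    "\<And>z b t. L2_borel T z \<Longrightarrow> (\<And>s. s \<in> {0..T} \<Longrightarrow> \<bar>convol (RL_kernel 1) z s\<bar> \<le> b) \<Longrightarrow> t \<in> {0<..<T} \<Longrightarrow>
       \<bar>convol (\<lambda>t. if t \<in> {0<..<T} then RL_kernel a (t + \<epsilon>) else 0) z t\<bar> \<le> A * b"
proof -
  define k where "k t = (t + \<epsilon>) powr (a - 1) / Gamma a" for t
  define k' where "k' t = (a - 1) * (t + \<epsilon>) powr (a - 1 - 1) / Gamma a" for t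
  define k1 where "k1 t = (if t \<in> {0<..<T} then k' t else 0)" for t
  have G: "Gamma a \<noteq> 0" using Gamma_real_pos[OF a] by simp
  have der: "(k has_real_derivative k' t) (at t within {0..T})" if "t \<in> {0..T}" for t
    unfolding k_def k'_def using that \<epsilon> G by (auto intro!: derivative_eq_intros)
  have cont: "continuous_on {0..T} k'"
    unfolding k'_def using \<epsilon> G by (auto intro!: continuous_intros)
  have k: "(\<lambda>t. if t \<in> {0<..<T} then RL_kernel a (t + \<epsilon>) else 0) = (\<lambda>t. if t \<in> {0<..<T} then k t else 0)"
    using \<epsilon> by (auto simp: RL_kernel_def k_def)
  have int: "integrable lborel k1" and ck1: "causal k1"
    using convol_C1_kernel(1,2)[OF der cont, of "\<lambda>x. 0"] by (auto simp: k1_def[abs_def] causal_def)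
  define I where "I = (\<integral>t. \<bar>k1 t\<bar> \<partial>lborel)"
  have I: "(\<integral>\<^sup>+t. nnabs k1 t \<partial>lborel) = ennreal I"
    unfolding I_def nnabs_def using int by (intro nn_integral_eq_integral) auto
  show thesis
  proof (rule that[of "\<bar>k 0\<bar> + I"])
    show "0 \<le> \<bar>k 0\<bar> + I" by (simp add: I_def)
    fix z b t assume z: "L2_borel T z" and b: "\<And>s. s \<in> {0..T} \<Longrightarrow> \<bar>convol (RL_kernel 1) z s\<bar> \<le> b"
      and t: "t \<in> {0<..<T}"
    let ?P = "convol (RL_kernel 1) z"
    have b0: "0 \<le> b" using b[of t] t by auto
    have cP: "causal ?P" using L2_borelD(2)[OF z] by (intro causal_convol) auto
    have "nnabs (convol k1 ?P) t \<le> nnconvol (nnabs k1) (nnabs ?P) t" by (rule nnabs_convol_le)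
    also have "\<dots> \<le> (\<integral>\<^sup>+s. ennreal b * nnabs k1 (t - s) \<partial>lborel)"
      unfolding nnconvol_def
    proof (rule nn_integral_mono)
      fix s
      show "nnabs k1 (t - s) * nnabs ?P s \<le> ennreal b * nnabs k1 (t - s)"
      proof (cases "0 < s \<and> s < t")
        case True
        then have "nnabs ?P s \<le> ennreal b" using t b[of s] by (auto simp: nnabs_def intro!: ennreal_leI)
        then show ?thesis by (subst mult.commute) (rule mult_right_mono, simp_all)
      next
        case False
        then have "nnabs k1 (t - s) * nnabs ?P s = 0"
          using cP ck1 by (auto simp: causal_def nnabs_def not_less)
        then show ?thesis by (rule ord_eq_le_trans) simp
      qed
    qed
    also have "\<dots> = ennreal b * (\<integral>\<^sup>+s. nnabs k1 (t - s) \<partial>lborel)"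
      using int by (intro nn_integral_cmult) (auto simp: nnabs_def)
    also have "(\<integral>\<^sup>+s. nnabs k1 (t - s) \<partial>lborel) = ennreal I"
      using nn_integral_real_affine[of "nnabs k1" "-1" t] int I by simp
    finally have "\<bar>convol k1 ?P t\<bar> \<le> b * I"
      using b0 by (simp add: nnabs_def ennreal_mult[symmetric] I_def)
    moreover have "\<bar>k 0 * ?P t\<bar> \<le> \<bar>k 0\<bar> * b"
      using b[of t] t by (simp add: abs_mult mult_left_mono)
    moreover have "convol (\<lambda>t. if t \<in> {0<..<T} then k t else 0) z t = k 0 * ?P t + convol k1 ?P t"
      using convol_C1_kernel(4)[OF der cont L2_borelD(3,2)[OF z], of t] t by (simp add: k1_def[abs_def])
    ultimately show "\<bar>convol (\<lambda>t. if t \<in> {0<..<T} then RL_kernel a (t + \<epsilon>) else 0) z t\<bar> \<le> (\<bar>k 0\<bar> + I) * b"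
      unfolding k by (simp add: algebra_simps)
  qed
qed

text \<open>The kernel is replaced by its shift by \<open>\<epsilon>\<close>, at the price of a small \<open>L\<^sup>1\<close> error. The
  shifted kernel is continuously differentiable up to \<open>0\<close>, so that integration by parts moves the
  burden to the primitive of \<open>z\<close>.\<close>

lemma sq_norm_convol_RL_kernel_small:
  assumes a: "0 < a" "a < 1" and T: "0 < T" and e: "0 < e" and D: "0 \<le> D"
  obtains b where "0 < b"
    "\<And>z. L2_borel T z \<Longrightarrow> sq_norm T z \<le> ennreal D \<Longrightarrow>
       (\<And>s. s \<in> {0..T} \<Longrightarrow> \<bar>convol (RL_kernel 1) z s\<bar> \<le> b) \<Longrightarrow>
       sq_norm T (convol (RL_kernel a) z) \<le> ennreal e"
proof -
  \<comment> \<open>Allots e/2 to the kernel error; the summand 1 covers D = 0.\<close>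
  define \<kappa> where "\<kappa> = sqrt (e / (4 * (D + 1)))"
  have \<kappa>: "0 < \<kappa>" "2 * (\<kappa>\<^sup>2 * D) \<le> e / 2"
  proof -
    show "0 < \<kappa>" using e D by (simp add: \<kappa>_def)
    have "\<kappa>\<^sup>2 = e / (4 * (D + 1))" using e D by (simp add: \<kappa>_def)
    then have "4 * (\<kappa>\<^sup>2 * (D + 1)) = e" using D by (simp add: field_simps)
    moreover have "\<kappa>\<^sup>2 * D \<le> \<kappa>\<^sup>2 * (D + 1)" by (intro mult_left_mono) auto
    ultimately show "2 * (\<kappa>\<^sup>2 * D) \<le> e / 2" by linarith
  qed
  obtain \<epsilon> where \<epsilon>: "0 < \<epsilon>"
    and q: "(\<integral>\<^sup>+t\<in>{0<..<T}. nnabs (\<lambda>t. RL_kernel a t - RL_kernel a (t + \<epsilon>)) t \<partial>lborel) \<le> ennreal \<kappa>"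
    using RL_kernel_shift_approx[OF a \<kappa>(1)] by blast
  define k where "k t = (if t \<in> {0<..<T} then RL_kernel a (t + \<epsilon>) else 0)" for t
  obtain A where A: "0 \<le> A" and Ab: "\<And>z b t. L2_borel T z \<Longrightarrow> (\<And>s. s \<in> {0..T} \<Longrightarrow> \<bar>convol (RL_kernel 1) z s\<bar> \<le> b) \<Longrightarrow>
      t \<in> {0<..<T} \<Longrightarrow> \<bar>convol k z t\<bar> \<le> A * b"
    using RL_kernel_shift_convol_bound[OF a(1) \<epsilon>, of T] unfolding k_def[abs_def] by blast
  define q where "q t = RL_kernel a t - k t" for t
  have [measurable]: "k \<in> borel_measurable borel" "q \<in> borel_measurable borel"
    unfolding k_def q_def by measurable
  have G: "0 < Gamma a" using a by (simp add: Gamma_real_pos)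
  have kle: "0 \<le> k t \<and> k t \<le> RL_kernel a t" for t
    using \<epsilon> a G by (auto simp: k_def RL_kernel_def intro!: divide_right_mono powr_mono2')
  have ck: "causal k" "causal q" by (auto simp: causal_def k_def q_def RL_kernel_def)
  have Q: "(\<integral>\<^sup>+t\<in>{0<..<T}. nnabs q t \<partial>lborel) \<le> ennreal \<kappa>"
  proof -
    have "(\<integral>\<^sup>+t\<in>{0<..<T}. nnabs q t \<partial>lborel) =
        (\<integral>\<^sup>+t\<in>{0<..<T}. nnabs (\<lambda>t. RL_kernel a t - RL_kernel a (t + \<epsilon>)) t \<partial>lborel)"
      by (rule nn_integral_cong) (auto simp: indicator_def nnabs_def q_def k_def)
    with q show ?thesis by simp
  qed
  \<comment> \<open>Allots the other e/2 to the shifted kernel, by way of the sup bound A b on an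
    interval of length T.\<close>
  define b where "b = sqrt (e / (4 * T)) / (A + 1)"
  have b: "0 < b" "2 * ((A * b)\<^sup>2 * T) \<le> e / 2"
  proof -
    show b0: "0 < b" using e T A by (simp add: b_def)
    have "A * b \<le> (A + 1) * b" using b0 by (simp add: algebra_simps)
    also have "\<dots> = sqrt (e / (4 * T))" using A by (simp add: b_def)
    finally have "(A * b)\<^sup>2 \<le> (sqrt (e / (4 * T)))\<^sup>2" using A b0 by (intro power_mono) auto
    also have "\<dots> = e / (4 * T)" using e T by simp
    finally have "(A * b)\<^sup>2 * T \<le> e / (4 * T) * T" using T by (intro mult_right_mono) auto
    then show "2 * ((A * b)\<^sup>2 * T) \<le> e / 2" using T by simp
  qed
  show thesis
  proof (rule that[OF b(1)])
    fix z assume z: "L2_borel T z" and zD: "sq_norm T z \<le> ennreal D"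
      and zb: "\<And>s. s \<in> {0..T} \<Longrightarrow> \<bar>convol (RL_kernel 1) z s\<bar> \<le> b"
    note [measurable] = L2_borelD(1)[OF z]
    have "sq_norm T (convol (RL_kernel a) z) = sq_norm T (\<lambda>t. convol k z t + convol q z t)"
    proof (rule sq_norm_cong_AE)
      show "AE t in lborel. t \<in> {0<..<T} \<longrightarrow> convol (RL_kernel a) z t = convol k z t + convol q z t"
        using AE_nnconvol_RL_kernel_finite[OF z a(1)]
      proof eventually_elim
        case (elim t)
        show ?case
        proof
          assume "t \<in> {0<..<T}"
          then have fin: "nnconvol (nnabs (RL_kernel a)) (nnabs z) t < \<infinity>" using elim by simp
          have le: "nnabs k x \<le> nnabs (RL_kernel a) x" "nnabs q x \<le> nnabs (RL_kernel a) x" for x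
            using kle[of x] by (auto simp: nnabs_def q_def intro!: ennreal_leI)
          have "integrable lborel (\<lambda>s. k (t - s) * z s)" "integrable lborel (\<lambda>s. q (t - s) * z s)"
            using nnconvol_mono[of "nnabs k" "nnabs (RL_kernel a)" "nnabs z" "nnabs z" t]
              nnconvol_mono[of "nnabs q" "nnabs (RL_kernel a)" "nnabs z" "nnabs z" t] fin le
            by (auto simp: convol_integrable_iff intro: le_less_trans)
          then have "convol k z t + convol q z t = (\<integral>s. k (t - s) * z s + q (t - s) * z s \<partial>lborel)"
            by (simp add: convol_def)
          then show "convol (RL_kernel a) z t = convol k z t + convol q z t"
            by (simp add: convol_def q_def algebra_simps)
        qed
      qed
    qed
    also have "\<dots> \<le> 2 * sq_norm T (convol k z) + 2 * sq_norm T (convol q z)"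
      by (rule sq_norm_add_le) measurable
    also have "\<dots> \<le> 2 * ennreal ((A * b)\<^sup>2 * T) + 2 * ((ennreal \<kappa>)\<^sup>2 * ennreal D)"
    proof (intro add_mono mult_left_mono)
      show "sq_norm T (convol k z) \<le> ennreal ((A * b)\<^sup>2 * T)"
        using T by (intro sq_norm_le_const Ab[OF z zb]) auto
      have "sq_norm T (convol q z) \<le> (\<integral>\<^sup>+t\<in>{0<..<T}. nnabs q t \<partial>lborel)\<^sup>2 * sq_norm T z"
        using ck L2_borelD[OF z] by (intro sq_norm_convol_le) auto
      also have "\<dots> \<le> (ennreal \<kappa>)\<^sup>2 * ennreal D"
        using Q zD by (intro mult_mono power_mono) auto
      finally show "sq_norm T (convol q z) \<le> (ennreal \<kappa>)\<^sup>2 * ennreal D" .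
    qed auto
    also have "\<dots> = ennreal (2 * ((A * b)\<^sup>2 * T) + 2 * (\<kappa>\<^sup>2 * D))"
      using \<kappa>(1) D T by (simp add: ennreal_mult ennreal_plus ennreal_power)
    also have "\<dots> \<le> ennreal e" using b(2) \<kappa>(2) by (intro ennreal_leI) simp
    finally show "sq_norm T (convol (RL_kernel a) z) \<le> ennreal e" .
  qed
qed

text \<open>Arzela-Ascoli with the common modulus sqrt(D |t - s|); the uniform bound follows from it
  because all primitives vanish at 0. The Cauchy form of the conclusion is what a difference of two
  members of the subsequence needs.\<close>

lemma primitives_uniformly_convergent_subsequence:
  assumes w: "\<And>n. L2_borel T (w n)" and wD: "\<And>n. sq_norm T (w n) \<le> ennreal D" and T: "0 < T" and D: "0 \<le> D"
  obtains r :: "nat \<Rightarrow> nat" where "strict_mono r"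
    "\<And>e. 0 < e \<Longrightarrow> \<exists>N. \<forall>m\<ge>N. \<forall>n\<ge>N. \<forall>t\<in>{0..T}.
       \<bar>convol (RL_kernel 1) (w (r m)) t - convol (RL_kernel 1) (w (r n)) t\<bar> \<le> e"
proof -
  let ?P = "\<lambda>n. convol (RL_kernel 1) (w n)"
  have H: "(?P n t - ?P n s)\<^sup>2 \<le> \<bar>t - s\<bar> * D" for n s t
  proof -
    have *: "(?P n t - ?P n s)\<^sup>2 \<le> (t - s) * D" if "s \<le> t" for s t
    proof -
      have "ennreal ((?P n t - ?P n s)\<^sup>2) \<le> ennreal (t - s) * sq_norm T (w n)"
        by (rule primitive_Hoelder[OF w that])
      also have "\<dots> \<le> ennreal (t - s) * ennreal D" by (intro mult_left_mono wD) simp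
      also have "\<dots> = ennreal ((t - s) * D)" using that D by (simp add: ennreal_mult)
      finally show ?thesis using that D by (simp add: ennreal_le_iff)
    qed
    show ?thesis using *[of s t] *[of t s] by (cases "s \<le> t") (auto simp: power2_commute)
  qed
  have P0: "?P n 0 = 0" for n
    using causal_convol[OF causal_RL_kernel L2_borelD(2)[OF w]] by (simp add: causal_def)
  obtain g and r :: "nat \<Rightarrow> nat" where r: "strict_mono r"
    and lim: "\<And>e. 0 < e \<Longrightarrow> \<exists>N. \<forall>n x. n \<ge> N \<and> x \<in> {0..T} \<longrightarrow> norm (?P (r n) x - g x) < e"
  proof (rule Arzela_Ascoli[of "{0..T}" ?P "sqrt (T * D)"])
    show "norm (?P n x) \<le> sqrt (T * D)" if "x \<in> {0..T}" for n x
    proof -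
      have "(?P n x)\<^sup>2 \<le> x * D" using H[of n x 0] P0[of n] that by simp
      also have "\<dots> \<le> T * D" using that D by (intro mult_right_mono) auto
      finally show ?thesis by (simp add: real_le_rsqrt)
    qed
    show "\<exists>d>0. \<forall>n y. y \<in> {0..T} \<and> norm (x - y) < d \<longrightarrow> norm (?P n x - ?P n y) < e" if e: "0 < e" for x e
    proof (intro exI[of _ "e\<^sup>2 / (D + 1)"] conjI allI impI)
      show "0 < e\<^sup>2 / (D + 1)" using e D by simp
      fix n y assume y: "y \<in> {0..T} \<and> norm (x - y) < e\<^sup>2 / (D + 1)"
      have "(?P n x - ?P n y)\<^sup>2 \<le> \<bar>x - y\<bar> * D" by (rule H)
      also have "\<dots> \<le> \<bar>x - y\<bar> * (D + 1)" by (intro mult_left_mono) auto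
      also have "\<dots> < e\<^sup>2" using y D by (simp add: pos_less_divide_eq)
      finally have "(?P n x - ?P n y)\<^sup>2 < e\<^sup>2" .
      then show "norm (?P n x - ?P n y) < e"
        using e by (intro power2_less_imp_less[of "norm (?P n x - ?P n y)" e]) simp_all
    qed
  qed auto
  show thesis
  proof (rule that[OF r])
    fix e :: real assume "0 < e"
    then obtain N where N: "\<And>n x. n \<ge> N \<Longrightarrow> x \<in> {0..T} \<Longrightarrow> \<bar>?P (r n) x - g x\<bar> < e / 2"
      using lim[of "e / 2"] by auto
    have "\<bar>?P (r m) t - ?P (r n) t\<bar> \<le> e" if "N \<le> m" "N \<le> n" "t \<in> {0..T}" for m n t
      using N[OF that(1,3)] N[OF that(2,3)] by linarith
    then show "\<exists>N. \<forall>m\<ge>N. \<forall>n\<ge>N. \<forall>t\<in>{0..T}. \<bar>?P (r m) t - ?P (r n) t\<bar> \<le> e" by blast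
  qed
qed

context C1_kernel
begin

lemma op_S_compact: "L2_compact_operator T (op_S T \<gamma> m)"
  unfolding L2_compact_operator_def
proof (intro conjI allI impI op_S_linear)
  fix f :: "nat \<Rightarrow> real \<Rightarrow> real"
  assume f: "(\<forall>n. f n \<in> L2 T) \<and> (\<exists>C. \<forall>n. L2_norm T (f n) \<le> C)"
  then obtain C where C: "\<And>n. L2_norm T (f n) \<le> C" by blast
  have "\<forall>n. \<exists>f'. borel_rep T (f n) f' \<and> L2_borel T f'" using f L2_obtain_borel by metis
  then obtain f' where f': "\<And>n. borel_rep T (f n) (f' n)" "\<And>n. L2_borel T (f' n)" by metis
  obtain B where B: "0 \<le> B" "\<And>u. L2_borel T u \<Longrightarrow> sq_norm T (dB u) \<le> ennreal B * sq_norm T u"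
    using dB_bounded by blast
  define w where "w n = dB (f' n)" for n
  define D where "D = B * C\<^sup>2"
  have D: "0 \<le> D" using B by (simp add: D_def)
  have w: "L2_borel T (w n)" for n unfolding w_def by (rule L2_borel_dB[OF f'(2)])
  note [measurable] = L2_borelD(1)[OF w]
  have wD: "sq_norm T (w n) \<le> ennreal D" for n
  proof -
    have eq: "sq_norm T (f n) = sq_norm T (f' n)"
      using f'(1)[of n] by (intro sq_norm_cong_AE) (auto simp: borel_rep_def)
    have "f n \<in> borel_measurable (I_meas T)" using f by (auto simp: L2_iff)
    then have "sqrt (enn2real (sq_norm T (f' n))) \<le> C" using C[of n] by (simp add: L2_norm_eq eq)
    then have "enn2real (sq_norm T (f' n)) \<le> C\<^sup>2" by (rule sqrt_le_D)
    then have "sq_norm T (f' n) \<le> ennreal (C\<^sup>2)"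
      using L2_borelD(4)[OF f'(2)[of n]] by (simp add: enn2real_le less_top)
    then have "ennreal B * sq_norm T (f' n) \<le> ennreal B * ennreal (C\<^sup>2)" by (intro mult_left_mono) auto
    then show ?thesis using B(2)[OF f'(2)[of n]] B(1)
      by (simp add: w_def D_def ennreal_mult)
  qed
  obtain r :: "nat \<Rightarrow> nat" where r: "strict_mono r"
    and unif: "\<And>e. 0 < e \<Longrightarrow> \<exists>N. \<forall>m\<ge>N. \<forall>n\<ge>N. \<forall>t\<in>{0..T}.
       \<bar>convol (RL_kernel 1) (w (r m)) t - convol (RL_kernel 1) (w (r n)) t\<bar> \<le> e"
    using primitives_uniformly_convergent_subsequence[of T w D, OF w wD T D] by metis
  define V where "V n = convol (RL_kernel \<gamma>) (w (r n))" for n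
  have [measurable]: "V n \<in> borel_measurable borel" for n unfolding V_def by measurable
  have VI: "V n \<in> borel_measurable (I_meas T)" for n by (rule measurable_I_meas_cong[of "V n"]) auto
  have Cauchy: "\<exists>N. \<forall>m\<ge>N. \<forall>n\<ge>N. sq_norm T (\<lambda>t. V m t - V n t) \<le> ennreal e" if e: "0 < e" for e
  proof -
    \<comment> \<open>The level 4 D is the bound for the squared norm of a difference of two
      functions whose squared norms are at most D.\<close>
    obtain b where b: "0 < b" and small: "\<And>z. L2_borel T z \<Longrightarrow> sq_norm T z \<le> ennreal (4 * D) \<Longrightarrow>
       (\<And>s. s \<in> {0..T} \<Longrightarrow> \<bar>convol (RL_kernel 1) z s\<bar> \<le> b) \<Longrightarrow>
       sq_norm T (convol (RL_kernel \<gamma>) z) \<le> ennreal e"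
      using sq_norm_convol_RL_kernel_small[OF \<gamma> T e mult_nonneg_nonneg[of 4 D, OF _ D]] by auto
    obtain N where N: "\<forall>m\<ge>N. \<forall>n\<ge>N. \<forall>t\<in>{0..T}.
       \<bar>convol (RL_kernel 1) (w (r m)) t - convol (RL_kernel 1) (w (r n)) t\<bar> \<le> b"
      using unif[OF b] by (elim exE)
    have "sq_norm T (\<lambda>t. V m t - V n t) \<le> ennreal e" if mn: "m \<ge> N" "n \<ge> N" for m n
    proof -
      define z where "z = (\<lambda>t. 1 * w (r m) t + (-1) * w (r n) t)"
      have z: "L2_borel T z" unfolding z_def by (rule L2_borel_lin[OF w w])
      have "sq_norm T z \<le> 2 * sq_norm T (\<lambda>t. 1 * w (r m) t) + 2 * sq_norm T (\<lambda>t. (-1) * w (r n) t)"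
        unfolding z_def by (rule sq_norm_add_le) measurable
      also have "\<dots> = 2 * sq_norm T (w (r m)) + 2 * sq_norm T (w (r n))"
        by (subst (1 2) sq_norm_cmult) auto
      also have "\<dots> \<le> 2 * ennreal D + 2 * ennreal D"
        by (intro add_mono mult_left_mono wD) auto
      also have "\<dots> = ennreal (4 * D)"
        using D by (simp add: ennreal_mult distrib_right[symmetric])
      finally have zD: "sq_norm T z \<le> ennreal (4 * D)" .
      have "convol (RL_kernel 1) z s = convol (RL_kernel 1) (w (r m)) s - convol (RL_kernel 1) (w (r n)) s" for s
        unfolding z_def
        by (subst convol_lin) (auto intro: convol_RL_kernel_1_integrable L2_borelD(3)[OF w])
      then have "sq_norm T (convol (RL_kernel \<gamma>) z) \<le> ennreal e"
        using N[rule_format, OF mn] by (intro small[OF z zD]) auto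
      moreover have "sq_norm T (convol (RL_kernel \<gamma>) z) = sq_norm T (\<lambda>t. V m t - V n t)"
      proof (rule sq_norm_cong_AE)
        show "AE t in lborel. t \<in> {0<..<T} \<longrightarrow> convol (RL_kernel \<gamma>) z t = V m t - V n t"
          using AE_nnconvol_RL_kernel_finite[OF w \<gamma>(1), of "r m"] AE_nnconvol_RL_kernel_finite[OF w \<gamma>(1), of "r n"]
          unfolding z_def V_def
          by eventually_elim (intro impI, subst convol_lin, auto simp: convol_integrable_iff)
      qed
      ultimately show ?thesis by simp
    qed
    then show ?thesis by blast
  qed
  obtain v where v: "v \<in> borel_measurable (I_meas T)"
    and lim: "\<And>e. 0 < e \<Longrightarrow> \<exists>N. \<forall>n\<ge>N. sq_norm T (\<lambda>t. V n t - v t) \<le> ennreal e"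
    using L2_Cauchy_converges[of V "I_meas T"] VI Cauchy unfolding sq_norm_I_meas by blast
  \<comment> \<open>Completeness delivers a limit measurable for \<open>I_meas T\<close>; its Borel
    representative serves as the limit from here on.\<close>
  obtain v' where v': "borel_rep T v v'" using borel_rep_exists[OF v] .
  then have [measurable]: "v' \<in> borel_measurable borel" by (simp add: borel_rep_def)
  have vv': "AE t in lborel. t \<in> {0<..<T} \<longrightarrow> v t = v' t" using v' by (simp add: borel_rep_def)
  have S: "AE t in lborel. t \<in> {0<..<T} \<longrightarrow> op_S T \<gamma> m (f (r n)) t - v' t = V n t - v t" for n
    using vv' by eventually_elim (auto simp: op_S_eq[OF f'] V_def w_def)
  have "v' \<in> L2 T"
  proof -
    obtain n where n: "sq_norm T (\<lambda>t. V n t - v t) \<le> ennreal 1" using lim[of 1] by auto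
    have "sq_norm T v' = sq_norm T (\<lambda>t. V n t + (-1) * (V n t - v' t))"
      by (rule sq_norm_cong_AE) simp
    also have "\<dots> \<le> 2 * sq_norm T (V n) + 2 * sq_norm T (\<lambda>t. (-1) * (V n t - v' t))"
      by (rule sq_norm_add_le) measurable
    also have "sq_norm T (\<lambda>t. (-1) * (V n t - v' t)) = sq_norm T (\<lambda>t. V n t - v' t)"
      by (subst sq_norm_cmult) auto
    also have "\<dots> = sq_norm T (\<lambda>t. V n t - v t)"
      using vv' by (intro sq_norm_cong_AE) (auto elim!: eventually_mono)
    also have "2 * sq_norm T (V n) + 2 * sq_norm T (\<lambda>t. V n t - v t) < \<infinity>"
    proof -
      have "sq_norm T (V n) < \<infinity>"
        using op_S_L2[OF f', of "r n"] unfolding V_def w_def L2_iff by simp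
      moreover have "sq_norm T (\<lambda>t. V n t - v t) < \<infinity>" using n by (rule le_less_trans) simp
      ultimately show ?thesis by (auto simp: ennreal_mult_less_top)
    qed
    finally show ?thesis unfolding L2_iff by (auto intro: measurable_I_meas_cong[of v'])
  qed
  moreover have "(\<lambda>n. L2_norm T (\<lambda>t. op_S T \<gamma> m (f (r n)) t - v' t)) \<longlonglongrightarrow> 0"
  proof (rule LIMSEQ_I)
    fix e :: real assume e: "0 < e"
    then obtain N where N: "\<And>n. n \<ge> N \<Longrightarrow> sq_norm T (\<lambda>t. V n t - v t) \<le> ennreal ((e / 2)\<^sup>2)"
      using lim[of "(e / 2)\<^sup>2"] by auto
    have "norm (L2_norm T (\<lambda>t. op_S T \<gamma> m (f (r n)) t - v' t) - 0) < e" if "n \<ge> N" for n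
    proof -
      have meas: "(\<lambda>t. op_S T \<gamma> m (f (r n)) t - v' t) \<in> borel_measurable (I_meas T)"
      proof (rule measurable_I_meas_cong)
        show "(\<lambda>t. V n t - v' t) \<in> borel_measurable borel" by measurable
      qed (simp add: op_S_eq[OF f'] V_def w_def)
      have "L2_norm T (\<lambda>t. op_S T \<gamma> m (f (r n)) t - v' t) = sqrt (enn2real (sq_norm T (\<lambda>t. V n t - v t)))"
        unfolding L2_norm_eq[OF meas] sq_norm_cong_AE[OF S] ..
      also have "\<dots> \<le> sqrt ((e / 2)\<^sup>2)"
        using N[OF that] by (intro real_sqrt_le_mono enn2real_leI) auto
      also have "\<dots> < e" using e by simp
      finally show ?thesis by (simp add: L2_norm_def)
    qed
    then show "\<exists>N. \<forall>n\<ge>N. norm (L2_norm T (\<lambda>t. op_S T \<gamma> m (f (r n)) t - v' t) - 0) < e" by blast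
  qed
  ultimately show "\<exists>(r :: nat \<Rightarrow> nat) v. strict_mono r \<and> v \<in> L2 T \<and>
      (\<lambda>n. L2_norm T (\<lambda>t. op_S T \<gamma> m (f (r n)) t - v t)) \<longlonglongrightarrow> 0"
    using r by blast
qed

end

section \<open>The null space of \<open>I + S\<close>\<close>

text \<open>Dominated convergence along c = -n, with the unweighted kernel as majorant.\<close>

lemma RL_kernel_exp_weight_small:
  assumes a: "0 < a" and e: "0 < e"
  obtains c where "c \<le> 0"
    "(\<integral>\<^sup>+t\<in>{0<..<T}. nnabs (\<lambda>t. exp (c * t) * RL_kernel a t) t \<partial>lborel) \<le> ennreal e"
proof -
  let ?q = "\<lambda>n t. nnabs (\<lambda>t. exp (- real n * t) * RL_kernel a t) t * indicator {0<..<T} t"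
  have "(\<lambda>n. \<integral>\<^sup>+t. ?q n t \<partial>lborel) \<longlonglongrightarrow> (\<integral>\<^sup>+t. 0 \<partial>(lborel :: real measure))"
  proof (rule nn_integral_dominated_convergence[where w="\<lambda>t. nnabs (RL_kernel a) t * indicator {0<..<T} t"])
    show "AE t in lborel. ?q n t \<le> nnabs (RL_kernel a) t * indicator {0<..<T} t" for n
    proof (rule AE_I2)
      fix t
      have "\<bar>exp (- real n * t) * RL_kernel a t\<bar> \<le> \<bar>RL_kernel a t\<bar>" if "0 < t"
        unfolding abs_mult using that by (intro mult_left_le_one_le) auto
      then show "?q n t \<le> nnabs (RL_kernel a) t * indicator {0<..<T} t"
        by (auto simp: indicator_def nnabs_def intro!: ennreal_leI)
    qed
    show "(\<integral>\<^sup>+t. nnabs (RL_kernel a) t * indicator {0<..<T} t \<partial>lborel) < \<infinity>"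
      by (rule RL_kernel_integral_finite[OF a])
    show "AE t in lborel. (\<lambda>n. ?q n t) \<longlonglongrightarrow> 0"
    proof (rule AE_I2)
      fix t :: real
      show "(\<lambda>n. ?q n t) \<longlonglongrightarrow> 0"
      proof (cases "0 < t")
        case True
        have "(\<lambda>n. exp (- t) ^ n) \<longlonglongrightarrow> 0"
          using True by (intro LIMSEQ_realpow_zero) auto
        then have "(\<lambda>n. exp (- real n * t)) \<longlonglongrightarrow> 0"
          by (simp add: exp_of_nat_mult[symmetric])
        then have "(\<lambda>n. \<bar>exp (- real n * t) * RL_kernel a t\<bar>) \<longlonglongrightarrow> \<bar>0 * RL_kernel a t\<bar>"
          by (intro tendsto_intros)
        then have "(\<lambda>n. nnabs (\<lambda>t. exp (- real n * t) * RL_kernel a t) t) \<longlonglongrightarrow> 0"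
          unfolding nnabs_def by (auto dest: tendsto_ennrealI)
        then show ?thesis by (cases "t < T") (auto simp: indicator_def)
      qed (simp add: indicator_def)
    qed
  qed measurable
  then have "(\<lambda>n. \<integral>\<^sup>+t. ?q n t \<partial>lborel) \<longlonglongrightarrow> 0" by simp
  then have "eventually (\<lambda>n. (\<integral>\<^sup>+t. ?q n t \<partial>lborel) < ennreal e) sequentially"
    using e by (intro order_tendstoD) auto
  then obtain n where "(\<integral>\<^sup>+t. ?q n t \<partial>lborel) < ennreal e"
    by (auto simp: eventually_sequentially)
  then show thesis by (intro that[of "- real n"]) auto
qed

lemma sq_norm_eq_0_iff:
  assumes [measurable]: "f \<in> borel_measurable borel"
  shows "sq_norm T f = 0 \<longleftrightarrow> (AE t in lborel. t \<in> {0<..<T} \<longrightarrow> f t = 0)"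
  unfolding sq_norm_def by (subst nn_integral_0_iff_AE) (auto simp: indicator_def)

context C1_kernel
begin

lemma volterra_unique:
  assumes u: "L2_borel T u"
    and eq: "AE t in lborel. t \<in> {0<..<T} \<longrightarrow> u t + convol (RL_kernel \<gamma>) (dB u) t = 0"
  shows "AE t in lborel. t \<in> {0<..<T} \<longrightarrow> u t = 0"
proof -
  note [measurable] = L2_borelD(1)[OF u]
  obtain C where C: "0 \<le> C" and CE: "\<And>u c. L2_borel T u \<Longrightarrow> c \<le> 0 \<Longrightarrow>
      sq_norm T (\<lambda>t. exp (c * t) * dB u t) \<le> ennreal C * sq_norm T (\<lambda>t. exp (c * t) * u t)"
    using dB_exp_bounded by blast
  \<comment> \<open>Chosen so that \<kappa>^2 C \<le> 1/2, where C does not depend on the weight; c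
    can therefore be selected afterwards, and one application of Young's inequality
    contracts.\<close>
  define \<kappa> where "\<kappa> = sqrt (1 / (2 * (C + 1)))"
  have \<kappa>: "0 < \<kappa>" "\<kappa>\<^sup>2 * C \<le> 1 / 2"
    using C by (auto simp: \<kappa>_def field_simps)
  obtain c where c: "c \<le> 0"
    and q: "(\<integral>\<^sup>+t\<in>{0<..<T}. nnabs (\<lambda>t. exp (c * t) * RL_kernel \<gamma> t) t \<partial>lborel) \<le> ennreal \<kappa>"
    using RL_kernel_exp_weight_small[OF \<gamma>(1) \<kappa>(1)] by blast
  let ?E = "\<lambda>f t. exp (c * t) * (f t :: real)"
  let ?X = "sq_norm T (?E u)"
  have "?X = sq_norm T (convol (?E (RL_kernel \<gamma>)) (?E (dB u)))"
  proof -
    have "?X = sq_norm T (\<lambda>t. (-1) * ?E (convol (RL_kernel \<gamma>) (dB u)) t)"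
    proof (rule sq_norm_cong_AE)
      show "AE t in lborel. t \<in> {0<..<T} \<longrightarrow> ?E u t = (-1) * ?E (convol (RL_kernel \<gamma>) (dB u)) t"
        using eq
      proof eventually_elim
        case (elim t)
        show ?case
        proof
          assume "t \<in> {0<..<T}"
          then have "u t = - convol (RL_kernel \<gamma>) (dB u) t" using elim by linarith
          then show "?E u t = (-1) * ?E (convol (RL_kernel \<gamma>) (dB u)) t" by simp
        qed
      qed
    qed
    also have "\<dots> = sq_norm T (?E (convol (RL_kernel \<gamma>) (dB u)))"
      by (subst sq_norm_cmult) auto
    finally show ?thesis unfolding exp_mult_convol .
  qed
  also have "\<dots> \<le> (\<integral>\<^sup>+t\<in>{0<..<T}. nnabs (?E (RL_kernel \<gamma>)) t \<partial>lborel)\<^sup>2 * sq_norm T (?E (dB u))"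
    using L2_borelD(2)[OF L2_borel_dB[OF u]] causal_RL_kernel[of \<gamma>]
    by (intro sq_norm_convol_le) (auto simp: causal_def)
  also have "\<dots> \<le> (ennreal \<kappa>)\<^sup>2 * (ennreal C * ?X)"
    by (intro mult_mono power_mono q CE u c) auto
  also have "\<dots> = ennreal (\<kappa>\<^sup>2 * C) * ?X"
    using C \<kappa> by (simp add: ennreal_power ennreal_mult mult.assoc)
  also have "\<dots> \<le> ennreal (1 / 2) * ?X"
    by (intro mult_right_mono ennreal_leI \<kappa>) simp
  finally have X: "?X \<le> ennreal (1 / 2) * ?X" .
  \<comment> \<open>Finiteness is what makes X \<le> X/2 conclusive, since the inequality also holds
    for an infinite X.\<close>
  have "?X \<le> sq_norm T u"
    unfolding sq_norm_def
  proof (rule nn_integral_mono)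
    fix t
    have "\<bar>exp (c * t) * u t\<bar> \<le> \<bar>u t\<bar>" if "0 < t"
      unfolding abs_mult using that c by (intro mult_left_le_one_le) (auto simp: mult_nonpos_nonneg)
    then show "ennreal ((?E u t)\<^sup>2) * indicator {0<..<T} t \<le> ennreal ((u t)\<^sup>2) * indicator {0<..<T} t"
      by (auto simp: indicator_def abs_le_square_iff intro!: ennreal_leI)
  qed
  then have "?X < \<infinity>" using L2_borelD(4)[OF u] by (rule le_less_trans)
  then obtain x where x: "?X = ennreal x" "0 \<le> x" by (cases ?X) auto
  have "ennreal (1 / 2) * ennreal x = ennreal (1 / 2 * x)"
    using x(2) by (intro ennreal_mult[symmetric]) auto
  then have "ennreal x \<le> ennreal (1 / 2 * x)" using X unfolding x(1) by simp
  then have "x \<le> 1 / 2 * x" using x(2) by (subst (asm) ennreal_le_iff) auto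
  then have "?X = 0" using x by simp
  then have "AE t in lborel. t \<in> {0<..<T} \<longrightarrow> ?E u t = 0"
    by (subst (asm) sq_norm_eq_0_iff) auto
  then show ?thesis by simp
qed

lemma op_S_null_space: "L2_null_space T (\<lambda>u t. u t + op_S T \<gamma> m u t) = L2_zero T"
proof -
  have "L2_eq T (\<lambda>t. u t + op_S T \<gamma> m u t) (\<lambda>t. 0) \<longleftrightarrow> L2_eq T u (\<lambda>t. 0)" if u: "u \<in> L2 T" for u
  proof -
    obtain u' where u': "borel_rep T u u'" "L2_borel T u'" using L2_obtain_borel[OF u] .
    have uu': "AE t in lborel. t \<in> {0<..<T} \<longrightarrow> u t = u' t" using u' by (simp add: borel_rep_def)
    show ?thesis
    proof
      assume "L2_eq T (\<lambda>t. u t + op_S T \<gamma> m u t) (\<lambda>t. 0)"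
      then have "AE t in lborel. t \<in> {0<..<T} \<longrightarrow> u' t + convol (RL_kernel \<gamma>) (dB u') t = 0"
        unfolding L2_eq_def AE_I_meas_iff using uu'
        by eventually_elim (auto simp: op_S_eq[OF u'])
      from volterra_unique[OF u'(2) this] show "L2_eq T u (\<lambda>t. 0)"
        unfolding L2_eq_def AE_I_meas_iff using uu' by eventually_elim auto
    next
      assume "L2_eq T u (\<lambda>t. 0)"
      then have u0: "AE t in lborel. t \<in> {0<..<T} \<longrightarrow> u t = 0"
        unfolding L2_eq_def AE_I_meas_iff .
      then have z: "borel_rep T u (\<lambda>t. 0)" "L2_borel T (\<lambda>t. 0)"
        by (auto simp: borel_rep_def L2_borel_def sq_norm_def)
      have "dB (\<lambda>t. 0) = (\<lambda>t. 0)" by (auto simp: dB_def convol_def fun_eq_iff)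
      then have S0: "op_S T \<gamma> m u t = 0" if "t \<in> {0<..<T}" for t
        using op_S_eq[OF z that] by (simp add: convol_def)
      show "L2_eq T (\<lambda>t. u t + op_S T \<gamma> m u t) (\<lambda>t. 0)"
        unfolding L2_eq_def AE_I_meas_iff using u0 by eventually_elim (auto simp: S0)
    qed
  qed
  then show ?thesis unfolding L2_null_space_def L2_zero_def by blast
qed

end

section \<open>The regularizer\<close>

lemma nnconvol_RL_kernel_le:
  assumes a: "0 < a" and b: "0 < b" and g: "\<And>s. g s \<le> ennreal c * nnabs (RL_kernel b) s"
  shows "nnconvol (nnabs (RL_kernel a)) g t \<le> ennreal c * nnabs (RL_kernel (a + b)) t"
proof -
  have "nnconvol (nnabs (RL_kernel a)) g t
      \<le> nnconvol (nnabs (RL_kernel a)) (\<lambda>s. ennreal c * nnabs (RL_kernel b) s) t"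
    by (intro nnconvol_mono g order_refl)
  also have "\<dots> = ennreal c * nnconvol (nnabs (RL_kernel a)) (nnabs (RL_kernel b)) t"
    unfolding nnconvol_def by (subst nn_integral_cmult[symmetric]) (auto simp: mult_ac)
  finally show ?thesis using a b by (simp add: nnconvol_RL_kernel)
qed

lemma convol_RL_kernel_le:
  assumes a: "0 < a" and b: "0 < b" and c: "0 \<le> c" and f: "\<And>s. \<bar>f s\<bar> \<le> c * RL_kernel b s"
  shows "nnconvol (nnabs (RL_kernel a)) (nnabs f) t < \<infinity>"
    and "\<bar>convol (RL_kernel a) f t\<bar> \<le> c * RL_kernel (a + b) t"
proof -
  have g: "nnabs f s \<le> ennreal c * nnabs (RL_kernel b) s" for s
    using f[of s] b c by (simp add: nnabs_def ennreal_mult[symmetric] RL_kernel_nonneg ennreal_leI)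
  note le = nnconvol_RL_kernel_le[where t=t, OF a b g]
  also have "ennreal c * nnabs (RL_kernel (a + b)) t < \<infinity>"
    by (simp add: nnabs_def ennreal_mult_less_top)
  finally show "nnconvol (nnabs (RL_kernel a)) (nnabs f) t < \<infinity>" .
  have "nnabs (convol (RL_kernel a) f) t \<le> ennreal c * nnabs (RL_kernel (a + b)) t"
    using nnabs_convol_le le by (rule order_trans)
  also have "\<dots> = ennreal (c * RL_kernel (a + b) t)"
    using a b c by (simp add: nnabs_def ennreal_mult RL_kernel_nonneg)
  finally show "\<bar>convol (RL_kernel a) f t\<bar> \<le> c * RL_kernel (a + b) t"
    using a b c by (simp add: nnabs_def RL_kernel_nonneg)
qed

lemma RL_kernel_antimono:
  "0 < a \<Longrightarrow> a \<le> 1 \<Longrightarrow> 0 < x \<Longrightarrow> x \<le> y \<Longrightarrow> RL_kernel a y \<le> RL_kernel a x"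
  by (auto simp: RL_kernel_def Gamma_real_pos less_imp_le intro!: divide_right_mono powr_mono2')

lemma RL_kernel_mono:
  "1 \<le> a \<Longrightarrow> x \<le> y \<Longrightarrow> RL_kernel a x \<le> RL_kernel a y"
  by (auto simp: RL_kernel_def Gamma_real_nonneg intro!: divide_right_mono powr_mono2)

lemma AE_lborel_translate:
  assumes "AE x in lborel. P x"
  shows "AE x in lborel. P (x + h :: real)"
proof -
  obtain N where N: "N \<in> null_sets lborel" "{x. \<not> P x} \<subseteq> N"
    using assms by (auto elim!: AE_E simp: null_sets_def)
  then have [measurable]: "N \<in> sets borel" by auto
  have "AE x in lborel. x \<notin> N" using N(1) by (rule AE_not_in)
  then have "AE x in lborel. h + 1 * x \<notin> N" by (intro AE_borel_affine) auto
  then show ?thesis by eventually_elim (use N(2) in \<open>auto simp: add.commute\<close>)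
qed

text \<open>Here u is a Borel representative of the exact solution, with the bound valid at every
  point. \<open>M\<close> is also the constant m_2 of the step size.\<close>

locale bounded_solution =
  fixes T \<gamma> M :: real and u :: "real \<Rightarrow> real"
  assumes T: "0 < T" and \<gamma>: "0 < \<gamma>" "\<gamma> < 1" and M: "0 < M"
    and u_borel: "u \<in> borel_measurable borel" and u_bound: "\<And>s. \<bar>u s\<bar> \<le> M"
    and u_supp: "\<And>s. s \<notin> {0<..<T} \<Longrightarrow> u s = 0"
begin

declare u_borel [measurable]

lemma u_L2: "L2_borel T u"
proof -
  have "sq_norm T u \<le> ennreal (M\<^sup>2 * T)" by (rule sq_norm_le_const) (auto simp: u_bound T)
  then show ?thesis using u_supp by (auto simp: L2_borel_def intro: le_less_trans)
qed

lemmas u_props = L2_borelD[OF u_L2]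

definition U :: "real \<Rightarrow> real" where "U = convol (RL_kernel 1) u"
definition G :: "real \<Rightarrow> real" where "G = convol (RL_kernel (1 - \<gamma>)) u"

lemma U_measurable [measurable]: "U \<in> borel_measurable borel"
  and G_measurable [measurable]: "G \<in> borel_measurable borel"
  unfolding U_def G_def by measurable

lemma causal_G: "causal G"
  unfolding G_def by (intro causal_convol causal_RL_kernel u_props)

lemma u_le_RL_kernel: "\<bar>u s\<bar> \<le> M * RL_kernel 1 s"
  using u_bound[of s] u_supp[of s] by (cases "0 < s") (auto simp: RL_kernel_1)

lemma G_bound: "\<bar>G s\<bar> \<le> M * RL_kernel (2 - \<gamma>) s"
  unfolding G_def using convol_RL_kernel_le(2)[of "1 - \<gamma>" 1 M u s] M \<gamma> u_le_RL_kernel by simp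

lemma U_diff: "0 \<le> h \<Longrightarrow> \<bar>U (t + h) - U t\<bar> \<le> M * h"
proof -
  assume h: "0 \<le> h"
  note int = convol_RL_kernel_1_integrable[OF u_props(3)]
  have "U (t + h) - U t = (\<integral>s. RL_kernel 1 (t + h - s) * u s - RL_kernel 1 (t - s) * u s \<partial>lborel)"
    unfolding U_def convol_def using int by simp
  then have "ennreal \<bar>U (t + h) - U t\<bar>
      \<le> (\<integral>\<^sup>+s. ennreal (norm (RL_kernel 1 (t + h - s) * u s - RL_kernel 1 (t - s) * u s)) \<partial>lborel)"
    using integral_norm_bound_ennreal[OF Bochner_Integration.integrable_diff[OF int[of "t + h"] int[of t]]] by simp
  also have "\<dots> \<le> (\<integral>\<^sup>+s. ennreal M * indicator {t..<t + h} s \<partial>lborel)"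
    using h u_bound by (intro nn_integral_mono) (auto simp: RL_kernel_1 indicator_def intro!: ennreal_leI)
  also have "\<dots> = ennreal (M * h)"
    using h M by (simp add: nn_integral_cmult_indicator ennreal_mult)
  finally show ?thesis using h M by simp
qed

lemma convol_G: "convol (RL_kernel \<gamma>) G t = U t"
  unfolding G_def U_def using \<gamma> u_props(3) by (intro convol_RL_kernel_inverse) auto

lemma integrable_RL_kernel_G: "integrable lborel (\<lambda>s. RL_kernel \<gamma> (t - s) * G s)"
  using convol_RL_kernel_le(1)[of \<gamma> "2 - \<gamma>" M G t] \<gamma> M G_bound
  by (subst convol_integrable_iff) auto

text \<open>The part of \<open>U (t + h)\<close>, seen as the fractional integral of order \<open>\<gamma>\<close> of \<open>G\<close>, that
  the fractional integral of \<open>G (\<cdot> + h)\<close> over \<open>(0,t)\<close> misses.\<close>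

definition J :: "real \<Rightarrow> real \<Rightarrow> real" where
  "J h t = (\<integral>s. indicator {..h} s * (RL_kernel \<gamma> (t + h - s) * G s) \<partial>lborel)"

text \<open>On 0 < s < h the decreasing kernel k_\<gamma>(t+h-s) is at most k_\<gamma>(t) and at
  most k_\<gamma>(h-s), giving one bound each. After division by h the first tends to 0 for fixed t,
  but its factor t^(\<gamma>-1) lies in L^2 near 0 only if \<gamma> > 1/2. The second becomes a
  constant: no decay, but a majorant.\<close>

lemma J_bound:
  assumes h: "0 < h" and t: "0 < t"
  shows "\<bar>J h t\<bar> \<le> M * h * RL_kernel (2 - \<gamma>) h * RL_kernel \<gamma> t"
    and "\<bar>J h t\<bar> \<le> M * RL_kernel (2 - \<gamma>) h * RL_kernel (\<gamma> + 1) h"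
proof -
  let ?j = "\<lambda>s. indicator {..h} s * (RL_kernel \<gamma> (t + h - s) * G s)"
  let ?c = "M * RL_kernel (2 - \<gamma>) h"
  have int: "integrable lborel ?j"
    using integrable_mult_indicator[OF _ integrable_RL_kernel_G, of "{..h}" "t + h"] by simp
  have c: "0 \<le> ?c" using M \<gamma> by (simp add: RL_kernel_nonneg)
  have Gc: "\<bar>G s\<bar> \<le> ?c" if "s \<le> h" for s
  proof -
    have "\<bar>G s\<bar> \<le> M * RL_kernel (2 - \<gamma>) s" by (rule G_bound)
    also have "\<dots> \<le> ?c" using M that \<gamma> by (intro mult_left_mono RL_kernel_mono) auto
    finally show ?thesis .
  qed
  have G0: "G s = 0" if "s \<le> 0" for s using causal_G that by (simp add: causal_def)
  have J: "ennreal \<bar>J h t\<bar> \<le> (\<integral>\<^sup>+s. ennreal (norm (?j s)) \<partial>lborel)"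
    using integral_norm_bound_ennreal[OF int] by (simp add: J_def)
  note J
  also have "(\<integral>\<^sup>+s. ennreal (norm (?j s)) \<partial>lborel)
      \<le> (\<integral>\<^sup>+s. ennreal (RL_kernel \<gamma> t * ?c) * indicator {0<..h} s \<partial>lborel)"
  proof (rule nn_integral_mono)
    fix s
    show "ennreal (norm (?j s)) \<le> ennreal (RL_kernel \<gamma> t * ?c) * indicator {0<..h} s"
    proof (cases "0 < s \<and> s \<le> h")
      case True
      have "\<bar>RL_kernel \<gamma> (t + h - s)\<bar> * \<bar>G s\<bar> \<le> RL_kernel \<gamma> t * ?c"
        using True t \<gamma> Gc[of s] RL_kernel_antimono[of \<gamma> t "t + h - s"]
        by (intro mult_mono) (auto simp: RL_kernel_nonneg)
      then show ?thesis using True by (simp add: abs_mult ennreal_leI)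
    qed (auto simp: G0)
  qed
  also have "\<dots> = ennreal (RL_kernel \<gamma> t * ?c * h)"
    using h M \<gamma> by (simp add: nn_integral_cmult_indicator ennreal_mult RL_kernel_nonneg)
  finally show "\<bar>J h t\<bar> \<le> M * h * RL_kernel (2 - \<gamma>) h * RL_kernel \<gamma> t"
    using h M \<gamma> by (simp add: RL_kernel_nonneg mult_ac)
  note J
  also have "(\<integral>\<^sup>+s. ennreal (norm (?j s)) \<partial>lborel)
      \<le> (\<integral>\<^sup>+s. ennreal ?c * (nnabs (RL_kernel \<gamma>) (h - s) * nnabs (RL_kernel 1) s) \<partial>lborel)"
  proof (rule nn_integral_mono_AE)
    \<comment> \<open>The point s = h must be excluded: there the majorant vanishes, because
      \<open>RL_kernel \<gamma> 0 = 0\<close>, while the integrand may not.\<close>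
    have "AE s in lborel. s \<noteq> h" by (rule AE_lborel_singleton)
    then show "AE s in lborel. ennreal (norm (?j s)) \<le> ennreal ?c * (nnabs (RL_kernel \<gamma>) (h - s) * nnabs (RL_kernel 1) s)"
    proof eventually_elim
      case (elim s)
      show ?case
      proof (cases "0 < s \<and> s < h")
        case True
        have "\<bar>RL_kernel \<gamma> (t + h - s)\<bar> * \<bar>G s\<bar> \<le> RL_kernel \<gamma> (h - s) * ?c"
          using True t \<gamma> Gc[of s] RL_kernel_antimono[of \<gamma> "h - s" "t + h - s"]
          by (intro mult_mono) (auto simp: RL_kernel_nonneg)
        then have "ennreal (norm (?j s)) \<le> ennreal (RL_kernel \<gamma> (h - s) * ?c)"
          using True by (simp add: abs_mult ennreal_leI)
        also have "\<dots> = ennreal (RL_kernel \<gamma> (h - s)) * ennreal ?c"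
          by (intro ennreal_mult c RL_kernel_nonneg \<gamma>)
        also have "\<dots> = ennreal ?c * (nnabs (RL_kernel \<gamma>) (h - s) * nnabs (RL_kernel 1) s)"
          using True \<gamma> by (simp add: nnabs_def RL_kernel_1 RL_kernel_nonneg mult.commute)
        finally show ?thesis .
      next
        case False
        then have "?j s = 0" using elim by (cases "s \<le> 0") (auto simp: G0)
        then have "ennreal (norm (?j s)) = ennreal (norm (0::real))" by (simp only:)
        then show ?thesis by (rule ord_eq_le_trans) simp
      qed
    qed
  qed
  also have "\<dots> = ennreal ?c * nnconvol (nnabs (RL_kernel \<gamma>)) (nnabs (RL_kernel 1)) h"
    unfolding nnconvol_def by (rule nn_integral_cmult) measurable
  also have "\<dots> = ennreal (?c * RL_kernel (\<gamma> + 1) h)"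
    using c \<gamma> by (simp add: nnconvol_RL_kernel) (simp add: nnabs_def RL_kernel_nonneg ennreal_mult[symmetric])
  finally show "\<bar>J h t\<bar> \<le> M * RL_kernel (2 - \<gamma>) h * RL_kernel (\<gamma> + 1) h"
    using c \<gamma> by (simp add: RL_kernel_nonneg)
qed

text \<open>U(t+h) is the fractional integral of G at t+h. Splitting it at s = h and translating the
  part beyond h by h produces the fractional integral of the shifted data.\<close>

lemma convol_shifted_G:
  assumes h: "0 < h"
  defines "S \<equiv> \<lambda>s. if 0 < s then G (s + h) else 0"
  shows "integrable lborel (\<lambda>s. RL_kernel \<gamma> (t - s) * S s)"
    and "convol (RL_kernel \<gamma>) S t = U (t + h) - J h t"
proof -
  let ?k = "\<lambda>s. RL_kernel \<gamma> (t + h - s) * G s"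
  have int: "integrable lborel (\<lambda>s. indicator {h<..} s * ?k s)" "integrable lborel (\<lambda>s. indicator {..h} s * ?k s)"
    using integrable_mult_indicator[OF _ integrable_RL_kernel_G, of _ "t + h"] by auto
  have S: "RL_kernel \<gamma> (t - s) * S s = indicator {h<..} (h + 1 * s) * ?k (h + 1 * s)" for s
    by (auto simp: S_def indicator_def add.commute)
  show "integrable lborel (\<lambda>s. RL_kernel \<gamma> (t - s) * S s)"
    unfolding S by (rule lborel_integrable_real_affine[OF int(1)]) simp
  have "convol (RL_kernel \<gamma>) S t = (\<integral>s. indicator {h<..} s * ?k s \<partial>lborel)"
    unfolding convol_def S using lborel_integral_real_affine[of 1 "\<lambda>s. indicator {h<..} s * ?k s" h] by simp
  moreover have "U (t + h) = (\<integral>s. indicator {h<..} s * ?k s + indicator {..h} s * ?k s \<partial>lborel)"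
    unfolding convol_G[symmetric] convol_def
    by (rule Bochner_Integration.integral_cong) (auto simp: indicator_def)
  ultimately show "convol (RL_kernel \<gamma>) S t = U (t + h) - J h t"
    using int by (simp add: J_def)
qed

lemma fractional_difference_quotient:
  assumes h: "0 < h" and \<delta>: "0 < \<delta>"
    and n: "n \<in> borel_measurable borel" "\<And>s. \<bar>n s\<bar> \<le> \<delta>"
    and d: "AE s in lborel. 0 \<le> s \<longrightarrow> d s = G s + n s"
  obtains f where "f \<in> borel_measurable borel"
    "\<And>t. 1 / Gamma \<gamma> * (LINT s:{0..t}|lebesgue. ((d (s + h) - d s) / h) / (t - s) powr (1 - \<gamma>)) = f t"
    "\<And>t. \<bar>f t - (U (t + h) - U t - J h t) / h\<bar> \<le> 2 * \<delta> / h * RL_kernel (\<gamma> + 1) t"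
proof -
  define S where "S = (\<lambda>s. if 0 < s then G (s + h) else 0)"
  define \<nu> where "\<nu> = (\<lambda>s. if 0 < s then (n (s + h) - n s) / h else 0)"
  define e where "e s = 1 * ((1 / h) * S s + (- 1 / h) * G s) + 1 * \<nu> s" for s
  note [measurable] = n(1)
  have [measurable]: "S \<in> borel_measurable borel" "\<nu> \<in> borel_measurable borel"
    unfolding S_def \<nu>_def by measurable
  have [measurable]: "e \<in> borel_measurable borel" unfolding e_def by measurable
  have ce: "causal e" using causal_G by (simp add: causal_def e_def S_def \<nu>_def)
  have \<nu>_le: "\<bar>\<nu> s\<bar> \<le> 2 * \<delta> / h * RL_kernel 1 s" for s
  proof (cases "0 < s")
    case True
    have "\<bar>n (s + h) - n s\<bar> \<le> 2 * \<delta>" using n(2)[of s] n(2)[of "s + h"] by linarith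
    then show ?thesis using True h by (simp add: \<nu>_def RL_kernel_1 divide_right_mono)
  qed (simp add: \<nu>_def RL_kernel_1)
  note \<nu> = convol_RL_kernel_le[OF \<gamma>(1) zero_less_one _ \<nu>_le]
  have eq: "AE s in lborel. 0 < s \<longrightarrow> (d (s + h) - d s) / h = e s"
    using d AE_lborel_translate[OF d, of h]
    by eventually_elim (use h in \<open>auto simp: e_def S_def \<nu>_def field_simps\<close>)
  show thesis
  proof (rule that[of "convol (RL_kernel \<gamma>) e"])
    fix t
    show "1 / Gamma \<gamma> * (LINT s:{0..t}|lebesgue. ((d (s + h) - d s) / h) / (t - s) powr (1 - \<gamma>)) = convol (RL_kernel \<gamma>) e t"
      using eq by (intro fractional_integral_eq_convol ce \<gamma>) (auto elim!: eventually_mono)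
    have iS: "integrable lborel (\<lambda>s. RL_kernel \<gamma> (t - s) * S s)"
      unfolding S_def by (rule convol_shifted_G(1)[OF h])
    have i\<nu>: "integrable lborel (\<lambda>s. RL_kernel \<gamma> (t - s) * \<nu> s)"
      using \<nu>(1)[of t] h \<delta> by (subst convol_integrable_iff) auto
    have "integrable lborel (\<lambda>s. (1 / h) * (RL_kernel \<gamma> (t - s) * S s) + (- 1 / h) * (RL_kernel \<gamma> (t - s) * G s))"
      using iS integrable_RL_kernel_G by (intro Bochner_Integration.integrable_add integrable_mult_right)
    then have iSG: "integrable lborel (\<lambda>s. RL_kernel \<gamma> (t - s) * ((1 / h) * S s + (- 1 / h) * G s))"
      by (simp add: algebra_simps)
    have "convol (RL_kernel \<gamma>) e t
        = 1 * convol (RL_kernel \<gamma>) (\<lambda>s. (1 / h) * S s + (- 1 / h) * G s) t + 1 * convol (RL_kernel \<gamma>) \<nu> t"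
      unfolding e_def by (rule convol_lin[OF iSG i\<nu>])
    also have "convol (RL_kernel \<gamma>) (\<lambda>s. (1 / h) * S s + (- 1 / h) * G s) t
        = (1 / h) * convol (RL_kernel \<gamma>) S t + (- 1 / h) * convol (RL_kernel \<gamma>) G t"
      by (rule convol_lin[OF iS integrable_RL_kernel_G])
    also have "\<dots> = (U (t + h) - U t - J h t) / h"
      unfolding S_def convol_shifted_G(2)[OF h] convol_G by (simp add: diff_divide_distrib)
    finally show "\<bar>convol (RL_kernel \<gamma>) e t - (U (t + h) - U t - J h t) / h\<bar> \<le> 2 * \<delta> / h * RL_kernel (\<gamma> + 1) t"
      using \<nu>(2)[of t] h \<delta> by simp
  qed measurable
qed


section \<open>Noisy data: error estimates and the limit in L^2\<close>

lemma op_A_zero_extension: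
  assumes "borel_rep T v u"
  shows "op_A \<gamma> (zero_extension T v) t = G t"
  unfolding G_def
proof (rule op_A_eq_convol)
  have "AE s in lborel. s \<noteq> T" by (rule AE_lborel_singleton)
  moreover have "AE s in lborel. s \<in> {0<..<T} \<longrightarrow> v s = u s" using assms by (simp add: borel_rep_def)
  ultimately show "AE s in lborel. s \<in> {0<..<t} \<longrightarrow> zero_extension T v s = u s"
    by eventually_elim (auto simp: zero_extension_def u_supp)
qed (use u_props in auto)

text \<open>Replacing d by a Borel function may destroy the bound on a null set; truncating the
  difference at level \<delta> restores it everywhere and alters nothing where d was
  matched.\<close>

lemma noisy_data_decomposition:
  assumes d: "d \<in> borel_measurable (lebesgue_on {0..})" "\<And>t. 0 \<le> t \<Longrightarrow> \<bar>d t - G t\<bar> \<le> \<delta>" and \<delta>: "0 < \<delta>"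
  obtains n where "n \<in> borel_measurable borel" "\<And>s. \<bar>n s\<bar> \<le> \<delta>"
    "AE s in lborel. 0 \<le> s \<longrightarrow> d s = G s + n s"
proof -
  have "(\<lambda>x. indicator {0..} x *\<^sub>R d x) \<in> borel_measurable lebesgue"
    using d(1) by (subst (asm) borel_measurable_restrict_space_iff) auto
  then obtain d' where d': "d' \<in> borel_measurable lborel"
      and eq: "AE x in lborel. indicator {0..} x *\<^sub>R d x = d' x"
    using completion_ex_borel_measurable_real by blast
  have [measurable]: "d' \<in> borel_measurable borel" using d' by simp
  show thesis
  proof (rule that[of "\<lambda>s. if \<bar>d' s - G s\<bar> \<le> \<delta> then d' s - G s else 0"])
    show "AE s in lborel. 0 \<le> s \<longrightarrow> d s = G s + (if \<bar>d' s - G s\<bar> \<le> \<delta> then d' s - G s else 0)"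
      using eq
    proof eventually_elim
      case (elim s)
      then show ?case using d(2)[of s] by (auto simp: indicator_def)
    qed
  qed (use \<delta> in \<open>auto simp: less_imp_le\<close>)
qed

lemma R1_op_estimates:
  fixes \<delta> :: real
  defines "h \<equiv> step_size M \<delta>"
  assumes \<delta>: "0 < \<delta>" and d: "d \<in> borel_measurable (lebesgue_on {0..})" "\<And>t. 0 \<le> t \<Longrightarrow> \<bar>d t - G t\<bar> \<le> \<delta>"
  shows "R1_op \<gamma> M \<delta> d \<in> borel_measurable borel"
    and "0 < t \<Longrightarrow> \<bar>R1_op \<gamma> M \<delta> d t - (U (t + h) - U t) / h\<bar>
        \<le> M * RL_kernel (2 - \<gamma>) h * RL_kernel \<gamma> t + M * h / 2 * RL_kernel (\<gamma> + 1) t"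
    and "0 < t \<Longrightarrow> \<bar>R1_op \<gamma> M \<delta> d t\<bar>
        \<le> M + M / (Gamma (2 - \<gamma>) * Gamma (\<gamma> + 1)) + M * h / 2 * RL_kernel (\<gamma> + 1) t"
proof -
  have h: "0 < h" using \<delta> M by (simp add: h_def step_size_def)
  have "h\<^sup>2 = 4 * \<delta> / M" using \<delta> M by (simp add: h_def step_size_def power_mult_distrib)
  \<comment> \<open>The step size enters here: it turns the noise amplification 2\<delta>/h into a
    term of order h.\<close>
  then have \<delta>h: "2 * \<delta> / h = M * h / 2" using h M by (simp add: field_simps power2_eq_square)
  obtain n where n: "n \<in> borel_measurable borel" "\<And>s. \<bar>n s\<bar> \<le> \<delta>"
    "AE s in lborel. 0 \<le> s \<longrightarrow> d s = G s + n s"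
    using noisy_data_decomposition[OF d \<delta>] by blast
  obtain f where f: "f \<in> borel_measurable borel"
    and eq: "\<And>t. 1 / Gamma \<gamma> * (LINT s:{0..t}|lebesgue. ((d (s + h) - d s) / h) / (t - s) powr (1 - \<gamma>)) = f t"
    and est: "\<And>t. \<bar>f t - (U (t + h) - U t - J h t) / h\<bar> \<le> 2 * \<delta> / h * RL_kernel (\<gamma> + 1) t"
    using fractional_difference_quotient[OF h \<delta> n] by blast
  have R: "R1_op \<gamma> M \<delta> d = f"
    using eq by (simp add: R1_op_def R_op_def h_def fun_eq_iff)
  show "R1_op \<gamma> M \<delta> d \<in> borel_measurable borel" using f by (simp add: R)
  have est': "\<bar>f t - (U (t + h) - U t) / h\<bar> \<le> \<bar>J h t\<bar> / h + M * h / 2 * RL_kernel (\<gamma> + 1) t"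
  proof -
    have "f t - (U (t + h) - U t) / h = (f t - (U (t + h) - U t - J h t) / h) - J h t / h"
      by (simp add: diff_divide_distrib)
    then have "\<bar>f t - (U (t + h) - U t) / h\<bar> \<le> \<bar>f t - (U (t + h) - U t - J h t) / h\<bar> + \<bar>J h t / h\<bar>"
      by (simp only: abs_triangle_ineq4)
    moreover have "\<bar>J h t / h\<bar> = \<bar>J h t\<bar> / h" using h by simp
    ultimately show ?thesis using est[of t] unfolding \<delta>h by linarith
  qed
  {
    assume t: "0 < t"
    have "\<bar>J h t\<bar> / h \<le> M * RL_kernel (2 - \<gamma>) h * RL_kernel \<gamma> t"
      using J_bound(1)[OF h t] h by (simp add: pos_divide_le_eq mult_ac)
    then show "\<bar>R1_op \<gamma> M \<delta> d t - (U (t + h) - U t) / h\<bar>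
        \<le> M * RL_kernel (2 - \<gamma>) h * RL_kernel \<gamma> t + M * h / 2 * RL_kernel (\<gamma> + 1) t"
      using est' unfolding R by linarith
    \<comment> \<open>The exponents 1-\<gamma> and \<gamma> add up to 1, so the remainder divided by
      h is bounded by a constant free of both t and h.\<close>
    have "h powr (1 - \<gamma>) * h powr \<gamma> = h"
      using h by (simp add: powr_add[symmetric])
    then have "M * RL_kernel (2 - \<gamma>) h * RL_kernel (\<gamma> + 1) h = M / (Gamma (2 - \<gamma>) * Gamma (\<gamma> + 1)) * h"
      using h by (simp add: RL_kernel_def mult_ac)
    then have "\<bar>J h t\<bar> / h \<le> M / (Gamma (2 - \<gamma>) * Gamma (\<gamma> + 1))"
      using J_bound(2)[OF h t] h by (simp add: pos_divide_le_eq)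
    moreover have "\<bar>(U (t + h) - U t) / h\<bar> \<le> M"
      using U_diff[of h t] h by (simp add: abs_divide pos_divide_le_eq)
    ultimately show "\<bar>R1_op \<gamma> M \<delta> d t\<bar>
        \<le> M + M / (Gamma (2 - \<gamma>) * Gamma (\<gamma> + 1)) + M * h / 2 * RL_kernel (\<gamma> + 1) t"
      using est' unfolding R by linarith
  }
qed

lemma R1_op_L2:
  assumes \<delta>: "0 < \<delta>" and d: "d \<in> borel_measurable (lebesgue_on {0..})" "\<And>t. 0 \<le> t \<Longrightarrow> \<bar>d t - G t\<bar> \<le> \<delta>"
  shows "R1_op \<gamma> M \<delta> d \<in> L2 T"
proof -
  let ?c = "M + M / (Gamma (2 - \<gamma>) * Gamma (\<gamma> + 1)) + M * step_size M \<delta> / 2 * RL_kernel (\<gamma> + 1) T"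
  have "sq_norm T (R1_op \<gamma> M \<delta> d) \<le> ennreal (?c\<^sup>2 * T)"
  proof (rule sq_norm_le_const)
    fix t assume t: "t \<in> {0<..<T}"
    have "M * step_size M \<delta> / 2 * RL_kernel (\<gamma> + 1) t \<le> M * step_size M \<delta> / 2 * RL_kernel (\<gamma> + 1) T"
      using t M \<gamma> \<delta> by (intro mult_left_mono RL_kernel_mono) (auto simp: step_size_def)
    then show "\<bar>R1_op \<gamma> M \<delta> d t\<bar> \<le> ?c" using R1_op_estimates(3)[OF \<delta> d, of t] t by simp
  qed (rule T)
  then show ?thesis unfolding L2_iff
    using R1_op_estimates(1)[OF \<delta> d] by (auto intro: measurable_I_meas_cong le_less_trans)
qed

lemma R1_op_convergence:
  assumes v: "borel_rep T v u" and vI: "v \<in> borel_measurable (I_meas T)"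
    and d: "\<And>\<delta>. 0 < \<delta> \<Longrightarrow> d \<delta> \<in> borel_measurable (lebesgue_on {0..})"
      "\<And>\<delta> t. 0 < \<delta> \<Longrightarrow> 0 \<le> t \<Longrightarrow> \<bar>d \<delta> t - G t\<bar> \<le> \<delta>"
  shows "((\<lambda>\<delta>. L2_norm T (\<lambda>t. R1_op \<gamma> M \<delta> (d \<delta>) t - v t)) \<longlongrightarrow> 0) (at_right 0)"
proof (rule tendsto_at_right_sequentially[of 0 1])
  \<comment> \<open>Dominated convergence works along sequences. Restricting to \<delta> < 1 bounds
    the step by \<open>step_size M 1\<close>, which makes the majorant independent of n.\<close>
  fix S :: "nat \<Rightarrow> real" assume S: "\<And>n. 0 < S n" "\<And>n. S n < 1" "S \<longlonglongrightarrow> 0"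
  define h where "h n = step_size M (S n)" for n
  have h: "0 < h n" for n using S(1)[of n] M by (simp add: h_def step_size_def)
  have h0: "h \<longlonglongrightarrow> 0"
  proof -
    have "(\<lambda>n. 2 * sqrt (S n / M)) \<longlonglongrightarrow> 2 * sqrt (0 / M)"
      by (intro tendsto_intros S(3)) (use M in auto)
    then show ?thesis by (simp add: h_def[abs_def] step_size_def)
  qed
  have h2: "h n \<le> step_size M 1" for n
    using S(2)[of n] M by (simp add: h_def step_size_def divide_right_mono)
  let ?R = "\<lambda>n. R1_op \<gamma> M (S n) (d (S n))"
  note est' = R1_op_estimates[OF S(1) d[OF S(1)], folded h_def]
  have est: "?R n \<in> borel_measurable borel"
    "0 < t \<Longrightarrow> \<bar>?R n t - (U (t + h n) - U t) / h n\<bar>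
        \<le> M * RL_kernel (2 - \<gamma>) (h n) * RL_kernel \<gamma> t + M * h n / 2 * RL_kernel (\<gamma> + 1) t"
    "0 < t \<Longrightarrow> \<bar>?R n t\<bar>
        \<le> M + M / (Gamma (2 - \<gamma>) * Gamma (\<gamma> + 1)) + M * h n / 2 * RL_kernel (\<gamma> + 1) t" for n t
    by (rule est'; assumption)+
  have vu: "AE t in lborel. t \<in> {0<..<T} \<longrightarrow> v t = u t" using v by (simp add: borel_rep_def)
  have uI: "u \<in> borel_measurable (I_meas T)" by (rule measurable_I_meas_cong[OF u_borel]) simp
  have RI: "?R n \<in> borel_measurable (I_meas T)" for n
    by (rule measurable_I_meas_cong[OF est(1)[of n]]) (rule refl)
  have lim: "(\<lambda>n. ?R n t - u t) \<longlonglongrightarrow> 0"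
    if t: "0 < t" and U': "(U has_real_derivative u t) (at t)" for t
  proof -
    have "((\<lambda>k. (U (t + k) - U t) / k) \<longlongrightarrow> u t) (at 0)" using U' by (simp only: DERIV_def)
    moreover have "filterlim h (at 0) sequentially"
      using h0 h by (auto simp: filterlim_at intro!: always_eventually less_imp_neq[symmetric])
    ultimately have q: "(\<lambda>n. (U (t + h n) - U t) / h n) \<longlonglongrightarrow> u t" by (rule filterlim_compose)
    have "(\<lambda>n. h n powr (1 - \<gamma>)) \<longlonglongrightarrow> 0"
      using h \<gamma> by (intro tendsto_zero_powrI[OF h0 tendsto_const]) (auto intro!: always_eventually less_imp_le)
    then have "(\<lambda>n. h n powr (1 - \<gamma>) / Gamma (2 - \<gamma>)) \<longlonglongrightarrow> 0"
      by (rule tendsto_divide_zero)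
    then have r: "(\<lambda>n. RL_kernel (2 - \<gamma>) (h n)) \<longlonglongrightarrow> 0" using h by (simp add: RL_kernel_def)
    have "(\<lambda>n. M * RL_kernel (2 - \<gamma>) (h n) * RL_kernel \<gamma> t + M * h n / 2 * RL_kernel (\<gamma> + 1) t)
        \<longlonglongrightarrow> M * 0 * RL_kernel \<gamma> t + M * 0 / 2 * RL_kernel (\<gamma> + 1) t"
      by (intro tendsto_intros r h0) auto
    then have b: "(\<lambda>n. M * RL_kernel (2 - \<gamma>) (h n) * RL_kernel \<gamma> t + M * h n / 2 * RL_kernel (\<gamma> + 1) t) \<longlonglongrightarrow> 0"
      by simp
    have "(\<lambda>n. ?R n t - (U (t + h n) - U t) / h n) \<longlonglongrightarrow> 0"
      by (rule Lim_null_comparison[OF always_eventually b]) (use est(2)[OF t] in simp)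
    from tendsto_add[OF this tendsto_diff[OF q tendsto_const[of "u t"]]]
    show ?thesis by simp
  qed
  let ?c = "M + M / (Gamma (2 - \<gamma>) * Gamma (\<gamma> + 1)) + M * step_size M 1 / 2 * RL_kernel (\<gamma> + 1) T"
  have bnd: "\<bar>?R n t - u t\<bar> \<le> ?c + M" if t: "t \<in> {0<..<T}" for n t
  proof -
    have "M * h n / 2 * RL_kernel (\<gamma> + 1) t \<le> M * step_size M 1 / 2 * RL_kernel (\<gamma> + 1) T"
      using t M \<gamma> h2[of n] h[of n]
      by (intro mult_mono RL_kernel_mono) (auto simp: step_size_def RL_kernel_nonneg)
    then show ?thesis using est(3)[of t n] t u_bound[of t] by simp
  qed
  have "(\<lambda>n. \<integral>t. (?R n t - v t)\<^sup>2 \<partial>I_meas T) \<longlonglongrightarrow> (\<integral>t. 0 \<partial>I_meas T)"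
  proof (rule integral_dominated_convergence[where w="\<lambda>t. (?c + M)\<^sup>2"])
    show "(\<lambda>t. (?R n t - v t)\<^sup>2) \<in> borel_measurable (I_meas T)" for n
      using RI vI by measurable
    show "integrable (I_meas T) (\<lambda>t. (?c + M)\<^sup>2)"
      by (intro finite_measure.integrable_const finite_measure_lebesgue_on) simp
    show "AE t in I_meas T. (\<lambda>n. (?R n t - v t)\<^sup>2) \<longlonglongrightarrow> 0"
      unfolding AE_I_meas_iff using vu AE_has_real_derivative_convol_RL_kernel_1[OF u_props(3,2)]
    proof eventually_elim
      case (elim t)
      show ?case
      proof
        assume "t \<in> {0<..<T}"
        then have "(\<lambda>n. ?R n t - v t) \<longlonglongrightarrow> 0" using elim lim[of t] by (simp add: U_def)
        then have "(\<lambda>n. (?R n t - v t)\<^sup>2) \<longlonglongrightarrow> 0\<^sup>2" by (rule tendsto_power)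
        then show "(\<lambda>n. (?R n t - v t)\<^sup>2) \<longlonglongrightarrow> 0" by simp
      qed
    qed
    show "AE t in I_meas T. norm ((?R n t - v t)\<^sup>2) \<le> (?c + M)\<^sup>2" for n
      unfolding AE_I_meas_iff using vu
    proof eventually_elim
      case (elim t)
      show ?case
      proof
        assume t: "t \<in> {0<..<T}"
        then have "\<bar>?R n t - v t\<bar> \<le> ?c + M" using elim bnd[OF t, of n] by simp
        then have "\<bar>?R n t - v t\<bar>\<^sup>2 \<le> (?c + M)\<^sup>2" by (rule power_mono) simp
        then show "norm ((?R n t - v t)\<^sup>2) \<le> (?c + M)\<^sup>2" by simp
      qed
    qed
  qed simp
  then have "(\<lambda>n. sqrt (\<integral>t. (?R n t - v t)\<^sup>2 \<partial>I_meas T)) \<longlonglongrightarrow> sqrt 0"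
    by (intro tendsto_real_sqrt) simp
  then show "(\<lambda>n. L2_norm T (\<lambda>t. R1_op \<gamma> M (S n) (d (S n)) t - v t)) \<longlonglongrightarrow> 0"
    by (simp add: L2_norm_def)
qed simp

end

text \<open>The essential bound fails only on a null set; setting a representative to 0 where it is
  too large makes the bound hold at every point.\<close>

lemma Linf_bounded_borel_rep:
  assumes u: "u \<in> Linf T" and M: "Linf_norm T u \<le> ereal M" "0 \<le> M"
  obtains u' where "borel_rep T u u'" "\<And>s. \<bar>u' s\<bar> \<le> M"
proof -
  obtain u0 where u0: "borel_rep T u u0" using u borel_rep_exists unfolding Linf_def by blast
  then have [measurable]: "u0 \<in> borel_measurable borel" by (simp add: borel_rep_def)
  have "AE t in I_meas T. ereal \<bar>u t\<bar> \<le> Linf_norm T u"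
    unfolding Linf_norm_def by (rule esssup_AE)
  then have "AE t in I_meas T. \<bar>u t\<bar> \<le> M"
    by eventually_elim (use M(1) order_trans in fastforce)
  then have "AE t in lborel. t \<in> {0<..<T} \<longrightarrow> \<bar>u t\<bar> \<le> M" unfolding AE_I_meas_iff .
  moreover have "AE t in lborel. t \<in> {0<..<T} \<longrightarrow> u t = u0 t" using u0 by (simp add: borel_rep_def)
  ultimately have "AE t in lborel. t \<in> {0<..<T} \<longrightarrow> u t = (if \<bar>u0 t\<bar> \<le> M then u0 t else 0)"
    by eventually_elim auto
  then have "borel_rep T u (\<lambda>t. if \<bar>u0 t\<bar> \<le> M then u0 t else 0)"
    using u0 unfolding borel_rep_def by auto
  then show thesis using M(2) by (intro that) auto
qed

lemma regularizer_R1_op: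
  assumes "0 < T" "0 < \<gamma>" "\<gamma> < 1" "0 < m\<^sub>2"
  shows "regularizer T (op_A \<gamma>) m\<^sub>2 (R1_op \<gamma> m\<^sub>2)"
  unfolding regularizer_def
proof (intro allI impI)
  fix u g and g\<delta> :: "real \<Rightarrow> real \<Rightarrow> real"
  assume *: "u \<in> W2inf T \<and> W2inf_norm T u \<le> ereal m\<^sub>2 \<and> g = op_A \<gamma> (zero_extension T u) \<and>
    (\<forall>\<delta>>0. g\<delta> \<delta> \<in> borel_measurable (lebesgue_on {0..}) \<and> (\<forall>t\<ge>0. \<bar>g\<delta> \<delta> t - g t\<bar> \<le> \<delta>))"
  then have u: "u \<in> Linf T" and "Linf_norm T u \<le> ereal m\<^sub>2"
    by (auto simp: W2inf_def W2inf_norm_def)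
  then obtain u' where u': "borel_rep T u u'" "\<And>s. \<bar>u' s\<bar> \<le> m\<^sub>2"
    using Linf_bounded_borel_rep assms(4) by (metis less_imp_le)
  interpret bounded_solution T \<gamma> m\<^sub>2 u'
    using assms u' by unfold_locales (auto simp: borel_rep_def)
  have g: "g = G" using * op_A_zero_extension[OF u'(1)] by auto
  have d: "g\<delta> \<delta> \<in> borel_measurable (lebesgue_on {0..})" "0 \<le> t \<Longrightarrow> \<bar>g\<delta> \<delta> t - G t\<bar> \<le> \<delta>"
    if "0 < \<delta>" for \<delta> t using * that unfolding g by auto
  have "u \<in> borel_measurable (I_meas T)" using u by (simp add: Linf_def)
  then show "(\<forall>\<delta>>0. R1_op \<gamma> m\<^sub>2 \<delta> (g\<delta> \<delta>) \<in> L2 T) \<and>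
      ((\<lambda>\<delta>. L2_norm T (\<lambda>t. R1_op \<gamma> m\<^sub>2 \<delta> (g\<delta> \<delta>) t - u t)) \<longlongrightarrow> 0) (at_right 0)"
    using R1_op_L2[OF _ d] R1_op_convergence[OF u'(1) _ d] by blast
qed

theorem theorem3p2:
  fixes T \<gamma> m\<^sub>2 :: real and m :: "real \<Rightarrow> real"
  assumes "0 < T" and "0 < \<gamma>" and "\<gamma> < 1" and "0 < m\<^sub>2"
    and "C1_on_interval T m"
  shows "regularizer T (op_A \<gamma>) m\<^sub>2 (R1_op \<gamma> m\<^sub>2) \<and>
         L2_compact_operator T (op_S T \<gamma> m) \<and>
         L2_null_space T (\<lambda>u t. u t + op_S T \<gamma> m u t) = L2_zero T"
proof -
  obtain m' where "\<forall>t\<in>{0..T}. (m has_real_derivative m' t) (at t within {0..T})" "continuous_on {0..T} m'"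
    using assms(5) unfolding C1_on_interval_def by blast
  then interpret C1_kernel T \<gamma> m m'
    using assms by unfold_locales auto
  show ?thesis using regularizer_R1_op[OF assms(1-4)] op_S_compact op_S_null_space by blast
qed

end
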